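(* Let $\mathscr{A}\subseteq(2\mathbb{N})^n$ be finite, let $\mathscr{B}_1\subseteq\mathrm{conv}(\mathscr{A})\cap(2\mathbb{N})^n$ and $\mathscr{B}_2\subseteq\mathrm{conv}(\mathscr{A})\cap(\mathbb{N}^n\setminus(2\mathbb{N})^n)$, with $\mathscr{A}\cap\mathscr{B}_1=\varnothing$. Then the convex cone $\mathrm{SONC}_{\mathscr{A},\mathscr{B}_1,\mathscr{B}_2}$ admits a second-order cone representation.
   Context: $\mathbb{N}$ denotes the nonnegative integers, $2\mathbb{N}$ the even ones, and $\mathrm{conv}$ the convex hull. For $\mathbf{x}=(x_1,\dots,x_n)$ and $\alpha\in\mathbb{N}^n$, $\mathbf{x}^\alpha=x_1^{\alpha_1}\cdots x_n^{\alpha_n}$. Circuit polynomial: a polynomial in $\mathbb{R}[\mathbf{x}]$ of the form $\sum_{\alpha\in\mathscr{T}}c_\alpha\mathbf{x}^\alpha-d\,\mathbf{x}^\beta$, where $\mathscr{T}\subseteq(2\mathbb{N})^n$ is the vertex set of a simplex (of any dimension), $c_\alpha>0$ for all $\alpha\in\mathscr{T}$, $d\in\mathbb{R}$, and $\beta\in\mathbb{N}^n$ lies in the relative interior of $\mathrm{conv}(\mathscr{T})$. A nonnegative circuit polynomial is a circuit polynomial that is nonnegative on $\mathbb{R}^n$; by convention a monomial square $c\,\mathbf{x}^\alpha$ ($c\ge 0$, $\alpha\in(2\mathbb{N})^n$) is also regarded as a nonnegative circuit polynomial. $\mathrm{SONC}$ is the set of all finite sums of nonnegative circuit polynomials. Define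 $$\mathrm{SONC}_{\mathscr{A},\mathscr{B}_1,\mathscr{B}_2}:=\Big\{(\mathbf{c}_{\mathscr{A}},\mathbf{d}_{\mathscr{B}_1},\mathbf{d}_{\mathscr{B}_2})\in\mathbb{R}_{\ge0}^{|\mathscr{A}|}\times\mathbb{R}_{\ge0}^{|\mathscr{B}_1|}\times\mathbb{R}^{|\mathscr{B}_2|}\ \Big|\ \sum_{\alpha\in\mathscr{A}}c_\alpha\mathbf{x}^\alpha-\sum_{\beta\in\mathscr{B}_1\cup\mathscr{B}_2}d_\beta\mathbf{x}^\beta\in\mathrm{SONC}\Big\},$$ where $\mathbf{c}_{\mathscr{A}}=(c_\alpha)_{\alpha\in\mathscr{A}}$ and $\mathbf{d}_{\mathscr{B}_i}=(d_\beta)_{\beta\in\mathscr{B}_i}$ for $i=1,2$. The $N$-dimensional (rotated) second-order cone is $\mathbf{K}^N:=\{a\in\mathbb{R}^N\mid 2a_1a_2\ge\sum_{i=3}^N a_i^2,\ a_1\ge0,\ a_2\ge0\}$. For a second-order cone $\mathcal{Q}\subseteq\mathbb{R}^N$ let $\mathcal{Q}^k=\mathcal{Q}\times\cdots\times\mathcal{Q}$ ($k$ copies). A convex cone $C\subseteq\mathbb{R}^m$ has a $\mathcal{Q}^k$-lift if there are a linear subspace $L$ of the ambient space $(\mathbb{R}^N)^k$ of $\mathcal{Q}^k$ and a linear map $\pi:(\mathbb{R}^N)^k\to\mathbb{R}^m$ such that $C=\pi(\mathcal{Q}^k\cap L)$. A convex cone admits a second-order cone representation if it has a $\mathcal{Q}^k$-lift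 for some second-order cone $\mathcal{Q}$ and some $k\in\mathbb{N}$. *)

theory Defs
  imports "HOL-Analysis.Analysis" "HOL-Analysis.Finite_Function_Topology"
begin

text \<open>
  Exponents are elements of \<^typ>\<open>nat ^ 'n\<close>, where \<open>n = CARD('n)\<close>. A polynomial in
  \<open>n\<close> variables with real coefficients is a finitely supported map from exponents to
  coefficients; \<^term>\<open>Poly_Mapping.single \<alpha> c\<close> is the term with coefficient \<open>c\<close> and
  exponent \<open>\<alpha>\<close>.
\<close>

type_synonym 'n exponent = "nat ^ 'n"
type_synonym 'n rpoly = "(nat ^ 'n) \<Rightarrow>\<^sub>0 real"

definition real_exp :: "'n::finite exponent \<Rightarrow> real ^ 'n" where
  "real_exp \<alpha> = (\<chi> i. real (\<alpha> $ i))"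

definition even_exps :: "'n::finite exponent set" where
  "even_exps = {\<alpha>. \<forall>i. even (\<alpha> $ i)}"

definition newton :: "'n::finite exponent set \<Rightarrow> (real ^ 'n) set" where
  "newton T = convex hull (real_exp ` T)"

definition eval_poly :: "'n::finite rpoly \<Rightarrow> real ^ 'n \<Rightarrow> real" where
  "eval_poly p x =
     (\<Sum>\<alpha>\<in>Poly_Mapping.keys p. Poly_Mapping.lookup p \<alpha> * (\<Prod>i\<in>UNIV. (x $ i) ^ (\<alpha> $ i)))"

definition nonneg_poly :: "'n::finite rpoly \<Rightarrow> bool" where
  "nonneg_poly p \<longleftrightarrow> (\<forall>x. 0 \<le> eval_poly p x)"

text \<open>
  A simplex is the convex hull of a nonempty (automatically finite) affinely independent
  set, which is then its set of vertices; compare \<^const>\<open>simplex\<close>. Single points, the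
  simplices of dimension 0, are included.
\<close>

definition simplex_vertices :: "'n::finite exponent set \<Rightarrow> bool" where
  "simplex_vertices T \<longleftrightarrow> finite T \<and> T \<noteq> {} \<and> \<not> affine_dependent (real_exp ` T)"

definition circuit_poly :: "'n::finite rpoly \<Rightarrow> bool" where
  "circuit_poly p \<longleftrightarrow>
     (\<exists>T c d \<beta>. T \<subseteq> even_exps \<and> simplex_vertices T \<and> (\<forall>\<alpha>\<in>T. 0 < c \<alpha>)
        \<and> real_exp \<beta> \<in> rel_interior (newton T)
        \<and> p = (\<Sum>\<alpha>\<in>T. Poly_Mapping.single \<alpha> (c \<alpha>)) - Poly_Mapping.single \<beta> d)"

definition monomial_square :: "'n::finite rpoly \<Rightarrow> bool" where
  "monomial_square p \<longleftrightarrow> (\<exists>c \<alpha>. 0 \<le> c \<and> \<alpha> \<in> even_exps \<and> p = Poly_Mapping.single \<alpha> c)"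

definition nonneg_circuit :: "'n::finite rpoly \<Rightarrow> bool" where
  "nonneg_circuit p \<longleftrightarrow> circuit_poly p \<and> nonneg_poly p \<or> monomial_square p"

definition SONC :: "'n::finite rpoly set" where
  "SONC = {sum_list ps | ps. \<forall>p\<in>set ps. nonneg_circuit p}"

text \<open>
  For a finite set \<open>I\<close> the space of real vectors indexed by \<open>I\<close> is rendered as the
  subspace of the finitely supported maps that vanish outside \<open>I\<close>. This keeps the
  library notions of linear map, subspace and convex cone available although \<open>I\<close> is
  not a type.
\<close>

definition coord_space :: "'i set \<Rightarrow> ('i \<Rightarrow>\<^sub>0 real) set" where
  "coord_space I = {v. Poly_Mapping.keys v \<subseteq> I}"

definition SONC_ambient ::
  "'n::finite exponent set \<Rightarrow> 'n exponent set \<Rightarrow> 'n exponent set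
    \<Rightarrow> (('n exponent \<Rightarrow>\<^sub>0 real) \<times> ('n exponent \<Rightarrow>\<^sub>0 real) \<times> ('n exponent \<Rightarrow>\<^sub>0 real)) set" where
  "SONC_ambient A B1 B2 = coord_space A \<times> coord_space B1 \<times> coord_space B2"

text \<open>
  The sum over \<open>B1 \<union> B2\<close> is split into two sums: the exponents in \<open>B1\<close> are even and those
  in \<open>B2\<close> are not, so the two sets are disjoint.
\<close>

definition SONC_cone ::
  "'n::finite exponent set \<Rightarrow> 'n exponent set \<Rightarrow> 'n exponent set
    \<Rightarrow> (('n exponent \<Rightarrow>\<^sub>0 real) \<times> ('n exponent \<Rightarrow>\<^sub>0 real) \<times> ('n exponent \<Rightarrow>\<^sub>0 real)) set" where
  "SONC_cone A B1 B2 =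
     {(c, d1, d2) \<in> SONC_ambient A B1 B2.
        (\<forall>\<alpha>\<in>A. 0 \<le> Poly_Mapping.lookup c \<alpha>) \<and>
        (\<forall>\<beta>\<in>B1. 0 \<le> Poly_Mapping.lookup d1 \<beta>) \<and>
        (\<Sum>\<alpha>\<in>A. Poly_Mapping.single \<alpha> (Poly_Mapping.lookup c \<alpha>))
          - ((\<Sum>\<beta>\<in>B1. Poly_Mapping.single \<beta> (Poly_Mapping.lookup d1 \<beta>))
             + (\<Sum>\<beta>\<in>B2. Poly_Mapping.single \<beta> (Poly_Mapping.lookup d2 \<beta>))) \<in> SONC}"

definition soc :: "nat \<Rightarrow> (nat \<Rightarrow>\<^sub>0 real) set" where
  "soc N = {a \<in> coord_space {1..N}.
     (\<Sum>i=3..N. (Poly_Mapping.lookup a i)\<^sup>2) \<le> 2 * Poly_Mapping.lookup a 1 * Poly_Mapping.lookup a 2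
     \<and> 0 \<le> Poly_Mapping.lookup a 1 \<and> 0 \<le> Poly_Mapping.lookup a 2}"

text \<open>The \<open>k\<close>-fold Cartesian power of a set, with the factors indexed by \<open>1, \<dots>, k\<close>.\<close>

definition cart_power :: "nat \<Rightarrow> 'b::zero set \<Rightarrow> (nat \<Rightarrow>\<^sub>0 'b) set" where
  "cart_power k X =
     {v. Poly_Mapping.keys v \<subseteq> {1..k} \<and> (\<forall>j\<in>{1..k}. Poly_Mapping.lookup v j \<in> X)}"

text \<open>
  \<open>V\<close> is the ambient space of the cone \<open>C\<close>. The map \<open>\<pi>\<close> is total, but only its values on
  the ambient space of the \<open>k\<close>-th power of \<^term>\<open>soc N\<close> matter; every linear map defined
  on that subspace extends to a total one.
\<close>

definition has_soc_lift :: "nat \<Rightarrow> nat \<Rightarrow> 'v::real_vector set \<Rightarrow> 'v set \<Rightarrow> bool" where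
  "has_soc_lift N k V C \<longleftrightarrow>
     (\<exists>L \<pi>. subspace L \<and> L \<subseteq> cart_power k (coord_space {1..N})
        \<and> linear \<pi> \<and> \<pi> ` cart_power k (coord_space {1..N}) \<subseteq> V
        \<and> C = \<pi> ` (cart_power k (soc N) \<inter> L))"

definition admits_soc_representation :: "'v::real_vector set \<Rightarrow> 'v set \<Rightarrow> bool" where
  "admits_soc_representation V C \<longleftrightarrow>
     convex_cone C \<and> C \<subseteq> V \<and> (\<exists>N k. 2 \<le> N \<and> has_soc_lift N k V C)"

end

(*
A SONC polynomial is a sum of nonnegative polynomials f_b, each with at most one coefficient that is
negative or belongs to an odd exponent. Redistributing a summand f_g with a negative coefficient at g
over the other summands removes all cancellation at g, so that eventually the decomposition only uses
exponents of the given support (this is the argument of Murray, Chandrasekaran and Wierman for SAGE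
certificates). After the substitution x = exp y, the minimum condition for the resulting exponential
sums, together with a conic Caratheodory argument, splits each f_b into circuit polynomials with
vertices in A. The barycentric coordinates of a circuit are rational, so nonnegativity of a circuit
polynomial is an inequality d^M <= prod u_a^(m_a) with integer exponents, which a binary tree of
inequalities z^2 <= x y turns into second-order cone constraints. Hence the cone is a finite Minkowski
sum of second-order cone representable cones.
*)
theory Submission
  imports Defs "HOL-Library.Set_Algebras"
begin

section \<open>Second-order cone lifts\<close>

text \<open>The summands of a SONC decomposition may involve arbitrary exponents, so nothing bounds
  the number of circuits a priori. Once a summand lives on \<open>A\<close> and a single further
  exponent \<beta>, only the finitely many affinely independent subsets of \<open>A\<close> matter,
  and on each of them the weights are determined up to scaling; one integer vector \<open>m\<close>
  per subset is enough. A circuit polynomial is normalised as the sum of (m \<alpha> / M) u \<alpha>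
  x^\<alpha> minus \<sigma> d x^\<beta>, with M the sum of the m \<alpha> and \<sigma> a sign. In
  the coordinates u the weights drop out of the constants in the nonnegativity condition, leaving
  d^M \<le> prod u \<alpha>^(m \<alpha>). The splitting need not be exact: the pieces may use less
  than the available coefficient at each \<alpha>, and the surplus is absorbed by rays, one for each
  monomial square x^\<alpha>. An odd \<beta> admits both signs of its coefficient, hence two
  opposite directions; an even one in \<open>B1\<close> admits only one.\<close>

lemma lookup_scaleR [simp]:
  "Poly_Mapping.lookup (r *\<^sub>R p) k = r *\<^sub>R Poly_Mapping.lookup p k"
  for p :: "'a \<Rightarrow>\<^sub>0 'b::real_vector"
proof -
  have "finite {i. r *\<^sub>R Poly_Mapping.lookup p i \<noteq> 0}"
    by (rule finite_subset[OF _ finite_keys[of p]]) (auto simp: in_keys_iff)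
  then show ?thesis
    by (simp add: scaleR_poly_mapping_def)
qed

lemma single_scaleR: "Poly_Mapping.single k (r *\<^sub>R x) = r *\<^sub>R Poly_Mapping.single k x"
  for x :: "'b::real_vector"
  by (rule poly_mapping_eqI) (simp add: lookup_single when_def)

lemma linear_single: "linear (\<lambda>x. Poly_Mapping.single k x)"
  by (rule linearI) (simp_all add: single_add single_scaleR)

lemma mem_coord_space_iff: "v \<in> coord_space I \<longleftrightarrow> (\<forall>i. i \<notin> I \<longrightarrow> Poly_Mapping.lookup v i = 0)"
  by (auto simp: coord_space_def in_keys_iff)

lemma subspace_coord_space: "subspace (coord_space I)"
  by (auto simp: subspace_def mem_coord_space_iff lookup_add)

lemma mem_soc_3_iff:
  "a \<in> soc 3 \<longleftrightarrow> a \<in> coord_space {1..3}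
     \<and> (Poly_Mapping.lookup a 3)\<^sup>2 \<le> 2 * Poly_Mapping.lookup a 1 * Poly_Mapping.lookup a 2
     \<and> 0 \<le> Poly_Mapping.lookup a 1 \<and> 0 \<le> Poly_Mapping.lookup a 2"
  by (simp add: soc_def)

text \<open>This is \<open>soc 3\<close> on triples, so that constraints can be given as linear maps
  into a product type instead of finitely supported maps.\<close>

definition rotated_cone3 :: "(real \<times> real \<times> real) set" where
  "rotated_cone3 = {(a, b, c). c\<^sup>2 \<le> 2 * a * b \<and> 0 \<le> a \<and> 0 \<le> b}"

text \<open>The kernel condition makes \<open>\<pi> z\<close> a function of the values \<open>q j z\<close>, which are the coordinates
  of the lift.\<close>

lemma has_soc_lift_constraints:
  fixes q :: "nat \<Rightarrow> 'z::real_vector \<Rightarrow> real \<times> real \<times> real" and \<pi> :: "'z \<Rightarrow> 'v::real_vector"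
  assumes L: "subspace L" and q: "\<And>j. j \<in> {1..k} \<Longrightarrow> linear (q j)" and \<pi>: "linear \<pi>"
    and V: "\<pi> ` L \<subseteq> V"
    and ker: "\<And>z. z \<in> L \<Longrightarrow> (\<And>j. j \<in> {1..k} \<Longrightarrow> q j z = 0) \<Longrightarrow> \<pi> z = 0"
  shows "has_soc_lift 3 k V (\<pi> ` {z \<in> L. \<forall>j\<in>{1..k}. q j z \<in> rotated_cone3})"
proof -
  define e :: "real \<times> real \<times> real \<Rightarrow> (nat \<Rightarrow>\<^sub>0 real)" where
    "e = (\<lambda>p. Poly_Mapping.single 1 (fst p) + Poly_Mapping.single 2 (fst (snd p))
            + Poly_Mapping.single 3 (snd (snd p)))"
  define \<Phi> :: "'z \<Rightarrow> (nat \<Rightarrow>\<^sub>0 (nat \<Rightarrow>\<^sub>0 real))" where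
    "\<Phi> = (\<lambda>z. \<Sum>j\<in>{1..k}. Poly_Mapping.single j (e (q j z)))"
  have e_lookup: "Poly_Mapping.lookup (e p) 1 = fst p" "Poly_Mapping.lookup (e p) 2 = fst (snd p)"
    "Poly_Mapping.lookup (e p) 3 = snd (snd p)" for p
    by (simp_all add: e_def lookup_add lookup_single)
  have e_coord: "e p \<in> coord_space {1..3}" for p
    by (auto simp: e_def mem_coord_space_iff lookup_add lookup_single when_def)
  have e_soc: "e p \<in> soc 3 \<longleftrightarrow> p \<in> rotated_cone3" for p
    using e_coord[of p] e_lookup[of p]
    by (auto simp: mem_soc_3_iff rotated_cone3_def split: prod.splits)
  have lin_e: "linear e"
    unfolding e_def
    by (intro linear_compose_add linear_compose[OF _ linear_single, unfolded o_def]
        linear_compose[OF linear_snd linear_fst, unfolded o_def]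
        linear_compose[OF linear_snd linear_snd, unfolded o_def] linear_fst)
  have lin_\<Phi>: "linear \<Phi>"
    unfolding \<Phi>_def
    by (intro linear_compose_sum ballI linear_compose[OF _ linear_single, unfolded o_def]
        linear_compose[OF _ lin_e, unfolded o_def]) (use q in auto)
  have \<Phi>_lookup: "Poly_Mapping.lookup (\<Phi> z) j = (if j \<in> {1..k} then e (q j z) else 0)" for z j
    by (simp add: \<Phi>_def lookup_sum lookup_single when_def)
  have e0: "e p = 0 \<longleftrightarrow> p = 0" for p
  proof
    assume "e p = 0"
    then have "fst p = 0" "fst (snd p) = 0" "snd (snd p) = 0"
      using e_lookup[of p] by auto
    then show "p = 0"
      by (simp add: prod_eq_iff)
  next
    show "p = 0 \<Longrightarrow> e p = 0"
      by (simp add: e_def)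
  qed
  \<comment> \<open>\<open>\<Phi>\<close> need not be injective on \<open>L\<close>. The linear
    section \<open>g\<close> takes all its values in \<open>L\<close>, even off the image, so
    \<open>\<pi>'\<close> maps the whole space into \<open>V\<close>.\<close>
  obtain g where g: "range g \<subseteq> L" "linear g" "\<And>y. y \<in> \<Phi> ` L \<Longrightarrow> \<Phi> (g y) = y"
    using linear_exists_right_inverse_on[OF lin_\<Phi> L] by auto
  define \<pi>' where "\<pi>' = \<pi> \<circ> g"
  have \<pi>'_\<Phi>: "\<pi>' (\<Phi> z) = \<pi> z" if z: "z \<in> L" for z
  proof -
    have "\<Phi> (g (\<Phi> z) - z) = 0"
      using g(3) z by (simp add: linear_diff[OF lin_\<Phi>])
    then have "q j (g (\<Phi> z) - z) = 0" if "j \<in> {1..k}" for j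
      using \<Phi>_lookup[of "g (\<Phi> z) - z" j] that e0 by simp
    moreover have "g (\<Phi> z) - z \<in> L"
      using g(1) z L by (blast intro: subspace_diff)
    ultimately have "\<pi> (g (\<Phi> z) - z) = 0"
      using ker by blast
    then show ?thesis
      by (simp add: \<pi>'_def linear_diff[OF \<pi>])
  qed
  have keys: "Poly_Mapping.keys (\<Phi> z) \<subseteq> {1..k}" for z
    using \<Phi>_lookup[of z] by (auto simp: in_keys_iff simp del: atLeastAtMost_iff split: if_splits)
  have cart: "\<Phi> z \<in> cart_power k (soc 3) \<longleftrightarrow> (\<forall>j\<in>{1..k}. q j z \<in> rotated_cone3)" for z
    using keys[of z] by (simp add: cart_power_def \<Phi>_lookup e_soc)
  have "\<pi> ` {z \<in> L. \<forall>j\<in>{1..k}. q j z \<in> rotated_cone3}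
      = \<pi>' ` (cart_power k (soc 3) \<inter> \<Phi> ` L)" (is "?S = ?R")
  proof
    show "?S \<subseteq> ?R"
      using cart \<pi>'_\<Phi> by (force intro!: image_eqI)
    show "?R \<subseteq> ?S"
      using cart \<pi>'_\<Phi> by (auto intro!: imageI)
  qed
  moreover have "subspace (\<Phi> ` L)"
    by (rule linear_subspace_image[OF lin_\<Phi> L])
  moreover have "\<Phi> ` L \<subseteq> cart_power k (coord_space {1..3})"
  proof clarify
    fix z
    show "\<Phi> z \<in> cart_power k (coord_space {1..3})"
      unfolding cart_power_def using keys[of z] e_coord by (simp add: \<Phi>_lookup del: One_nat_def)
  qed
  moreover have "linear \<pi>'"
    unfolding \<pi>'_def by (rule linear_compose[OF g(2) \<pi>])
  moreover have "range \<pi>' \<subseteq> V"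
    using V g(1) by (auto simp: \<pi>'_def)
  ultimately show ?thesis
    unfolding has_soc_lift_def by blast
qed

text \<open>Fixing N = 3 lets the lifts of two cones be joined into one power of the same cone;
  products of two variables are all that is needed here.\<close>

definition soc3_representable :: "'v::real_vector set \<Rightarrow> 'v set \<Rightarrow> bool" where
  "soc3_representable V C \<longleftrightarrow> (\<exists>k. has_soc_lift 3 k V C)"

lemma soc3_representable_zero:
  assumes "subspace V"
  shows "soc3_representable V {0}"
proof -
  have "has_soc_lift 3 0 V ((\<lambda>z::real. 0) ` {z \<in> {0}. \<forall>j\<in>{1..0::nat}. (\<lambda>_ _. 0) j z \<in> rotated_cone3})"
    by (rule has_soc_lift_constraints) (auto simp: subspace_0[OF assms] linear_iff subspace_def)
  then show ?thesis
    by (auto simp: soc3_representable_def)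
qed

text \<open>The triple \<open>(t, 0, 0)\<close> lies in the rotated cone exactly when
  \<open>0 \<le> t\<close>, so a single factor encodes a linear inequality.\<close>

lemma soc3_representable_ray:
  assumes V: "subspace V" and v: "v \<in> V"
  shows "soc3_representable V {t *\<^sub>R v | t. 0 \<le> t}"
proof -
  have "has_soc_lift 3 1 V ((\<lambda>t. t *\<^sub>R v) `
      {t \<in> UNIV. \<forall>j\<in>{1..1::nat}. (\<lambda>_ t. (t, 0, 0)) j t \<in> rotated_cone3})"
    by (rule has_soc_lift_constraints)
      (auto simp: linear_iff algebra_simps zero_prod_def intro: subspace_scale[OF V v])
  moreover have "(\<lambda>t. t *\<^sub>R v) ` {t \<in> UNIV. \<forall>j\<in>{1..1::nat}. (t, 0, 0) \<in> rotated_cone3}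
      = {t *\<^sub>R v | t. 0 \<le> t}"
    by (auto simp: rotated_cone3_def)
  ultimately show ?thesis
    by (auto simp: soc3_representable_def)
qed

text \<open>The product of two lifts is a lift of the Minkowski sum: factors 1 to k carry the first,
  factors k + 1 to k + l the second, and the two linear maps are added.\<close>

lemma soc3_representable_plus:
  assumes V: "subspace V" and C: "soc3_representable V C" and D: "soc3_representable V D"
  shows "soc3_representable V (C + D)"
proof -
  obtain k L f where 1: "subspace L" "L \<subseteq> cart_power k (coord_space {1..3})" "linear f"
     "f ` cart_power k (coord_space {1..3}) \<subseteq> V" "C = f ` (cart_power k (soc 3) \<inter> L)"
    using C unfolding soc3_representable_def has_soc_lift_def by blast
  obtain l M g where 2: "subspace M" "M \<subseteq> cart_power l (coord_space {1..3})" "linear g"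
     "g ` cart_power l (coord_space {1..3}) \<subseteq> V" "D = g ` (cart_power l (soc 3) \<inter> M)"
    using D unfolding soc3_representable_def has_soc_lift_def by blast
  define c :: "(nat \<Rightarrow>\<^sub>0 real) \<Rightarrow> real \<times> real \<times> real" where
    "c a = (Poly_Mapping.lookup a 1, Poly_Mapping.lookup a 2, Poly_Mapping.lookup a 3)" for a
  define q where "q j z = c (if j \<le> k then Poly_Mapping.lookup (fst z) j
      else Poly_Mapping.lookup (snd z) (j - k))"
    for j and z :: "(nat \<Rightarrow>\<^sub>0 (nat \<Rightarrow>\<^sub>0 real)) \<times> (nat \<Rightarrow>\<^sub>0 (nat \<Rightarrow>\<^sub>0 real))"
  have lin_q: "linear (q j)" for j
    by (auto intro!: linearI simp: q_def c_def lookup_add)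
  \<comment> \<open>On the ambient space the triple determines \<open>a\<close>; the kernel
    condition of the lift rests on this.\<close>
  have c0: "a = 0" if "c a = 0" "a \<in> coord_space {1..3}" for a
  proof (rule poly_mapping_eqI)
    fix i :: nat
    consider "i = 1" | "i = 2" | "i = 3" | "i \<notin> {1..3}"
      by fastforce
    then show "Poly_Mapping.lookup a i = Poly_Mapping.lookup 0 i"
      by cases (use that in \<open>auto simp: c_def mem_coord_space_iff zero_prod_def
            simp del: atLeastAtMost_iff\<close>)
  qed
  have c_soc: "c a \<in> rotated_cone3 \<longleftrightarrow> a \<in> soc 3" if "a \<in> coord_space {1..3}" for a
    using that by (auto simp: mem_soc_3_iff rotated_cone3_def c_def)
  have split: "(\<forall>j\<in>{1..k+l}. P j) \<longleftrightarrow> (\<forall>j\<in>{1..k}. P j) \<and> (\<forall>j\<in>{1..l}. P (k + j))" for P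
  proof -
    have "{1..k+l} = {1..k} \<union> (+) k ` {1..l}"
      unfolding image_add_atLeastAtMost by auto
    then show ?thesis
      by (simp only: ball_Un ball_simps(9))
  qed
  have q_iff: "(\<forall>j\<in>{1..k+l}. R (q j z)) \<longleftrightarrow>
      (\<forall>j\<in>{1..k}. R (c (Poly_Mapping.lookup (fst z) j))) \<and>
      (\<forall>j\<in>{1..l}. R (c (Poly_Mapping.lookup (snd z) j)))" for R z
    unfolding split by (simp add: q_def del: One_nat_def)
  have pm0: "y = 0" if "y \<in> cart_power m (coord_space {1..3})"
    "\<forall>j\<in>{1..m}. c (Poly_Mapping.lookup y j) = 0" for y m
  proof (rule poly_mapping_eqI)
    fix j
    show "Poly_Mapping.lookup y j = Poly_Mapping.lookup 0 j"
    proof (cases "j \<in> {1..m}")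
      case True
      then show ?thesis
        using that c0[of "Poly_Mapping.lookup y j"] by (simp add: cart_power_def)
    next
      case False
      then show ?thesis
        using that(1) by (metis (mono_tags, lifting) cart_power_def in_keys_iff lookup_zero
            mem_Collect_eq subset_iff)
    qed
  qed
  have soc_iff: "(\<forall>j\<in>{1..m}. c (Poly_Mapping.lookup y j) \<in> rotated_cone3)
      \<longleftrightarrow> y \<in> cart_power m (soc 3)" if "y \<in> cart_power m (coord_space {1..3})" for y m
    using that c_soc by (simp add: cart_power_def del: atLeastAtMost_iff One_nat_def)
  have "has_soc_lift 3 (k + l) V ((\<lambda>z. f (fst z) + g (snd z)) `
      {z \<in> L \<times> M. \<forall>j\<in>{1..k+l}. q j z \<in> rotated_cone3})"
  proof (rule has_soc_lift_constraints)
    show "subspace (L \<times> M)"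
      by (rule subspace_Times[OF 1(1) 2(1)])
    show "linear (\<lambda>z. f (fst z) + g (snd z))"
      by (intro linear_compose_add linear_compose[OF linear_fst 1(3), unfolded o_def]
          linear_compose[OF linear_snd 2(3), unfolded o_def])
    show "(\<lambda>z. f (fst z) + g (snd z)) ` (L \<times> M) \<subseteq> V"
    proof clarify
      fix y z assume "y \<in> L" "z \<in> M"
      then have "f y \<in> V" "g z \<in> V"
        using 1(2,4) 2(2,4) by blast+
      then show "f (fst (y, z)) + g (snd (y, z)) \<in> V"
        by (simp add: subspace_add[OF V])
    qed
    show "f (fst z) + g (snd z) = 0"
      if "z \<in> L \<times> M" "\<And>j. j \<in> {1..k+l} \<Longrightarrow> q j z = 0" for z
    proof -
      have "fst z \<in> cart_power k (coord_space {1..3})" "snd z \<in> cart_power l (coord_space {1..3})"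
        using that(1) 1(2) 2(2) by auto
      moreover have "\<forall>j\<in>{1..k+l}. q j z = 0"
        using that(2) by blast
      ultimately have "fst z = 0" "snd z = 0"
        using pm0 unfolding q_iff[of "\<lambda>x. x = 0" z] by blast+
      then show ?thesis
        by (simp add: linear_0[OF 1(3)] linear_0[OF 2(3)])
    qed
  qed (rule lin_q)
  moreover have "{z \<in> L \<times> M. \<forall>j\<in>{1..k+l}. q j z \<in> rotated_cone3}
      = (cart_power k (soc 3) \<inter> L) \<times> (cart_power l (soc 3) \<inter> M)"
    using 1(2) 2(2) soc_iff unfolding q_iff[where R = "\<lambda>x. x \<in> rotated_cone3"]
    by (force simp del: atLeastAtMost_iff One_nat_def)
  moreover have "(\<lambda>z. f (fst z) + g (snd z)) ` (X \<times> Y) = f ` X + g ` Y" for X Y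
    unfolding set_plus_image by force
  ultimately have "has_soc_lift 3 (k + l) V (C + D)"
    unfolding 1(5) 2(5) by simp
  then show ?thesis
    by (auto simp: soc3_representable_def)
qed

lemma soc3_representable_sum:
  assumes "subspace V" "\<And>i. i \<in> I \<Longrightarrow> soc3_representable V (C i)"
  shows "soc3_representable V (\<Sum>i\<in>I. C i)"
  using assms(2)
proof (induction I rule: infinite_finite_induct)
  case (insert i I)
  then show ?case
    by (simp add: soc3_representable_plus[OF assms(1)])
qed (simp_all add: soc3_representable_zero[OF assms(1)])

section \<open>Cones of geometric means\<close>

text \<open>In heap numbering the nodes from 2a to 2b - 1 are the children of the nodes from a to b
  - 1, so this groups the product over one level by parents.\<close>

lemma prod_double_interval:
  fixes f :: "nat \<Rightarrow> 'a::comm_monoid_mult"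
  shows "prod f {2 * a..<2 * b} = (\<Prod>i=a..<b. f (2 * i) * f (2 * i + 1))"
proof (induction b)
  case (Suc b)
  show ?case
  proof (cases "a \<le> b")
    case True
    then have "{2 * a..<2 * Suc b} = insert (2 * b + 1) (insert (2 * b) {2 * a..<2 * b})"
      by auto
    then have "prod f {2 * a..<2 * Suc b} = f (2 * b + 1) * (f (2 * b) * prod f {2 * a..<2 * b})"
      by simp
    also have "\<dots> = prod f {2 * a..<2 * b} * (f (2 * b) * f (2 * b + 1))"
      by (simp only: mult.commute mult.left_commute)
    finally show ?thesis
      using True by (simp add: Suc.IH)
  qed simp
qed simp

text \<open>Level r consists of the nodes from 2^r to 2^(r+1) - 1. Squaring the bound for one level
  and applying the inequality at each of its nodes gives the bound for the next level.\<close>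

lemma heap_root_power_le:
  fixes v :: "nat \<Rightarrow> real"
  assumes "\<And>i. i \<in> {1..<2 ^ r} \<Longrightarrow> (v i)\<^sup>2 \<le> v (2 * i) * v (2 * i + 1)"
    and "\<And>i. i \<in> {1..<2 ^ Suc r} \<Longrightarrow> 0 \<le> v i"
  shows "v 1 ^ 2 ^ r \<le> (\<Prod>i=2 ^ r..<2 ^ Suc r. v i)"
  using assms
proof (induction r)
  case (Suc r)
  have "v 1 ^ 2 ^ Suc r = (v 1 ^ 2 ^ r)\<^sup>2"
    by (simp add: power_mult[symmetric] mult.commute)
  also have "\<dots> \<le> (\<Prod>i=2 ^ r..<2 ^ Suc r. v i)\<^sup>2"
    using Suc one_less_power[of "2::nat" "Suc (Suc r)"]
    by (intro power_mono Suc.IH zero_le_power Suc.prems(2)) auto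
  also have "\<dots> = (\<Prod>i=2 ^ r..<2 ^ Suc r. (v i)\<^sup>2)"
    by (rule prod_power_distrib)
  also have "\<dots> \<le> (\<Prod>i=2 ^ r..<2 ^ Suc r. v (2 * i) * v (2 * i + 1))"
  proof (intro prod_mono conjI)
    fix i :: nat assume "i \<in> {2 ^ r..<2 ^ Suc r}"
    moreover have "(1::nat) \<le> 2 ^ r"
      by simp
    ultimately show "(v i)\<^sup>2 \<le> v (2 * i) * v (2 * i + 1)"
      using Suc.prems(1)[of i] by auto
  qed simp
  also have "\<dots> = (\<Prod>i=2 ^ Suc r..<2 ^ Suc (Suc r). v i)"
    using prod_double_interval[of v "2 ^ r" "2 ^ Suc r"] by simp
  finally show ?case .
qed (simp add: numeral_2_eq_2)

text \<open>The heap is filled from the leaves upwards, each inner node receiving the geometric mean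
  of its children. Then every estimate of the preceding lemma is an equality, so the root attains
  the bound.\<close>

lemma heap_fill_geometric_mean:
  fixes w :: "nat \<Rightarrow> real"
  assumes "\<And>i. i \<in> {2 ^ r..<2 ^ Suc r} \<Longrightarrow> 0 \<le> w i"
  shows "\<exists>v. (\<forall>i\<in>{1..<2 ^ Suc r}. 0 \<le> v i) \<and> (\<forall>i\<in>{2 ^ r..<2 ^ Suc r}. v i = w i)
    \<and> (\<forall>i\<in>{1..<2 ^ r}. (v i)\<^sup>2 = v (2 * i) * v (2 * i + 1))
    \<and> v 1 ^ 2 ^ r = (\<Prod>i=2 ^ r..<2 ^ Suc r. w i)"
  using assms
proof (induction r arbitrary: w)
  case 0
  then show ?case
    by (intro exI[of _ w]) (auto simp: numeral_2_eq_2)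
next
  case (Suc r)
  define w' where "w' i = sqrt (w (2 * i) * w (2 * i + 1))" for i
  have w'_sq: "(w' i)\<^sup>2 = w (2 * i) * w (2 * i + 1)" and w'_nonneg: "0 \<le> w' i"
    if "i \<in> {2 ^ r..<2 ^ Suc r}" for i
  proof -
    have "0 \<le> w (2 * i)" "0 \<le> w (2 * i + 1)"
      using that by (auto intro!: Suc.prems)
    then show "(w' i)\<^sup>2 = w (2 * i) * w (2 * i + 1)" "0 \<le> w' i"
      by (simp_all add: w'_def)
  qed
  obtain v where v: "\<forall>i\<in>{1..<2 ^ Suc r}. 0 \<le> v i" "\<forall>i\<in>{2 ^ r..<2 ^ Suc r}. v i = w' i"
    "\<forall>i\<in>{1..<2 ^ r}. (v i)\<^sup>2 = v (2 * i) * v (2 * i + 1)"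
    "v 1 ^ 2 ^ r = (\<Prod>i=2 ^ r..<2 ^ Suc r. w' i)"
    using Suc.IH[of w', OF w'_nonneg] by blast
  define v' where "v' i = (if i < 2 ^ Suc r then v i else w i)" for i
  have "(1::nat) < 2 ^ Suc r"
    by (rule one_less_power) auto
  then have "v' 1 ^ 2 ^ Suc r = (v 1 ^ 2 ^ r)\<^sup>2"
    by (simp add: v'_def power_mult[symmetric] mult.commute)
  also have "\<dots> = (\<Prod>i=2 ^ r..<2 ^ Suc r. (w' i)\<^sup>2)"
    unfolding v(4) by (rule prod_power_distrib)
  also have "\<dots> = (\<Prod>i=2 ^ Suc r..<2 ^ Suc (Suc r). w i)"
    using prod_double_interval[of w "2 ^ r" "2 ^ Suc r"] by (simp add: w'_sq cong: prod.cong_simp)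
  finally have root: "v' 1 ^ 2 ^ Suc r = (\<Prod>i=2 ^ Suc r..<2 ^ Suc (Suc r). w i)" .
  have sq: "(v' i)\<^sup>2 = v' (2 * i) * v' (2 * i + 1)" if i: "i \<in> {1..<2 ^ Suc r}" for i
  proof (cases "i < 2 ^ r")
    case True
    then show ?thesis
      using v(3) i by (simp add: v'_def)
  next
    case False
    then show ?thesis
      using i v(2) w'_sq[of i] unfolding v'_def by auto
  qed
  show ?case
  proof (intro exI[of _ v'] conjI root ballI sq)
    show "0 \<le> v' i" if "i \<in> {1..<2 ^ Suc (Suc r)}" for i
      using that v(1) Suc.prems[of i] by (simp add: v'_def)
    show "v' i = w i" if "i \<in> {2 ^ Suc r..<2 ^ Suc (Suc r)}" for i
      using that by (simp add: v'_def)
  qed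
qed

text \<open>Listing each \<alpha> as often as its multiplicity turns a product of powers into a
  product over leaves. That every \<alpha> with positive multiplicity occurs is what later allows
  properties of \<open>u \<alpha>\<close> to be read off from a leaf.\<close>

lemma ex_enumeration_with_multiplicity:
  assumes "finite T"
  shows "\<exists>l :: nat \<Rightarrow> 'a. l ` {..<(\<Sum>\<alpha>\<in>T. m \<alpha>)} \<subseteq> T \<and> (\<forall>\<alpha>\<in>T. 0 < m \<alpha> \<longrightarrow> \<alpha> \<in> l ` {..<(\<Sum>\<alpha>\<in>T. m \<alpha>)})
    \<and> (\<forall>u :: 'a \<Rightarrow> real. (\<Prod>i<(\<Sum>\<alpha>\<in>T. m \<alpha>). u (l i)) = (\<Prod>\<alpha>\<in>T. u \<alpha> ^ m \<alpha>))"
  using assms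
proof induction
  case (insert a T)
  let ?M = "\<Sum>\<alpha>\<in>T. m \<alpha>"
  obtain l where l: "l ` {..<?M} \<subseteq> T" "\<And>\<alpha>. \<alpha> \<in> T \<Longrightarrow> 0 < m \<alpha> \<Longrightarrow> \<alpha> \<in> l ` {..<?M}"
    "\<And>u :: 'a \<Rightarrow> real. (\<Prod>i<?M. u (l i)) = (\<Prod>\<alpha>\<in>T. u \<alpha> ^ m \<alpha>)"
    using insert.IH by blast
  define l' where "l' i = (if i < ?M then l i else a)" for i
  have M: "(\<Sum>\<alpha>\<in>insert a T. m \<alpha>) = ?M + m a"
    using insert.hyps by simp
  have split: "{..<?M + m a} = {..<?M} \<union> {?M..<?M + m a}"
    by auto
  have im: "l' ` {..<?M + m a} = l ` {..<?M} \<union> (if 0 < m a then {a} else {})"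
  proof -
    have "l' ` {..<?M} = l ` {..<?M}" "l' ` {?M..<?M + m a} = (if 0 < m a then {a} else {})"
      by (auto simp: l'_def image_constant_conv)
    then show ?thesis
      unfolding split image_Un by simp
  qed
  have "(\<Prod>i<?M + m a. u (l' i)) = (\<Prod>i<?M. u (l' i)) * (\<Prod>i=?M..<?M + m a. u (l' i))" for u :: "'a \<Rightarrow> real"
    unfolding split by (rule prod.union_disjoint) auto
  then have "(\<Prod>i<?M + m a. u (l' i)) = (\<Prod>\<alpha>\<in>insert a T. u \<alpha> ^ m \<alpha>)" for u :: "'a \<Rightarrow> real"
    using insert.hyps by (simp add: l'_def l(3))
  then show ?case
    unfolding M using l(1,2) by (intro exI[of _ l']) (auto simp: im)
qed simp

definition poly_of_fun :: "'a set \<Rightarrow> ('a \<Rightarrow> 'b) \<Rightarrow> ('a \<Rightarrow>\<^sub>0 'b::comm_monoid_add)" where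
  "poly_of_fun I f = (\<Sum>i\<in>I. Poly_Mapping.single i (f i))"

lemma lookup_poly_of_fun:
  "finite I \<Longrightarrow> Poly_Mapping.lookup (poly_of_fun I f) i = (if i \<in> I then f i else 0)"
  by (simp add: poly_of_fun_def lookup_sum lookup_single when_def)

text \<open>The part d \<ge> 0 of the hypograph of a weighted geometric mean with weights
  \<open>m \<alpha>\<close> divided by their sum, written with integer powers and pushed forward by
  the linear map with values \<open>E \<alpha>\<close> and \<open>F\<close>.\<close>

definition geometric_mean_cone :: "'a set \<Rightarrow> ('a \<Rightarrow> nat) \<Rightarrow> ('a \<Rightarrow> 'v) \<Rightarrow> 'v \<Rightarrow> 'v::real_vector set" where
  "geometric_mean_cone T m E F = {(\<Sum>\<alpha>\<in>T. u \<alpha> *\<^sub>R E \<alpha>) + d *\<^sub>R F | u d.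
     (\<forall>\<alpha>\<in>T. 0 \<le> u \<alpha>) \<and> 0 \<le> d \<and> d ^ (\<Sum>\<alpha>\<in>T. m \<alpha>) \<le> (\<Prod>\<alpha>\<in>T. u \<alpha> ^ m \<alpha>)}"

text \<open>The auxiliary variables form a binary heap, in which the square of node \<open>i\<close> is at most the product
  of its children \<open>2 * i\<close> and \<open>2 * i + 1\<close>. The leaves are the \<open>u \<alpha>\<close> with multiplicity \<open>m \<alpha>\<close>; surplus
  leaves are copies of the root \<open>d\<close>, which turns the power of two into the exponent \<open>M\<close>. As there is
  at least one surplus leaf, the root is nonnegative.\<close>

lemma soc3_representable_geometric_mean_cone:
  fixes E :: "'a \<Rightarrow> 'v::real_vector"
  assumes T: "finite T" "T \<noteq> {}" "\<And>\<alpha>. \<alpha> \<in> T \<Longrightarrow> 0 < m \<alpha>"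
    and V: "subspace V" "\<And>\<alpha>. \<alpha> \<in> T \<Longrightarrow> E \<alpha> \<in> V" "F \<in> V"
  shows "soc3_representable V (geometric_mean_cone T m E F)"
proof -
  define M where "M = (\<Sum>\<alpha>\<in>T. m \<alpha>)"
  have M_pos: "0 < M"
    using T sum_pos[of T m] by (simp add: M_def)
  obtain l where l': "l ` {..<M} \<subseteq> T" "\<forall>\<alpha>\<in>T. 0 < m \<alpha> \<longrightarrow> \<alpha> \<in> l ` {..<M}"
    and l_prod: "\<forall>u :: 'a \<Rightarrow> real. (\<Prod>i<M. u (l i)) = (\<Prod>\<alpha>\<in>T. u \<alpha> ^ m \<alpha>)"
    using ex_enumeration_with_multiplicity[OF T(1), of m] unfolding M_def by (elim exE conjE)
  have l: "i < M \<Longrightarrow> l i \<in> T" "\<alpha> \<in> T \<Longrightarrow> \<exists>i<M. l i = \<alpha>" for i \<alpha>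
    using l' T(3) by blast+
  \<comment> \<open>Any depth with \<open>M < 2 ^ r\<close> would do; \<open>r = M\<close> is the
    simplest choice that satisfies this strictly.\<close>
  define r where "r = M"
  define K :: nat where "K = 2 ^ r"
  have K: "M < K" "1 < K" "2 ^ Suc r = 2 * K"
    using M_pos one_less_power[of "2::nat" M] by (auto simp: K_def r_def)
  define leaf :: "('a \<Rightarrow> real) \<Rightarrow> real \<Rightarrow> nat \<Rightarrow> real" where
    "leaf u d i = (if i - K < M then u (l (i - K)) else d)" for u d i
  have prod_leaf: "(\<Prod>i=K..<2 * K. leaf u d i) = (\<Prod>\<alpha>\<in>T. u \<alpha> ^ m \<alpha>) * d ^ (K - M)" for u d
  proof -
    have "(\<Prod>i=K..<2 * K. leaf u d i) = (\<Prod>i=0..<K. leaf u d (i + K))"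
      using prod.shift_bounds_nat_ivl[of "leaf u d" 0 K K] by (simp add: mult_2)
    also have "\<dots> = (\<Prod>i<K. if i < M then u (l i) else d)"
      by (simp add: leaf_def atLeast0LessThan cong: if_cong)
    also have "\<dots> = (\<Prod>i<M. u (l i)) * (\<Prod>i=M..<K. d)"
    proof -
      have split: "{..<K} = {..<M} \<union> {M..<K}"
        using K(1) by auto
      have "(\<Prod>i<K. if i < M then u (l i) else d) =
          (\<Prod>i<M. if i < M then u (l i) else d) * (\<Prod>i=M..<K. if i < M then u (l i) else d)"
        unfolding split by (rule prod.union_disjoint) auto
      then show ?thesis
        by simp
    qed
    finally show ?thesis
      by (simp add: l_prod)
  qed
  \<comment> \<open>Only the inner nodes, with the root \<open>d\<close> at node 1, are variables.
    The leaves, from node \<open>K\<close> on, are linear functions of \<open>u\<close> and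
    \<open>d\<close>, so sharing a variable between several leaves needs no extra equation.\<close>
  define val :: "nat \<Rightarrow> ('a \<Rightarrow>\<^sub>0 real) \<times> (nat \<Rightarrow>\<^sub>0 real) \<Rightarrow> real" where
    "val i z = (if i < K then Poly_Mapping.lookup (snd z) i
       else leaf (Poly_Mapping.lookup (fst z)) (Poly_Mapping.lookup (snd z) 1) i)" for i z
  \<comment> \<open>The factor \<open>sqrt 2\<close> compensates the factor 2 in the rotated
    cone.\<close>
  define q where "q i z = (val (2 * i) z, val (2 * i + 1) z, sqrt 2 * val i z)" for i z
  define \<pi> where "\<pi> z = (\<Sum>\<alpha>\<in>T. Poly_Mapping.lookup (fst z) \<alpha> *\<^sub>R E \<alpha>)
      + Poly_Mapping.lookup (snd z) 1 *\<^sub>R F" for z :: "('a \<Rightarrow>\<^sub>0 real) \<times> (nat \<Rightarrow>\<^sub>0 real)"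
  define L where "L = (coord_space T :: ('a \<Rightarrow>\<^sub>0 real) set) \<times> (coord_space {1..<K} :: (nat \<Rightarrow>\<^sub>0 real) set)"
  have val_add: "val i (y + z) = val i y + val i z" and val_scale: "val i (c *\<^sub>R z) = c * val i z" for i y z c
    by (simp_all add: val_def leaf_def lookup_add)
  have q_iff: "q i z \<in> rotated_cone3 \<longleftrightarrow> (val i z)\<^sup>2 \<le> val (2 * i) z * val (2 * i + 1) z
      \<and> 0 \<le> val (2 * i) z \<and> 0 \<le> val (2 * i + 1) z" for i z
    by (simp add: q_def rotated_cone3_def power_mult_distrib)
  have "has_soc_lift 3 (K - 1) V (\<pi> ` {z \<in> L. \<forall>i\<in>{1..K - 1}. q i z \<in> rotated_cone3})"
  proof (rule has_soc_lift_constraints)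
    show "subspace L"
      unfolding L_def by (intro subspace_Times subspace_coord_space)
    show "linear (q i)" for i
      by (rule linearI) (simp_all add: q_def val_add val_scale algebra_simps)
    show "linear \<pi>"
      by (rule linearI) (simp_all add: \<pi>_def lookup_add algebra_simps sum.distrib scaleR_sum_right)
    show "\<pi> ` L \<subseteq> V"
      using V by (auto simp: \<pi>_def intro!: subspace_add subspace_sum subspace_scale)
    show "\<pi> z = 0" if z: "\<And>i. i \<in> {1..K - 1} \<Longrightarrow> q i z = 0" for z
    proof -
      have z': "val i z = 0" "val (2 * i) z = 0" "val (2 * i + 1) z = 0" if "i \<in> {1..<K}" for i
        using z[of i] that by (auto simp: q_def zero_prod_def)
      have val0: "val i z = 0" if "i \<in> {1..<2 * K}" for i
      proof (cases "i < K")
        case False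
        then have "i div 2 \<in> {1..<K}"
          using that K(2) by auto
        moreover have "i = 2 * (i div 2) \<or> i = 2 * (i div 2) + 1"
          by presburger
        ultimately show ?thesis
          using z'[of "i div 2"] by fastforce
      qed (use z' that in auto)
      have "Poly_Mapping.lookup (fst z) \<alpha> = 0" if "\<alpha> \<in> T" for \<alpha>
      proof -
        obtain i where "i < M" "l i = \<alpha>"
          using l(2) \<open>\<alpha> \<in> T\<close> by blast
        then show ?thesis
          using val0[of "K + i"] K by (simp add: val_def leaf_def)
      qed
      moreover have "Poly_Mapping.lookup (snd z) 1 = 0"
        using val0[of 1] K by (simp add: val_def)
      ultimately show ?thesis
        by (simp add: \<pi>_def)
    qed
  qed
  moreover have "\<pi> ` {z \<in> L. \<forall>i\<in>{1..K - 1}. q i z \<in> rotated_cone3} = geometric_mean_cone T m E F"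
  proof (intro equalityI subsetI)
    fix x assume "x \<in> \<pi> ` {z \<in> L. \<forall>i\<in>{1..K - 1}. q i z \<in> rotated_cone3}"
    then obtain z where z: "x = \<pi> z" "\<And>i. i \<in> {1..<K} \<Longrightarrow> q i z \<in> rotated_cone3"
      by force
    define u where "u = Poly_Mapping.lookup (fst z)"
    define d where "d = Poly_Mapping.lookup (snd z) 1"
    have root: "val 1 z = d"
      using K by (simp add: val_def d_def)
    have nonneg2: "0 \<le> val i z" if i: "2 \<le> i" "i < 2 * K" for i
    proof -
      have "i div 2 \<in> {1..<K}"
        using i by auto
      moreover have "i = 2 * (i div 2) \<or> i = 2 * (i div 2) + 1"
        by presburger
      ultimately show ?thesis
        using z(2)[of "i div 2"] q_iff[of "i div 2" z] by fastforce
    qed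
    have "0 \<le> val (2 * K - 1) z"
      using K by (intro nonneg2) auto
    moreover have "val (2 * K - 1) z = d"
    proof -
      have "\<not> 2 * K - 1 < K" "\<not> 2 * K - 1 - K < M"
        using K(1,2) by linarith+
      then show ?thesis
        by (simp only: val_def leaf_def d_def if_False)
    qed
    ultimately have d: "0 \<le> d"
      by simp
    have nonneg: "0 \<le> val i z" if "i \<in> {1..<2 * K}" for i
      using nonneg2[of i] that d root by (cases "i = 1") auto
    have u: "0 \<le> u \<alpha>" if "\<alpha> \<in> T" for \<alpha>
    proof -
      obtain i where "i < M" "l i = \<alpha>"
        using l(2) \<open>\<alpha> \<in> T\<close> by blast
      then show ?thesis
        using nonneg[of "K + i"] K by (simp add: val_def leaf_def u_def)
    qed
    have "val 1 z ^ 2 ^ r \<le> (\<Prod>i=2 ^ r..<2 ^ Suc r. val i z)"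
    proof (rule heap_root_power_le)
      fix i :: nat
      assume "i \<in> {1..<2 ^ r}"
      then have "q i z \<in> rotated_cone3"
        using z(2) by (simp add: K_def)
      then show "(val i z)\<^sup>2 \<le> val (2 * i) z * val (2 * i + 1) z"
        by (simp add: q_iff)
    qed (rule nonneg, simp add: K_def)
    also have "\<dots> = (\<Prod>i=K..<2 * K. leaf u d i)"
      by (simp add: K_def val_def u_def d_def)
    finally have "d ^ K \<le> (\<Prod>\<alpha>\<in>T. u \<alpha> ^ m \<alpha>) * d ^ (K - M)"
      unfolding root prod_leaf by (simp add: K_def)
    moreover have "d ^ K = d ^ M * d ^ (K - M)"
      using K by (simp add: power_add[symmetric])
    \<comment> \<open>Cancelling \<open>d ^ (K - M)\<close> requires d \<noteq> 0; for d = 0 the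
      left side is 0, because \<open>M\<close> is positive.\<close>
    ultimately have "d ^ M \<le> (\<Prod>\<alpha>\<in>T. u \<alpha> ^ m \<alpha>)"
      using d M_pos u by (cases "d = 0") (auto intro!: prod_nonneg simp: power_0_left)
    then show "x \<in> geometric_mean_cone T m E F"
      using u d unfolding geometric_mean_cone_def z(1) \<pi>_def M_def u_def d_def by blast
  next
    fix x assume "x \<in> geometric_mean_cone T m E F"
    then obtain u d where x: "x = (\<Sum>\<alpha>\<in>T. u \<alpha> *\<^sub>R E \<alpha>) + d *\<^sub>R F"
      and u: "\<And>\<alpha>. \<alpha> \<in> T \<Longrightarrow> 0 \<le> u \<alpha>" and d: "0 \<le> d" and du: "d ^ M \<le> (\<Prod>\<alpha>\<in>T. u \<alpha> ^ m \<alpha>)"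
      unfolding geometric_mean_cone_def M_def by blast
    have "0 \<le> leaf u d i" for i
      using u d l(1) by (simp add: leaf_def)
    then obtain v where v: "\<forall>i\<in>{1..<2 * K}. 0 \<le> v i" "\<forall>i\<in>{K..<2 * K}. v i = leaf u d i"
        "\<forall>i\<in>{1..<K}. (v i)\<^sup>2 = v (2 * i) * v (2 * i + 1)" "v 1 ^ K = (\<Prod>i=K..<2 * K. leaf u d i)"
      using heap_fill_geometric_mean[of r "leaf u d"] unfolding K(3) K_def[symmetric] by blast
    have "d ^ K = d ^ M * d ^ (K - M)"
      using K by (simp add: power_add[symmetric])
    also have "\<dots> \<le> v 1 ^ K"
      unfolding v(4) prod_leaf using du d by (intro mult_right_mono) auto
    finally have dv: "d \<le> v 1"
      using K v(1) by (auto intro: power_le_imp_le_base[of _ "K - 1"])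
    \<comment> \<open>The filled heap may have a root larger than \<open>d\<close>. Lowering it to
      \<open>d\<close> relaxes the inequality at node 1 and affects no other one, since the root is
      nobody's child and the surplus leaves already hold \<open>d\<close>.\<close>
    define w where "w = v(1 := d)"
    define z where "z = (poly_of_fun T u, poly_of_fun {1..<K} w)"
    have zL: "z \<in> L"
      by (simp add: z_def L_def mem_coord_space_iff lookup_poly_of_fun T)
    have d_z: "Poly_Mapping.lookup (snd z) 1 = d"
      using K by (simp add: z_def lookup_poly_of_fun w_def)
    have leaf_z: "leaf (Poly_Mapping.lookup (fst z)) d i = leaf u d i" for i
      using l(1) by (simp add: leaf_def z_def lookup_poly_of_fun T)
    have val_z: "val i z = w i" if "i \<in> {1..<2 * K}" for i
      using that v(2) K leaf_z[of i] d_z by (auto simp: val_def z_def lookup_poly_of_fun w_def)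
    have "q i z \<in> rotated_cone3" if i: "i \<in> {1..K - 1}" for i
    proof -
      have "(w i)\<^sup>2 \<le> w (2 * i) * w (2 * i + 1)"
      proof (cases "i = 1")
        case True
        have "d\<^sup>2 \<le> (v 1)\<^sup>2"
          using dv d by (rule power_mono)
        then show ?thesis
          using True v(3) K(2) by (simp add: w_def)
      qed (use v(3) i in \<open>auto simp: w_def\<close>)
      moreover have "0 \<le> w (2 * i)" "0 \<le> w (2 * i + 1)"
        using v(1) i by (auto simp: w_def)
      moreover have "i < K"
        using i K(2) by auto
      ultimately show ?thesis
        using val_z[of i] val_z[of "2 * i"] val_z[of "2 * i + 1"] i by (simp add: q_iff)
    qed
    moreover have "\<pi> z = x"
      unfolding \<pi>_def d_z x by (simp add: z_def lookup_poly_of_fun T)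
    ultimately show "x \<in> \<pi> ` {z \<in> L. \<forall>i\<in>{1..K - 1}. q i z \<in> rotated_cone3}"
      using zL by (intro image_eqI[of _ _ z]) auto
  qed
  ultimately show ?thesis
    unfolding soc3_representable_def by (intro exI[of _ "K - 1"]) (simp only:)
qed

section \<open>Support-preserving decompositions of SONC polynomials\<close>

definition monomial :: "real ^ 'n \<Rightarrow> 'n::finite exponent \<Rightarrow> real" where
  "monomial x \<alpha> = (\<Prod>i\<in>UNIV. (x $ i) ^ (\<alpha> $ i))"

section \<open>Evaluation and nonnegativity of polynomials\<close>

lemma eval_poly_superset:
  assumes "finite S" "Poly_Mapping.keys p \<subseteq> S"
  shows "eval_poly p x = (\<Sum>\<alpha>\<in>S. Poly_Mapping.lookup p \<alpha> * monomial x \<alpha>)"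
  unfolding eval_poly_def monomial_def
  by (rule sum.mono_neutral_left) (use assms in \<open>auto simp: in_keys_iff\<close>)

lemma eval_poly_add: "eval_poly (p + q) x = eval_poly p x + eval_poly q x"
proof -
  let ?S = "Poly_Mapping.keys p \<union> Poly_Mapping.keys q"
  have "eval_poly r x = (\<Sum>\<alpha>\<in>?S. Poly_Mapping.lookup r \<alpha> * monomial x \<alpha>)"
    if "Poly_Mapping.keys r \<subseteq> ?S" for r
    using that by (intro eval_poly_superset) auto
  then show ?thesis
    by (simp add: keys_add lookup_add distrib_right sum.distrib)
qed

lemma eval_poly_scaleR: "eval_poly (c *\<^sub>R p) x = c * eval_poly p x"
proof -
  have "Poly_Mapping.keys (c *\<^sub>R p) \<subseteq> Poly_Mapping.keys p"
    by (auto simp: in_keys_iff)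
  then have "eval_poly (c *\<^sub>R p) x
      = (\<Sum>\<alpha>\<in>Poly_Mapping.keys p. Poly_Mapping.lookup (c *\<^sub>R p) \<alpha> * monomial x \<alpha>)"
    by (intro eval_poly_superset) auto
  also have "\<dots> = c * eval_poly p x"
    by (simp add: eval_poly_superset[of "Poly_Mapping.keys p"] sum_distrib_left mult.assoc)
  finally show ?thesis .
qed

lemma eval_poly_single: "eval_poly (Poly_Mapping.single \<alpha> c) x = c * monomial x \<alpha>"
  by (subst eval_poly_superset[of "{\<alpha>}"]) auto

lemma eval_poly_zero [simp]: "eval_poly 0 x = 0"
  by (simp add: eval_poly_def)

lemma eval_poly_minus: "eval_poly (p - q) x = eval_poly p x - eval_poly q x"
  using eval_poly_add[of p "(-1) *\<^sub>R q"] unfolding eval_poly_scaleR by simp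

lemma eval_poly_sum: "eval_poly (sum f I) x = (\<Sum>i\<in>I. eval_poly (f i) x)"
  by (induction I rule: infinite_finite_induct) (auto simp: eval_poly_add)

lemma nonneg_poly_0: "nonneg_poly 0"
  by (simp add: nonneg_poly_def)

lemma nonneg_poly_add: "nonneg_poly p \<Longrightarrow> nonneg_poly q \<Longrightarrow> nonneg_poly (p + q)"
  by (simp add: nonneg_poly_def eval_poly_add)

lemma nonneg_poly_scaleR: "0 \<le> c \<Longrightarrow> nonneg_poly p \<Longrightarrow> nonneg_poly (c *\<^sub>R p)"
  by (simp add: nonneg_poly_def eval_poly_scaleR)

lemma monomial_even_nonneg: "\<alpha> \<in> even_exps \<Longrightarrow> 0 \<le> monomial x \<alpha>"
  by (auto simp: monomial_def even_exps_def intro!: prod_nonneg zero_le_even_power)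

lemma monomial_square_nonneg: "monomial_square p \<Longrightarrow> nonneg_poly p"
  by (auto simp: monomial_square_def nonneg_poly_def eval_poly_single monomial_even_nonneg)

section \<open>Closure properties of SONC\<close>

lemma SONC_0: "0 \<in> SONC"
  unfolding SONC_def by (force intro: exI[of _ "[]"])

lemma SONC_add:
  assumes "p \<in> SONC" "q \<in> SONC"
  shows "p + q \<in> SONC"
proof -
  obtain ps qs where "p = sum_list ps" "\<forall>r\<in>set ps. nonneg_circuit r"
      "q = sum_list qs" "\<forall>r\<in>set qs. nonneg_circuit r"
    using assms unfolding SONC_def by blast
  then have "p + q = sum_list (ps @ qs)" "\<forall>r\<in>set (ps @ qs). nonneg_circuit r"
    by auto
  then show ?thesis
    unfolding SONC_def by blast
qed

lemma SONC_sum: "(\<And>i. i \<in> I \<Longrightarrow> f i \<in> SONC) \<Longrightarrow> sum f I \<in> SONC"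
  by (induction I rule: infinite_finite_induct) (auto intro: SONC_0 SONC_add)

lemma nonneg_circuit_SONC: "nonneg_circuit p \<Longrightarrow> p \<in> SONC"
  unfolding SONC_def by (force intro!: exI[of _ "[p]"])

lemma single_SONC: "0 \<le> c \<Longrightarrow> \<alpha> \<in> even_exps \<Longrightarrow> Poly_Mapping.single \<alpha> c \<in> SONC"
  by (rule nonneg_circuit_SONC) (auto simp: nonneg_circuit_def monomial_square_def)

text \<open>The factor is strictly positive because the vertex coefficients of a circuit polynomial
  must stay positive; the factor 0 is treated at the level of SONC.\<close>

lemma nonneg_circuit_scaleR:
  assumes "nonneg_circuit p" "0 < t"
  shows "nonneg_circuit (t *\<^sub>R p)"
  using assms(1) unfolding nonneg_circuit_def
proof (elim disjE conjE)
  assume "monomial_square p"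
  then obtain c \<alpha> where "0 \<le> c" "\<alpha> \<in> even_exps" "p = Poly_Mapping.single \<alpha> c"
    unfolding monomial_square_def by blast
  then have "monomial_square (t *\<^sub>R p)"
    using assms(2) unfolding monomial_square_def
    by (intro exI[of _ "t * c"] exI[of _ \<alpha>]) (simp add: single_scaleR[symmetric])
  then show "circuit_poly (t *\<^sub>R p) \<and> nonneg_poly (t *\<^sub>R p) \<or> monomial_square (t *\<^sub>R p)" ..
next
  assume "circuit_poly p" "nonneg_poly p"
  then obtain T c d \<beta> where p: "T \<subseteq> even_exps" "simplex_vertices T" "\<forall>\<alpha>\<in>T. 0 < c \<alpha>"
      "real_exp \<beta> \<in> rel_interior (newton T)"
      "p = (\<Sum>\<alpha>\<in>T. Poly_Mapping.single \<alpha> (c \<alpha>)) - Poly_Mapping.single \<beta> d"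
    unfolding circuit_poly_def by blast
  have "t *\<^sub>R p = (\<Sum>\<alpha>\<in>T. Poly_Mapping.single \<alpha> (t * c \<alpha>)) - Poly_Mapping.single \<beta> (t * d)"
    by (simp add: p(5) scaleR_diff_right scaleR_sum_right single_scaleR[symmetric])
  moreover have "\<forall>\<alpha>\<in>T. 0 < t * c \<alpha>"
    using p(3) assms(2) by simp
  ultimately have "circuit_poly (t *\<^sub>R p)"
    unfolding circuit_poly_def using p(1,2,4)
    by (intro exI[of _ T] exI[of _ "\<lambda>\<alpha>. t * c \<alpha>"] exI[of _ "t * d"] exI[of _ \<beta>]) simp
  then show "circuit_poly (t *\<^sub>R p) \<and> nonneg_poly (t *\<^sub>R p) \<or> monomial_square (t *\<^sub>R p)"
    using \<open>nonneg_poly p\<close> assms(2) by (simp add: nonneg_poly_scaleR)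
qed

lemma SONC_scaleR:
  assumes "p \<in> SONC" "0 \<le> t"
  shows "t *\<^sub>R p \<in> SONC"
proof (cases "t = 0")
  case False
  obtain ps where ps: "p = sum_list ps" "\<forall>r\<in>set ps. nonneg_circuit r"
    using assms(1) unfolding SONC_def by blast
  have "t *\<^sub>R sum_list ps = sum_list (map ((*\<^sub>R) t) ps)"
    by (induction ps) (auto simp: scaleR_add_right)
  moreover have "\<forall>r\<in>set (map ((*\<^sub>R) t) ps). nonneg_circuit r"
    using ps(2) False assms(2) by (auto intro!: nonneg_circuit_scaleR)
  ultimately show ?thesis
    unfolding SONC_def ps(1) by blast
qed (simp add: SONC_0)

text \<open>As in SAGE certificates, at most one term of an \<open>age\<close> polynomial is not visibly nonnegative.\<close>

definition age :: "'n::finite exponent \<Rightarrow> 'n rpoly \<Rightarrow> bool" where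
  "age \<beta> p \<longleftrightarrow> nonneg_poly p \<and> (\<forall>\<alpha>. \<alpha> \<noteq> \<beta> \<longrightarrow> 0 \<le> Poly_Mapping.lookup p \<alpha>)
     \<and> (\<forall>\<alpha>. \<alpha> \<noteq> \<beta> \<longrightarrow> Poly_Mapping.lookup p \<alpha> \<noteq> 0 \<longrightarrow> \<alpha> \<in> even_exps)"

lemma age_0: "age \<beta> 0"
  by (simp add: age_def nonneg_poly_0)

lemma age_add: "age \<beta> p \<Longrightarrow> age \<beta> q \<Longrightarrow> age \<beta> (p + q)"
  unfolding age_def by (auto simp: nonneg_poly_add lookup_add)

lemma nonneg_circuit_age:
  assumes "nonneg_circuit p"
  shows "\<exists>\<beta>. age \<beta> p"
  using assms unfolding nonneg_circuit_def
proof (elim disjE conjE)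
  assume "monomial_square p"
  then show ?thesis
    using monomial_square_nonneg[of p]
    by (auto simp: age_def monomial_square_def lookup_single when_def)
next
  assume "circuit_poly p" "nonneg_poly p"
  then obtain T c d \<beta> where p: "T \<subseteq> even_exps" "finite T" "\<forall>\<alpha>\<in>T. 0 < c \<alpha>"
      "p = (\<Sum>\<alpha>\<in>T. Poly_Mapping.single \<alpha> (c \<alpha>)) - Poly_Mapping.single \<beta> d"
    unfolding circuit_poly_def simplex_vertices_def by blast
  have "Poly_Mapping.lookup p \<alpha> = (if \<alpha> \<in> T then c \<alpha> else 0)" if "\<alpha> \<noteq> \<beta>" for \<alpha>
    using that p(2) by (simp add: p(4) lookup_minus lookup_sum lookup_single when_def)
  then have "age \<beta> p"
    using \<open>nonneg_poly p\<close> p(1,3) by (auto simp: age_def less_imp_le split: if_splits)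
  then show ?thesis ..
qed

text \<open>Summands with the same \<beta> can be merged, because \<open>age \<beta>\<close> is
  closed under addition. Afterwards each exponent owns at most one summand, which is the form that
  redistribution works on.\<close>

lemma SONC_age_sum:
  assumes "p \<in> SONC"
  shows "\<exists>S f. finite S \<and> (\<forall>\<beta>\<in>S. age \<beta> (f \<beta>)) \<and> p = (\<Sum>\<beta>\<in>S. f \<beta>)"
proof -
  obtain ps where ps: "p = sum_list ps" "\<forall>r\<in>set ps. nonneg_circuit r"
    using assms unfolding SONC_def by blast
  have "\<exists>S f. finite S \<and> (\<forall>\<beta>\<in>S. age \<beta> (f \<beta>)) \<and> sum_list ps = (\<Sum>\<beta>\<in>S. f \<beta>)"
    using ps(2)
  proof (induction ps)
    case Nil
    then show ?case
      by (intro exI[of _ "{}"]) simp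
  next
    case (Cons q ps)
    obtain S f where S: "finite S" "\<forall>\<beta>\<in>S. age \<beta> (f \<beta>)" "sum_list ps = (\<Sum>\<beta>\<in>S. f \<beta>)"
      using Cons by auto
    obtain \<gamma> where \<gamma>: "age \<gamma> q"
      using Cons.prems nonneg_circuit_age by auto
    \<comment> \<open>The default 0 outside \<open>S\<close> covers the case that \<gamma> is
      new.\<close>
    define g where "g = (\<lambda>\<beta>. if \<beta> \<in> S then f \<beta> else 0)(\<gamma> := q + (if \<gamma> \<in> S then f \<gamma> else 0))"
    have "(\<Sum>\<beta>\<in>insert \<gamma> S. g \<beta>) = q + (if \<gamma> \<in> S then f \<gamma> else 0) + (\<Sum>\<beta>\<in>S - {\<gamma>}. f \<beta>)"
      using S(1) by (simp add: sum.insert_remove g_def)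
    also have "\<dots> = q + (\<Sum>\<beta>\<in>S. f \<beta>)"
      using S(1) by (simp add: sum.remove add.assoc)
    finally have "sum_list (q # ps) = (\<Sum>\<beta>\<in>insert \<gamma> S. g \<beta>)"
      by (simp add: S(3))
    moreover have "\<forall>\<beta>\<in>insert \<gamma> S. age \<beta> (g \<beta>)"
      using S(2) \<gamma> by (auto simp: g_def age_add age_0)
    ultimately show ?case
      using S(1) by (intro exI[of _ "insert \<gamma> S"] exI[of _ g]) simp
  qed
  then show ?thesis
    by (simp add: ps(1))
qed

text \<open>This says that nothing cancels at \<gamma>. In an age decomposition the other summands
  are nonnegative there anyway, so either \<open>f \<gamma>\<close> is nonnegative as well or
  \<open>f \<gamma>\<close> alone carries the whole coefficient.\<close>

definition settled :: "'n exponent set \<Rightarrow> 'n rpoly \<Rightarrow> ('n::finite exponent \<Rightarrow> 'n rpoly) \<Rightarrow> 'n exponent \<Rightarrow> bool" where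
  "settled S p f \<gamma> \<longleftrightarrow>
     (0 \<le> Poly_Mapping.lookup p \<gamma> \<longrightarrow> 0 \<le> Poly_Mapping.lookup (f \<gamma>) \<gamma>) \<and>
     (Poly_Mapping.lookup p \<gamma> \<le> 0 \<longrightarrow> (\<forall>\<beta>\<in>S - {\<gamma>}. Poly_Mapping.lookup (f \<beta>) \<gamma> = 0))"

text \<open>If \<open>f \<gamma>\<close> has a negative coefficient at \<open>\<gamma>\<close>, it is distributed over the other summands in proportion
  to their coefficients at \<open>\<gamma>\<close>, as far as these stay nonnegative.\<close>

lemma settle_one:
  fixes f :: "'n::finite exponent \<Rightarrow> 'n rpoly"
  assumes S: "finite S" "\<gamma> \<in> S" and f: "\<And>\<beta>. \<beta> \<in> S \<Longrightarrow> age \<beta> (f \<beta>)" and p: "p = (\<Sum>\<beta>\<in>S. f \<beta>)"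
  shows "\<exists>g. (\<forall>\<beta>\<in>S. age \<beta> (g \<beta>)) \<and> p = (\<Sum>\<beta>\<in>S. g \<beta>) \<and> settled S p g \<gamma>
    \<and> (\<forall>\<beta>\<in>S. settled S p f \<beta> \<longrightarrow> settled S p g \<beta>)"
proof -
  define w where "w \<beta> = Poly_Mapping.lookup (f \<beta>) \<gamma>" for \<beta>
  define W where "W = (\<Sum>\<beta>\<in>S - {\<gamma>}. w \<beta>)"
  \<comment> \<open>\<open>e\<close> is the deficit of \<open>f \<gamma>\<close> at \<gamma> and
    \<open>W\<close> the amount that the other summands hold there, so the coefficient of
    \<open>p\<close> is \<open>W - e\<close>.\<close>
  define e where "e = - w \<gamma>"
  have w: "0 \<le> w \<beta>" if "\<beta> \<in> S - {\<gamma>}" for \<beta>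
    using f[of \<beta>] that by (auto simp: age_def w_def)
  have W: "0 \<le> W"
    unfolding W_def by (intro sum_nonneg w)
  have w_le: "w \<beta> \<le> W" if "\<beta> \<in> S - {\<gamma>}" for \<beta>
    unfolding W_def using that w S(1) by (intro member_le_sum) auto
  have p\<gamma>: "Poly_Mapping.lookup p \<gamma> = W - e"
    using S by (simp add: p lookup_sum W_def e_def w_def sum.remove[of S \<gamma>] lookup_add)
  show ?thesis
  proof (cases "e \<le> 0")
    case True
    then have "settled S p f \<gamma>"
      unfolding settled_def p\<gamma> using W w_le w by (fastforce simp: e_def w_def)
    then show ?thesis
      using f p by blast
  next
    case False
    \<comment> \<open>If \<open>W \<ge> e\<close>, then \<open>m = W\<close>: all of
      \<open>f \<gamma>\<close> is handed out and \<open>g \<gamma>\<close> is 0. Otherwise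
      \<open>m = e\<close>, and the amount handed out cancels every other coefficient at \<gamma>.
      In both cases \<open>1 - W / m\<close> and \<open>1 - e / m\<close> are nonnegative.\<close>
    define m where "m = max W e"
    have m: "0 < m" "W \<le> m" "e \<le> m"
      using False by (auto simp: m_def)
    define g where "g \<beta> = (if \<beta> = \<gamma> then (1 - W / m) *\<^sub>R f \<gamma> else f \<beta> + (w \<beta> / m) *\<^sub>R f \<gamma>)" for \<beta>
    have sum_g: "p = (\<Sum>\<beta>\<in>S. g \<beta>)"
    proof -
      have "(\<Sum>\<beta>\<in>S. g \<beta>) = g \<gamma> + (\<Sum>\<beta>\<in>S - {\<gamma>}. f \<beta> + (w \<beta> / m) *\<^sub>R f \<gamma>)"
        using S by (simp add: sum.remove[of S \<gamma>] g_def)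
      also have "(\<Sum>\<beta>\<in>S - {\<gamma>}. f \<beta> + (w \<beta> / m) *\<^sub>R f \<gamma>)
          = (\<Sum>\<beta>\<in>S - {\<gamma>}. f \<beta>) + (W / m) *\<^sub>R f \<gamma>"
        by (simp add: sum.distrib W_def sum_divide_distrib scaleR_sum_left)
      finally show ?thesis
        using S by (simp add: p sum.remove[of S \<gamma>] g_def algebra_simps)
    qed
    have f\<gamma>: "age \<gamma> (f \<gamma>)"
      using f S(2) .
    have g\<gamma>\<gamma>: "Poly_Mapping.lookup (g \<beta>) \<gamma> = w \<beta> * (1 - e / m)" if "\<beta> \<noteq> \<gamma>" for \<beta>
      using that by (simp add: g_def lookup_add w_def e_def algebra_simps)
    have age_g: "age \<beta> (g \<beta>)" if "\<beta> \<in> S" for \<beta>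
    proof (cases "\<beta> = \<gamma>")
      case True
      have "0 \<le> 1 - W / m"
        using m by simp
      then show ?thesis
        using f\<gamma> True by (auto simp: g_def age_def intro: nonneg_poly_scaleR)
    next
      case False
      then have \<beta>: "\<beta> \<in> S - {\<gamma>}" "age \<beta> (f \<beta>)"
        using that f by auto
      have wm: "0 \<le> w \<beta> / m"
        using w[OF \<beta>(1)] m by simp
      have "nonneg_poly (g \<beta>)"
        using \<beta>(2) f\<gamma> wm False by (auto simp: g_def age_def intro!: nonneg_poly_add nonneg_poly_scaleR)
      moreover have "0 \<le> Poly_Mapping.lookup (g \<beta>) \<alpha> \<and> (Poly_Mapping.lookup (g \<beta>) \<alpha> \<noteq> 0 \<longrightarrow> \<alpha> \<in> even_exps)"
        if \<alpha>: "\<alpha> \<noteq> \<beta>" for \<alpha>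
      proof (cases "\<alpha> = \<gamma>")
        case True
        have "0 \<le> 1 - e / m"
          using m by simp
        moreover have "w \<beta> \<noteq> 0 \<Longrightarrow> \<gamma> \<in> even_exps"
          using \<beta>(2) False by (auto simp: age_def w_def)
        ultimately show ?thesis
          unfolding True g\<gamma>\<gamma>[OF False] using w[OF \<beta>(1)] by auto
      next
        case \<alpha>\<gamma>: False
        have "Poly_Mapping.lookup (g \<beta>) \<alpha> = Poly_Mapping.lookup (f \<beta>) \<alpha> + w \<beta> / m * Poly_Mapping.lookup (f \<gamma>) \<alpha>"
          using False by (simp add: g_def lookup_add)
        moreover have "0 \<le> w \<beta> / m * Poly_Mapping.lookup (f \<gamma>) \<alpha>" "0 \<le> Poly_Mapping.lookup (f \<beta>) \<alpha>"
          using \<beta>(2) f\<gamma> \<alpha> \<alpha>\<gamma> wm unfolding age_def by (blast intro: mult_nonneg_nonneg)+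
        moreover have "Poly_Mapping.lookup (f \<beta>) \<alpha> = 0 \<and> Poly_Mapping.lookup (f \<gamma>) \<alpha> = 0"
          if "\<alpha> \<notin> even_exps"
          using that \<beta>(2) f\<gamma> \<alpha> \<alpha>\<gamma> unfolding age_def by blast
        ultimately show ?thesis
          by (cases "\<alpha> \<in> even_exps") auto
      qed
      ultimately show ?thesis
        by (simp add: age_def)
    qed
    have "settled S p g \<gamma>"
      unfolding settled_def p\<gamma>
    proof (intro conjI impI ballI)
      assume "0 \<le> W - e"
      then have "m = W"
        by (simp add: m_def)
      then show "0 \<le> Poly_Mapping.lookup (g \<gamma>) \<gamma>"
        using m by (simp add: g_def)
    next
      fix \<beta> assume "W - e \<le> 0" "\<beta> \<in> S - {\<gamma>}"
      moreover from this have "m = e"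
        by (simp add: m_def)
      ultimately show "Poly_Mapping.lookup (g \<beta>) \<gamma> = 0"
        using g\<gamma>\<gamma>[of \<beta>] m by simp
    qed
    \<comment> \<open>At a settled \<delta> with nonpositive coefficient in \<open>p\<close>, the
      summand \<open>f \<gamma>\<close> has coefficient 0, so handing it out reintroduces nothing.
      Otherwise \<open>g \<delta>\<close> only gains a nonnegative amount at \<delta>.\<close>
    moreover have "settled S p g \<delta>" if \<delta>: "\<delta> \<in> S" "settled S p f \<delta>" for \<delta>
    proof (cases "\<delta> = \<gamma>")
      case False
      have "0 \<le> w \<delta> / m * Poly_Mapping.lookup (f \<gamma>) \<delta>"
        using w[of \<delta>] m \<delta>(1) f\<gamma> False by (simp add: age_def)
      then show ?thesis
        using \<delta> S(2) False by (auto simp: settled_def g_def lookup_add)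
    qed (use \<open>settled S p g \<gamma>\<close> in simp)
    ultimately show ?thesis
      using age_g sum_g by blast
  qed
qed

text \<open>Settling one exponent preserves the exponents already settled, so they can be treated
  one at a time.\<close>

lemma SONC_settled_age_sum:
  assumes "p \<in> SONC"
  shows "\<exists>S f. finite S \<and> (\<forall>\<beta>\<in>S. age \<beta> (f \<beta>)) \<and> p = (\<Sum>\<beta>\<in>S. f \<beta>) \<and> (\<forall>\<beta>\<in>S. settled S p f \<beta>)"
proof -
  obtain S f where S: "finite S" "\<forall>\<beta>\<in>S. age \<beta> (f \<beta>)" "p = (\<Sum>\<beta>\<in>S. f \<beta>)"
    using SONC_age_sum[OF assms] by (elim exE conjE) (rule that)
  have "\<exists>g. (\<forall>\<beta>\<in>S. age \<beta> (g \<beta>)) \<and> p = (\<Sum>\<beta>\<in>S. g \<beta>) \<and> (\<forall>\<beta>\<in>R. settled S p g \<beta>)"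
    if "finite R" "R \<subseteq> S" for R
    using that
  proof (induction R)
    case empty
    then show ?case
      using S by blast
  next
    case (insert \<gamma> R)
    then obtain g where g: "\<forall>\<beta>\<in>S. age \<beta> (g \<beta>)" "p = (\<Sum>\<beta>\<in>S. g \<beta>)" "\<forall>\<beta>\<in>R. settled S p g \<beta>"
      by auto
    then obtain h where "\<forall>\<beta>\<in>S. age \<beta> (h \<beta>)" "p = (\<Sum>\<beta>\<in>S. h \<beta>)" "settled S p h \<gamma>"
        "\<forall>\<beta>\<in>S. settled S p g \<beta> \<longrightarrow> settled S p h \<beta>"
      using settle_one[of S \<gamma> g p] S(1) insert.prems by auto
    then show ?case
      using g(3) insert.prems by (intro exI[of _ h]) auto
  qed
  then show ?thesis
    using S(1) by blast
qed

text \<open>In a settled decomposition a summand vanishes at every exponent of \<open>B\<close>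
  except its own, and all coefficients outside \<open>B\<close> are nonnegative. So nothing cancels
  and no exponent outside the support of \<open>p\<close> survives. The summands owned by exponents
  outside \<open>B\<close> are dropped, whence the inequality in the last clause.\<close>

lemma SONC_support_decomposition:
  assumes p: "p \<in> SONC" and B: "finite B"
    and neg: "\<And>\<beta>. \<beta> \<in> B \<Longrightarrow> Poly_Mapping.lookup p \<beta> \<le> 0 \<or> \<beta> \<notin> even_exps"
    and pos: "\<And>\<alpha>. \<alpha> \<notin> B \<Longrightarrow> 0 \<le> Poly_Mapping.lookup p \<alpha>"
  shows "\<exists>h. (\<forall>\<beta>\<in>B. age \<beta> (h \<beta>) \<and> Poly_Mapping.lookup (h \<beta>) \<beta> = Poly_Mapping.lookup p \<beta>
        \<and> Poly_Mapping.keys (h \<beta>) - {\<beta>} \<subseteq> Poly_Mapping.keys p - B)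
    \<and> (\<forall>\<alpha>. \<alpha> \<notin> B \<longrightarrow> (\<Sum>\<beta>\<in>B. Poly_Mapping.lookup (h \<beta>) \<alpha>) \<le> Poly_Mapping.lookup p \<alpha>)"
proof -
  obtain S f where S: "finite S" and f: "\<And>\<beta>. \<beta> \<in> S \<Longrightarrow> age \<beta> (f \<beta>)" and p_sum: "p = (\<Sum>\<beta>\<in>S. f \<beta>)"
    and settled: "\<And>\<beta>. \<beta> \<in> S \<Longrightarrow> settled S p f \<beta>"
    using SONC_settled_age_sum[OF p] by (elim exE conjE) (rule that, auto)
  have p_lookup: "Poly_Mapping.lookup p \<alpha> = (\<Sum>\<beta>\<in>S. Poly_Mapping.lookup (f \<beta>) \<alpha>)" for \<alpha>
    by (simp add: p_sum lookup_sum)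
  have f_nonneg: "0 \<le> Poly_Mapping.lookup (f \<beta>) \<alpha>" if "\<beta> \<in> S" "\<alpha> \<noteq> \<beta>" for \<alpha> \<beta>
    using f[OF that(1)] that(2) by (simp add: age_def)
  have cross: "Poly_Mapping.lookup (f \<beta>) \<gamma> = 0" if "\<beta> \<in> S" "\<gamma> \<in> B" "\<beta> \<noteq> \<gamma>" for \<beta> \<gamma>
    using neg[OF that(2)]
  proof
    assume "\<gamma> \<notin> even_exps"
    then show ?thesis
      using f[OF that(1)] that(3) unfolding age_def by metis
  next
    assume le: "Poly_Mapping.lookup p \<gamma> \<le> 0"
    show ?thesis
    proof (cases "\<gamma> \<in> S")
      case True
      then show ?thesis
        using settled[OF True] le that by (simp add: settled_def)
    next
      \<comment> \<open>No summand is owned by \<gamma>, so all coefficients there are nonnegative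
        while their sum is nonpositive.\<close>
      case False
      then have "\<forall>\<beta>\<in>S. 0 \<le> Poly_Mapping.lookup (f \<beta>) \<gamma>"
        using f_nonneg by metis
      moreover from this have "(\<Sum>\<beta>\<in>S. Poly_Mapping.lookup (f \<beta>) \<gamma>) = 0"
        using le unfolding p_lookup by (intro antisym sum_nonneg) auto
      ultimately show ?thesis
        using S that(1) by (simp add: sum_nonneg_eq_0_iff)
    qed
  qed
  have nonneg: "0 \<le> Poly_Mapping.lookup (f \<beta>) \<alpha>" if "\<beta> \<in> S" "\<alpha> \<notin> B" for \<alpha> \<beta>
    using f_nonneg[OF that(1)] settled[OF that(1)] pos[OF that(2)] by (metis settled_def)
  define h where "h \<beta> = (if \<beta> \<in> S then f \<beta> else 0)" for \<beta>
  have "age \<beta> (h \<beta>)" for \<beta>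
    using f by (simp add: h_def age_0)
  moreover have "Poly_Mapping.lookup (h \<beta>) \<beta> = Poly_Mapping.lookup p \<beta>" if "\<beta> \<in> B" for \<beta>
  proof -
    have "Poly_Mapping.lookup p \<beta> = (\<Sum>\<gamma>\<in>S. if \<gamma> = \<beta> then Poly_Mapping.lookup (f \<beta>) \<beta> else 0)"
      unfolding p_lookup by (rule sum.cong) (use cross that in auto)
    then show ?thesis
      using S by (simp add: h_def)
  qed
  moreover have "Poly_Mapping.keys (h \<beta>) - {\<beta>} \<subseteq> Poly_Mapping.keys p - B" if "\<beta> \<in> B" for \<beta>
  proof
    fix \<alpha> assume \<alpha>: "\<alpha> \<in> Poly_Mapping.keys (h \<beta>) - {\<beta>}"
    then have \<beta>: "\<beta> \<in> S" "Poly_Mapping.lookup (f \<beta>) \<alpha> \<noteq> 0" "\<alpha> \<noteq> \<beta>"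
      by (auto simp: h_def in_keys_iff split: if_splits)
    then have "\<alpha> \<notin> B"
      using cross by metis
    then have "0 < Poly_Mapping.lookup (f \<beta>) \<alpha>"
      using nonneg[OF \<beta>(1)] \<beta>(2) by (simp add: less_le)
    then have "0 < Poly_Mapping.lookup p \<alpha>"
      unfolding p_lookup by (rule sum_pos2[OF S \<beta>(1)]) (use nonneg \<open>\<alpha> \<notin> B\<close> in simp)
    then show "\<alpha> \<in> Poly_Mapping.keys p - B"
      using \<open>\<alpha> \<notin> B\<close> by (simp add: in_keys_iff)
  qed
  moreover have "(\<Sum>\<beta>\<in>B. Poly_Mapping.lookup (h \<beta>) \<alpha>) \<le> Poly_Mapping.lookup p \<alpha>" if "\<alpha> \<notin> B" for \<alpha>
  proof -
    have "(\<Sum>\<beta>\<in>B. Poly_Mapping.lookup (h \<beta>) \<alpha>) = (\<Sum>\<beta>\<in>B \<inter> S. Poly_Mapping.lookup (f \<beta>) \<alpha>)"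
      using B by (intro sum.mono_neutral_cong_right) (auto simp: h_def)
    also have "\<dots> \<le> Poly_Mapping.lookup p \<alpha>"
      unfolding p_lookup using S nonneg that by (intro sum_mono2) auto
    finally show ?thesis .
  qed
  ultimately show ?thesis
    by (intro exI[of _ h]) blast
qed

section \<open>Lower bounds of exponential sums\<close>

text \<open>Bolzano-Weierstrass for finitely many sequences at once, by refining the subsequence for
  one index after the other.\<close>

lemma bounded_family_convergent_subsequence:
  fixes f :: "nat \<Rightarrow> 'a \<Rightarrow> real"
  assumes "finite A" "\<And>\<alpha> k. \<alpha> \<in> A \<Longrightarrow> \<bar>f k \<alpha>\<bar> \<le> C"
  shows "\<exists>r \<nu>. strict_mono r \<and> (\<forall>\<alpha>\<in>A. (\<lambda>k. f (r k) \<alpha>) \<longlonglongrightarrow> \<nu> \<alpha>)"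
  using assms
proof (induction A)
  case empty
  then show ?case
    by (intro exI[of _ id]) (simp add: strict_mono_def)
next
  case (insert \<beta> A)
  then obtain r \<nu> where r: "strict_mono r" "\<forall>\<alpha>\<in>A. (\<lambda>k. f (r k) \<alpha>) \<longlonglongrightarrow> \<nu> \<alpha>"
    by auto
  have "bounded (range (\<lambda>k. f (r k) \<beta>))"
    using insert.prems by (auto simp: bounded_iff)
  then obtain l s where s: "strict_mono s" "((\<lambda>k. f (r k) \<beta>) \<circ> s) \<longlonglongrightarrow> l"
    using bounded_imp_convergent_subsequence by blast
  have "(\<lambda>k. f ((r \<circ> s) k) \<alpha>) \<longlonglongrightarrow> (\<nu>(\<beta> := l)) \<alpha>" if "\<alpha> \<in> insert \<beta> A" for \<alpha>
  proof (cases "\<alpha> = \<beta>")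
    case False
    then have "(\<lambda>k. f (r k) \<alpha>) \<longlonglongrightarrow> \<nu> \<alpha>"
      using that r(2) by auto
    then have "((\<lambda>k. f (r k) \<alpha>) \<circ> s) \<longlonglongrightarrow> \<nu> \<alpha>"
      by (rule LIMSEQ_subseq_LIMSEQ[OF _ s(1)])
    then show ?thesis
      using False by (simp add: o_def)
  qed (use s(2) in \<open>simp add: o_def\<close>)
  then show ?case
    using strict_mono_o[OF r(1) s(1)] by blast
qed

text \<open>The quadratic term makes the sum coercive, so a minimizer exists. The equation is the
  vanishing of the gradient there, the inequality the comparison with the value at 0.\<close>

lemma regularized_exp_sum_critical_point:
  fixes a :: "'a \<Rightarrow> 'v::euclidean_space" and c :: "'a \<Rightarrow> real"
  assumes A: "finite A" "\<And>\<alpha>. \<alpha> \<in> A \<Longrightarrow> 0 \<le> c \<alpha>" and \<epsilon>: "0 < \<epsilon>"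
  shows "\<exists>x. (\<Sum>\<alpha>\<in>A. (c \<alpha> * exp (a \<alpha> \<bullet> x)) *\<^sub>R a \<alpha>) = - (2 * \<epsilon>) *\<^sub>R x
    \<and> (\<Sum>\<alpha>\<in>A. c \<alpha> * exp (a \<alpha> \<bullet> x)) + \<epsilon> * (norm x)\<^sup>2 \<le> (\<Sum>\<alpha>\<in>A. c \<alpha>)"
proof -
  define F where "F x = (\<Sum>\<alpha>\<in>A. c \<alpha> * exp (a \<alpha> \<bullet> x))" for x
  define G where "G x = F x + \<epsilon> * (x \<bullet> x)" for x
  have G0: "G 0 = (\<Sum>\<alpha>\<in>A. c \<alpha>)"
    by (simp add: G_def F_def)
  have F_nonneg: "0 \<le> F x" for x
    unfolding F_def using A(2) by (intro sum_nonneg) simp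
  \<comment> \<open>Outside the ball of radius \<open>R\<close> the quadratic term alone is at least
    \<open>G 0\<close>.\<close>
  define R where "R = sqrt (G 0 / \<epsilon>)"
  have "0 \<le> G 0 / \<epsilon>"
    using F_nonneg[of 0] \<epsilon> by (simp add: G_def)
  then have R: "0 \<le> R" "\<epsilon> * R\<^sup>2 = G 0"
    using \<epsilon> by (simp_all add: R_def)
  have "continuous_on (cball 0 R) G"
    unfolding G_def F_def by (intro continuous_intros)
  then obtain x where x: "x \<in> cball 0 R" "\<And>y. y \<in> cball 0 R \<Longrightarrow> G x \<le> G y"
    using continuous_attains_inf[of "cball 0 R" G] R(1) by auto
  have min: "G x \<le> G y" for y
  proof (cases "y \<in> cball 0 R")
    case False
    then have "R\<^sup>2 \<le> (norm y)\<^sup>2"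
      using R(1) by (intro power_mono) auto
    then have "G 0 \<le> \<epsilon> * (norm y)\<^sup>2"
      using R(2) \<epsilon> by (metis mult_left_mono less_imp_le)
    also have "\<dots> \<le> G y"
      using F_nonneg by (simp add: G_def dot_square_norm)
    finally show ?thesis
      using x(2)[of 0] R(1) by simp
  qed (use x(2) in auto)
  define grad where "grad = (\<Sum>\<alpha>\<in>A. (c \<alpha> * exp (a \<alpha> \<bullet> x)) *\<^sub>R a \<alpha>) + (2 * \<epsilon>) *\<^sub>R x"
  \<comment> \<open>For the direction \<open>h = grad\<close> this derivative is the squared norm of
    the gradient, and it vanishes at a minimum.\<close>
  have "((\<lambda>t. G (x + t *\<^sub>R h)) has_real_derivative grad \<bullet> h) (at 0)" for h
    unfolding G_def F_def inner_add_left inner_add_right inner_scaleR_left inner_scaleR_right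
    by (auto intro!: derivative_eq_intros DERIV_sum
        simp: grad_def inner_add_left inner_sum_left inner_sum_right inner_commute algebra_simps)
  then have "grad \<bullet> grad = 0"
    by (rule DERIV_local_min[where d = 1]) (use min in auto)
  then have "(\<Sum>\<alpha>\<in>A. (c \<alpha> * exp (a \<alpha> \<bullet> x)) *\<^sub>R a \<alpha>) = - (2 * \<epsilon>) *\<^sub>R x"
    by (simp add: grad_def eq_neg_iff_add_eq_0)
  moreover have "F x + \<epsilon> * (norm x)\<^sup>2 \<le> (\<Sum>\<alpha>\<in>A. c \<alpha>)"
    using min[of 0] G0 by (simp add: G_def dot_square_norm)
  ultimately show ?thesis
    unfolding F_def by blast
qed

text \<open>The infimum of the exponential sum need not be attained, so \<open>\<nu>\<close> is a limit of the terms
  \<open>c \<alpha> * exp (a \<alpha> \<bullet> x)\<close> at the minimizers of regularized sums. The last property survives the limit because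
  \<open>m\<close> annihilates the linear forms \<open>a \<alpha> \<bullet> x\<close> at every \<open>x\<close>.\<close>

lemma exp_sum_lower_bound_certificate:
  fixes a :: "'a \<Rightarrow> 'v::euclidean_space" and c :: "'a \<Rightarrow> real"
  assumes A: "finite A" "\<And>\<alpha>. \<alpha> \<in> A \<Longrightarrow> 0 \<le> c \<alpha>"
    and d: "\<And>x. d \<le> (\<Sum>\<alpha>\<in>A. c \<alpha> * exp (a \<alpha> \<bullet> x))"
  shows "\<exists>\<nu>. (\<forall>\<alpha>\<in>A. 0 \<le> \<nu> \<alpha> \<and> (c \<alpha> = 0 \<longrightarrow> \<nu> \<alpha> = 0)) \<and> (\<Sum>\<alpha>\<in>A. \<nu> \<alpha> *\<^sub>R a \<alpha>) = 0
    \<and> d \<le> (\<Sum>\<alpha>\<in>A. \<nu> \<alpha>)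
    \<and> (\<forall>m. (\<forall>\<alpha>\<in>A. \<nu> \<alpha> = 0 \<longrightarrow> m \<alpha> = 0) \<longrightarrow> (\<Sum>\<alpha>\<in>A. m \<alpha> *\<^sub>R a \<alpha>) = 0
          \<longrightarrow> (\<Sum>\<alpha>\<in>A. m \<alpha> * ln (\<nu> \<alpha> / c \<alpha>)) = 0)"
proof -
  define C where "C = (\<Sum>\<alpha>\<in>A. c \<alpha>)"
  define \<epsilon> :: "nat \<Rightarrow> real" where "\<epsilon> k = inverse (real (Suc k))" for k
  have \<epsilon>: "0 < \<epsilon> k" for k
    by (simp add: \<epsilon>_def)
  have "\<forall>k. \<exists>x. (\<Sum>\<alpha>\<in>A. (c \<alpha> * exp (a \<alpha> \<bullet> x)) *\<^sub>R a \<alpha>) = - (2 * \<epsilon> k) *\<^sub>R x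
    \<and> (\<Sum>\<alpha>\<in>A. c \<alpha> * exp (a \<alpha> \<bullet> x)) + \<epsilon> k * (norm x)\<^sup>2 \<le> C"
    unfolding C_def by (rule allI, rule regularized_exp_sum_critical_point[OF A \<epsilon>])
  from this[THEN choice] obtain x where x: "\<And>k. (\<Sum>\<alpha>\<in>A. (c \<alpha> * exp (a \<alpha> \<bullet> x k)) *\<^sub>R a \<alpha>) = - (2 * \<epsilon> k) *\<^sub>R x k"
    "\<And>k. (\<Sum>\<alpha>\<in>A. c \<alpha> * exp (a \<alpha> \<bullet> x k)) + \<epsilon> k * (norm (x k))\<^sup>2 \<le> C"
    by (elim exE) (rule that, auto)
  define f where "f k \<alpha> = c \<alpha> * exp (a \<alpha> \<bullet> x k)" for k \<alpha>
  have f_nonneg: "0 \<le> f k \<alpha>" if "\<alpha> \<in> A" for k \<alpha>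
    using A(2)[OF that] by (simp add: f_def)
  have sum_f: "(\<Sum>\<alpha>\<in>A. f k \<alpha>) + \<epsilon> k * (norm (x k))\<^sup>2 \<le> C" for k
    using x(2) by (simp add: f_def)
  have f_le: "\<bar>f k \<alpha>\<bar> \<le> C" if "\<alpha> \<in> A" for k \<alpha>
  proof -
    have "f k \<alpha> \<le> (\<Sum>\<alpha>\<in>A. f k \<alpha>)"
      using that A(1) f_nonneg by (intro member_le_sum) auto
    also have "\<dots> \<le> C"
      using sum_f[of k] \<epsilon>[of k] by (smt (verit) mult_nonneg_nonneg zero_le_power2)
    finally show ?thesis
      using f_nonneg[OF that, of k] by simp
  qed
  have "\<exists>r \<nu>. strict_mono r \<and> (\<forall>\<alpha>\<in>A. (\<lambda>k. f (r k) \<alpha>) \<longlonglongrightarrow> \<nu> \<alpha>)"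
    by (rule bounded_family_convergent_subsequence[OF A(1) f_le])
  then obtain r \<nu> where r: "strict_mono r" and lim: "\<forall>\<alpha>\<in>A. (\<lambda>k. f (r k) \<alpha>) \<longlonglongrightarrow> \<nu> \<alpha>"
    by blast
  have \<nu>_nonneg: "0 \<le> \<nu> \<alpha>" if "\<alpha> \<in> A" for \<alpha>
    using lim that f_nonneg by (intro LIMSEQ_le_const[of "\<lambda>k. f (r k) \<alpha>"]) auto
  have \<nu>_0: "\<nu> \<alpha> = 0" if "\<alpha> \<in> A" "c \<alpha> = 0" for \<alpha>
  proof -
    have "(\<lambda>k. f (r k) \<alpha>) = (\<lambda>k. 0)"
      by (simp add: f_def that(2))
    then show ?thesis
      using lim that(1) LIMSEQ_unique[OF _ tendsto_const] by metis
  qed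
  \<comment> \<open>The comparison with the value at 0 bounds \<epsilon> |x|^2 by \<open>C\<close>,
    so |\<epsilon> x|^2 is at most \<epsilon> C. The points may escape to infinity, but the right
    side of the critical point equation still tends to 0.\<close>
  have "(\<lambda>k. \<epsilon> k *\<^sub>R x k) \<longlonglongrightarrow> 0"
  proof (rule tendsto_norm_zero_cancel, rule tendsto_sandwich[of "\<lambda>k. 0" _ _ "\<lambda>k. sqrt (\<epsilon> k * C)"])
    have "norm (\<epsilon> k *\<^sub>R x k) \<le> sqrt (\<epsilon> k * C)" for k
    proof (rule real_le_rsqrt)
      have "\<epsilon> k * (norm (x k))\<^sup>2 \<le> C"
        using sum_f[of k] sum_nonneg[of A "f k"] f_nonneg by (smt (verit))
      then have "\<epsilon> k * (\<epsilon> k * (norm (x k))\<^sup>2) \<le> \<epsilon> k * C"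
        using \<epsilon>[of k] by (intro mult_left_mono) auto
      then show "(norm (\<epsilon> k *\<^sub>R x k))\<^sup>2 \<le> \<epsilon> k * C"
        using \<epsilon>[of k] by (simp add: power2_eq_square ac_simps)
    qed
    then show "\<forall>\<^sub>F k in sequentially. norm (\<epsilon> k *\<^sub>R x k) \<le> sqrt (\<epsilon> k * C)"
      by simp
    have "(\<lambda>k. sqrt (\<epsilon> k * C)) \<longlonglongrightarrow> sqrt (0 * C)"
      unfolding \<epsilon>_def by (intro tendsto_intros LIMSEQ_inverse_real_of_nat)
    then show "(\<lambda>k. sqrt (\<epsilon> k * C)) \<longlonglongrightarrow> 0"
      by simp
  qed auto
  then have "(\<lambda>k. - 2 *\<^sub>R (\<epsilon> (r k) *\<^sub>R x (r k))) \<longlonglongrightarrow> - 2 *\<^sub>R 0"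
    by (intro tendsto_scaleR tendsto_const LIMSEQ_subseq_LIMSEQ[OF _ r, unfolded o_def])
  moreover have "(\<lambda>k. \<Sum>\<alpha>\<in>A. f (r k) \<alpha> *\<^sub>R a \<alpha>) \<longlonglongrightarrow> (\<Sum>\<alpha>\<in>A. \<nu> \<alpha> *\<^sub>R a \<alpha>)"
    using lim by (intro tendsto_sum tendsto_scaleR tendsto_const) auto
  moreover have "(\<Sum>\<alpha>\<in>A. f (r k) \<alpha> *\<^sub>R a \<alpha>) = - 2 *\<^sub>R (\<epsilon> (r k) *\<^sub>R x (r k))" for k
    using x(1)[of "r k"] by (simp add: f_def)
  ultimately have "(\<Sum>\<alpha>\<in>A. \<nu> \<alpha> *\<^sub>R a \<alpha>) = - 2 *\<^sub>R 0"
    by (intro LIMSEQ_unique[of "\<lambda>k. \<Sum>\<alpha>\<in>A. f (r k) \<alpha> *\<^sub>R a \<alpha>"]) simp_all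
  then have balance: "(\<Sum>\<alpha>\<in>A. \<nu> \<alpha> *\<^sub>R a \<alpha>) = 0"
    by simp
  have "d \<le> (\<Sum>\<alpha>\<in>A. f (r k) \<alpha>)" for k
    unfolding f_def by (rule d)
  moreover have "(\<lambda>k. \<Sum>\<alpha>\<in>A. f (r k) \<alpha>) \<longlonglongrightarrow> (\<Sum>\<alpha>\<in>A. \<nu> \<alpha>)"
    using lim by (intro tendsto_sum) auto
  ultimately have d_le: "d \<le> (\<Sum>\<alpha>\<in>A. \<nu> \<alpha>)"
    by (intro LIMSEQ_le_const) auto
  have "(\<Sum>\<alpha>\<in>A. m \<alpha> * ln (\<nu> \<alpha> / c \<alpha>)) = 0"
    if supp: "\<forall>\<alpha>\<in>A. \<nu> \<alpha> = 0 \<longrightarrow> m \<alpha> = 0" and m: "(\<Sum>\<alpha>\<in>A. m \<alpha> *\<^sub>R a \<alpha>) = 0" for m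
  proof -
    have "(\<Sum>\<alpha>\<in>A. m \<alpha> * ln (f k \<alpha> / c \<alpha>)) = 0" for k
    proof -
      have "(\<Sum>\<alpha>\<in>A. m \<alpha> * ln (f k \<alpha> / c \<alpha>)) = (\<Sum>\<alpha>\<in>A. m \<alpha> * (a \<alpha> \<bullet> x k))"
        using supp \<nu>_0 by (intro sum.cong) (auto simp: f_def)
      also have "\<dots> = (\<Sum>\<alpha>\<in>A. m \<alpha> *\<^sub>R a \<alpha>) \<bullet> x k"
        by (simp add: inner_sum_left)
      finally show ?thesis
        by (simp add: m)
    qed
    moreover have "(\<lambda>k. \<Sum>\<alpha>\<in>A. m \<alpha> * ln (f (r k) \<alpha> / c \<alpha>)) \<longlonglongrightarrow> (\<Sum>\<alpha>\<in>A. m \<alpha> * ln (\<nu> \<alpha> / c \<alpha>))"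
    proof (intro tendsto_sum)
      fix \<alpha> assume \<alpha>: "\<alpha> \<in> A"
      show "(\<lambda>k. m \<alpha> * ln (f (r k) \<alpha> / c \<alpha>)) \<longlonglongrightarrow> m \<alpha> * ln (\<nu> \<alpha> / c \<alpha>)"
      \<comment> \<open>Where the limit is 0 the logarithm is not continuous, but there the factor
        \<open>m \<alpha>\<close> vanishes.\<close>
      proof (cases "\<nu> \<alpha> = 0")
        case False
        then have "c \<alpha> \<noteq> 0"
          using \<nu>_0 \<alpha> by auto
        then show ?thesis
          using lim \<alpha> False by (intro tendsto_intros) auto
      qed (use supp \<alpha> in simp)
    qed
    ultimately show ?thesis
      using LIMSEQ_unique[OF _ tendsto_const] by simp
  qed
  then show ?thesis
    using \<nu>_nonneg \<nu>_0 balance d_le by (intro exI[of _ \<nu>]) blast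
qed

section \<open>Circuits\<close>

text \<open>A \<rat>-linear projection of the reals onto the rationals, obtained by extending {1} to
  a basis of the reals over \<rat>. Additivity and compatibility with natural factors are what a
  linear system with natural coefficients requires.\<close>

lemma ex_rational_functional:
  "\<exists>\<phi> :: real \<Rightarrow> real. (\<forall>x y. \<phi> (x + y) = \<phi> x + \<phi> y) \<and> (\<forall>n x. \<phi> (real n * x) = real n * \<phi> x)
     \<and> \<phi> 1 = 1 \<and> (\<forall>x. \<phi> x \<in> \<rat>)"
proof -
  interpret vector_space_pair "\<lambda>(q::rat) (x::real). of_rat q * x" "(*) :: rat \<Rightarrow> rat \<Rightarrow> rat"
    by unfold_locales (simp_all add: algebra_simps of_rat_add of_rat_mult)
  have "vs1.independent {1}"
    by simp
  from linear_independent_extend[OF this, of "\<lambda>_. 1"]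
  obtain g where g: "Vector_Spaces.linear (\<lambda>(q::rat) (x::real). of_rat q * x) ((*) :: rat \<Rightarrow> rat \<Rightarrow> rat) g"
    "g 1 = 1"
    by auto
  interpret g: Vector_Spaces.linear "\<lambda>(q::rat) (x::real). of_rat q * x" "(*) :: rat \<Rightarrow> rat \<Rightarrow> rat" g
    by (rule g(1))
  show ?thesis
  proof (intro exI[of _ "\<lambda>x. of_rat (g x)"] conjI allI)
    show "(of_rat (g (real n * x)) :: real) = real n * of_rat (g x)" for n x
      using g.scale[of "of_nat n" x] by (simp add: of_rat_mult)
  qed (auto simp: g.add g(2) of_rat_add)
qed

lemma common_denominator:
  fixes \<mu> :: "'a \<Rightarrow> real"
  assumes "finite T" "\<And>\<alpha>. \<alpha> \<in> T \<Longrightarrow> \<mu> \<alpha> \<in> \<rat> \<and> 0 \<le> \<mu> \<alpha>"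
  shows "\<exists>N>0. \<forall>\<alpha>\<in>T. real N * \<mu> \<alpha> \<in> \<nat>"
  using assms
proof (induction T)
  case empty
  show ?case
    by (intro exI[of _ 1]) simp
next
  case (insert \<beta> T)
  obtain N where N: "0 < N" "\<forall>\<alpha>\<in>T. real N * \<mu> \<alpha> \<in> \<nat>"
    using insert by auto
  have "\<mu> \<beta> \<in> \<rat>"
    using insert.prems by simp
  then obtain p q :: nat where pq: "q \<noteq> 0" "\<bar>\<mu> \<beta>\<bar> = real p / real q"
    by (rule Rats_abs_nat_div_natE)
  have \<beta>: "real (N * q) * \<mu> \<beta> = real (N * p)"
    using pq insert.prems[of \<beta>] by (simp add: field_simps)
  have "real (N * q) * \<mu> \<alpha> \<in> \<nat>" if "\<alpha> \<in> T" for \<alpha>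
  proof -
    have "real (N * q) * \<mu> \<alpha> = real q * (real N * \<mu> \<alpha>)"
      by simp
    moreover have "real N * \<mu> \<alpha> \<in> \<nat>"
      using N(2) that by blast
    then have "real q * (real N * \<mu> \<alpha>) \<in> \<nat>"
      by (rule Nats_mult[OF of_nat_in_Nats])
    ultimately show ?thesis
      by (simp only:)
  qed
  then have "\<forall>\<alpha>\<in>insert \<beta> T. real (N * q) * \<mu> \<alpha> \<in> \<nat>"
    unfolding ball_simps \<beta> using of_nat_in_Nats by blast
  then show ?case
    using N(1) pq(1) by (intro exI[of _ "N * q"]) simp
qed

text \<open>A circuit in integer form: the support of \<open>m\<close> is the vertex set, and
  \<open>m\<close> divided by its total gives the barycentric coordinates of \<beta>. As the support
  is implicit in \<open>m\<close>, sums may run over all of \<open>A\<close>.\<close>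

definition circuit_weight :: "'n::finite exponent set \<Rightarrow> 'n exponent \<Rightarrow> ('n exponent \<Rightarrow> nat) \<Rightarrow> bool" where
  "circuit_weight A \<beta> m \<longleftrightarrow> {\<alpha>. 0 < m \<alpha>} \<subseteq> A \<and> {\<alpha>. 0 < m \<alpha>} \<noteq> {}
     \<and> \<not> affine_dependent (real_exp ` {\<alpha>. 0 < m \<alpha>})
     \<and> (\<Sum>\<alpha>\<in>A. real (m \<alpha>) *\<^sub>R (real_exp \<alpha> - real_exp \<beta>)) = 0"

lemma inj_real_exp: "inj real_exp"
  by (rule injI) (simp add: real_exp_def vec_eq_iff)

lemma affine_independent_imp_zero:
  fixes u :: "'n::finite exponent \<Rightarrow> real"
  assumes "finite T" "\<not> affine_dependent (real_exp ` T)"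
    and "(\<Sum>\<alpha>\<in>T. u \<alpha>) = 0" "(\<Sum>\<alpha>\<in>T. u \<alpha> *\<^sub>R real_exp \<alpha>) = 0" "\<alpha> \<in> T"
  shows "u \<alpha> = 0"
proof -
  have inj: "inj_on real_exp T"
    using inj_real_exp by (rule inj_on_subset) simp
  define U where "U v = u (inv real_exp v)" for v :: "real ^ 'n"
  have U: "U (real_exp \<alpha>) = u \<alpha>" for \<alpha>
    by (simp add: U_def inv_f_f[OF inj_real_exp])
  have "sum U (real_exp ` T) = 0" "(\<Sum>v\<in>real_exp ` T. U v *\<^sub>R v) = 0"
    using assms(3,4) by (simp_all add: sum.reindex[OF inj] U)
  then have "\<forall>v\<in>real_exp ` T. U v = 0"
    using assms(2) affine_dependent_explicit_finite[of "real_exp ` T"] assms(1) by blast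
  then show ?thesis
    using assms(5) U by auto
qed

lemma affine_dependent_relation:
  fixes T :: "'n::finite exponent set"
  assumes "finite T" "affine_dependent (real_exp ` T)"
  shows "\<exists>u. (\<Sum>\<alpha>\<in>T. u \<alpha>) = 0 \<and> (\<exists>\<alpha>\<in>T. u \<alpha> \<noteq> 0) \<and> (\<Sum>\<alpha>\<in>T. u \<alpha> *\<^sub>R real_exp \<alpha>) = 0"
proof -
  have inj: "inj_on real_exp T"
    using inj_real_exp by (rule inj_on_subset) simp
  obtain U where U: "sum U (real_exp ` T) = 0" "\<exists>v\<in>real_exp ` T. U v \<noteq> 0"
      "(\<Sum>v\<in>real_exp ` T. U v *\<^sub>R v) = 0"
    using assms affine_dependent_explicit_finite[of "real_exp ` T"] by auto
  then show ?thesis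
    by (intro exI[of _ "U \<circ> real_exp"]) (auto simp: sum.reindex[OF inj])
qed

text \<open>The support of a solution with as few nonzero entries as possible is affinely independent,
  since an affine dependence could be used to cancel another entry.\<close>

lemma ex_affine_independent_solution:
  fixes \<nu> :: "'n::finite exponent \<Rightarrow> real"
  assumes "finite T" "T \<noteq> {}" "\<And>\<alpha>. \<alpha> \<in> T \<Longrightarrow> 0 < \<nu> \<alpha>"
    and "(\<Sum>\<alpha>\<in>T. \<nu> \<alpha> *\<^sub>R (real_exp \<alpha> - b)) = 0"
  shows "\<exists>S \<mu>. S \<subseteq> T \<and> S \<noteq> {} \<and> (\<forall>\<alpha>\<in>S. 0 < \<mu> \<alpha>) \<and> \<not> affine_dependent (real_exp ` S)
    \<and> (\<Sum>\<alpha>\<in>S. \<mu> \<alpha> *\<^sub>R (real_exp \<alpha> - b)) = 0"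
  using assms
proof (induction "card T" arbitrary: T \<nu> rule: less_induct)
  case less
  show ?case
  proof (cases "affine_dependent (real_exp ` T)")
    case False
    then show ?thesis
      using less.prems by blast
  next
    case True
    then obtain u where u: "(\<Sum>\<alpha>\<in>T. u \<alpha>) = 0" "\<exists>\<alpha>\<in>T. u \<alpha> \<noteq> 0" "(\<Sum>\<alpha>\<in>T. u \<alpha> *\<^sub>R real_exp \<alpha>) = 0"
      using affine_dependent_relation[OF less.prems(1)] by blast
    define P where "P = {\<alpha>\<in>T. 0 < u \<alpha>}"
    have P: "finite P" "P \<noteq> {}"
    proof -
      have "\<exists>\<alpha>\<in>T. 0 < u \<alpha>"
      proof (rule ccontr)
        assume "\<not> (\<exists>\<alpha>\<in>T. 0 < u \<alpha>)"
        then have "\<forall>\<alpha>\<in>T. 0 \<le> - u \<alpha>"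
          by auto
        moreover have "(\<Sum>\<alpha>\<in>T. - u \<alpha>) = 0"
          using u(1) by (simp add: sum_negf)
        ultimately have "\<forall>\<alpha>\<in>T. - u \<alpha> = 0"
          using less.prems(1) sum_nonneg_eq_0_iff[of T "\<lambda>\<alpha>. - u \<alpha>"] by blast
        then show False
          using u(2) by auto
      qed
      then show "finite P" "P \<noteq> {}"
        using less.prems(1) by (auto simp: P_def)
    qed
    \<comment> \<open>The largest multiple of the relation that can be subtracted without making an
      entry negative; the entry at which the minimum is attained becomes 0.\<close>
    define t where "t = Min ((\<lambda>\<alpha>. \<nu> \<alpha> / u \<alpha>) ` P)"
    have t_le: "t \<le> \<nu> \<alpha> / u \<alpha>" if "\<alpha> \<in> P" for \<alpha>
      using that P by (simp add: t_def)
    have "t \<in> (\<lambda>\<alpha>. \<nu> \<alpha> / u \<alpha>) ` P"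
      unfolding t_def using P by (intro Min_in) auto
    then obtain \<gamma> where \<gamma>: "\<gamma> \<in> P" "t = \<nu> \<gamma> / u \<gamma>"
      by auto
    have t: "0 < t"
      using \<gamma> less.prems(3) by (simp add: P_def)
    define \<mu> where "\<mu> \<alpha> = \<nu> \<alpha> - t * u \<alpha>" for \<alpha>
    have \<mu>_nonneg: "0 \<le> \<mu> \<alpha>" if "\<alpha> \<in> T" for \<alpha>
    proof (cases "0 < u \<alpha>")
      case True
      then show ?thesis
        using t_le[of \<alpha>] that by (simp add: P_def \<mu>_def field_simps)
    next
      case False
      then have "t * u \<alpha> \<le> 0"
        using t by (simp add: mult_le_0_iff)
      then show ?thesis
        using less.prems(3)[OF that] by (simp add: \<mu>_def)
    qed
    define S where "S = {\<alpha>\<in>T. \<mu> \<alpha> \<noteq> 0}"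
    have "\<mu> \<gamma> = 0"
      using \<gamma> by (simp add: \<mu>_def P_def)
    then have "S \<subset> T"
      using \<gamma>(1) by (auto simp: S_def P_def)
    then have card: "card S < card T"
      using less.prems(1) by (simp add: psubset_card_mono)
    have sum_S: "(\<Sum>\<alpha>\<in>S. \<mu> \<alpha> *\<^sub>R v \<alpha>) = (\<Sum>\<alpha>\<in>T. \<mu> \<alpha> *\<^sub>R v \<alpha>)" for v :: "'n exponent \<Rightarrow> 'c::real_vector"
      by (rule sum.mono_neutral_left) (use less.prems(1) in \<open>auto simp: S_def\<close>)
    \<comment> \<open>The coefficients of an affine relation sum to 0, so the total weight is
      preserved and the new support is not empty.\<close>
    have "(\<Sum>\<alpha>\<in>T. \<mu> \<alpha>) = (\<Sum>\<alpha>\<in>T. \<nu> \<alpha>)"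
      using u(1) by (simp add: \<mu>_def sum_subtractf sum_distrib_left[symmetric])
    then have "0 < (\<Sum>\<alpha>\<in>T. \<mu> \<alpha>)"
      using less.prems(1-3) by (simp add: sum_pos)
    then have "S \<noteq> {}"
      using sum_S[of "\<lambda>_. 1::real"] by auto
    have "(\<Sum>\<alpha>\<in>T. u \<alpha> *\<^sub>R (real_exp \<alpha> - b)) = 0"
      using u(1,3) by (simp add: scaleR_diff_right sum_subtractf scaleR_sum_left[symmetric])
    then have "(\<Sum>\<alpha>\<in>T. (t * u \<alpha>) *\<^sub>R (real_exp \<alpha> - b)) = 0"
      by (simp only: scaleR_scaleR[symmetric] scaleR_sum_right[symmetric] scaleR_zero_right)
    then have "(\<Sum>\<alpha>\<in>S. \<mu> \<alpha> *\<^sub>R (real_exp \<alpha> - b)) = 0"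
      unfolding sum_S using less.prems(4) by (simp add: \<mu>_def scaleR_diff_left sum_subtractf)
    moreover have "finite S" "\<And>\<alpha>. \<alpha> \<in> S \<Longrightarrow> 0 < \<mu> \<alpha>"
      using less.prems(1) \<mu>_nonneg by (auto simp: S_def less_le)
    ultimately have "\<exists>S' \<mu>'. S' \<subseteq> S \<and> S' \<noteq> {} \<and> (\<forall>\<alpha>\<in>S'. 0 < \<mu>' \<alpha>) \<and> \<not> affine_dependent (real_exp ` S')
        \<and> (\<Sum>\<alpha>\<in>S'. \<mu>' \<alpha> *\<^sub>R (real_exp \<alpha> - b)) = 0"
      using less.hyps[OF card, of \<mu>] \<open>S \<noteq> {}\<close> by blast
    then show ?thesis
      using \<open>S \<subset> T\<close> by blast
  qed
qed

text \<open>Barycentric coordinates of a lattice point with respect to affinely independent lattice points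
  are rational: a \<open>\<rat>\<close>-linear functional fixing 1 maps them to a solution of the same linear
  system, which has only one solution.\<close>

lemma rational_barycentric:
  fixes \<mu> :: "'n::finite exponent \<Rightarrow> real"
  assumes T: "finite T" "\<not> affine_dependent (real_exp ` T)"
    and \<mu>: "(\<Sum>\<alpha>\<in>T. \<mu> \<alpha>) = 1" "(\<Sum>\<alpha>\<in>T. \<mu> \<alpha> *\<^sub>R (real_exp \<alpha> - real_exp \<beta>)) = 0" and \<alpha>: "\<alpha> \<in> T"
  shows "\<mu> \<alpha> \<in> \<rat>"
proof -
  obtain \<phi> :: "real \<Rightarrow> real" where "\<forall>x y. \<phi> (x + y) = \<phi> x + \<phi> y"
    "\<forall>n x. \<phi> (real n * x) = real n * \<phi> x" and \<phi>1: "\<phi> 1 = 1" and "\<forall>x. \<phi> x \<in> \<rat>"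
    using ex_rational_functional by (elim exE conjE) (rule that)
  then have \<phi>_add: "\<phi> (x + y) = \<phi> x + \<phi> y" and \<phi>_mult: "\<phi> (real n * x) = real n * \<phi> x"
    and \<phi>_rat: "\<phi> x \<in> \<rat>" for x y n
    by auto
  have \<phi>0: "\<phi> 0 = 0"
    using \<phi>_mult[of 0 0] by simp
  have \<phi>_sum: "\<phi> (sum f T) = (\<Sum>\<alpha>\<in>T. \<phi> (f \<alpha>))" for f
    by (induction T rule: infinite_finite_induct) (auto simp: \<phi>0 \<phi>_add)
  have eq: "(\<Sum>\<alpha>\<in>T. \<mu> \<alpha> *\<^sub>R real_exp \<alpha>) = real_exp \<beta>"
    using \<mu> by (simp add: scaleR_diff_right sum_subtractf scaleR_sum_left[symmetric])
  have "(\<Sum>\<alpha>\<in>T. \<phi> (\<mu> \<alpha>) *\<^sub>R real_exp \<alpha>) = real_exp \<beta>"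
  proof (rule vec_eq_iff[THEN iffD2], rule allI)
    fix i
    have "(\<Sum>\<alpha>\<in>T. real (\<alpha> $ i) * \<mu> \<alpha>) = real (\<beta> $ i)"
      using arg_cong[OF eq, of "\<lambda>v. v $ i"] by (simp add: real_exp_def mult.commute)
    then have "\<phi> (\<Sum>\<alpha>\<in>T. real (\<alpha> $ i) * \<mu> \<alpha>) = \<phi> (real (\<beta> $ i) * 1)"
      by simp
    then show "(\<Sum>\<alpha>\<in>T. \<phi> (\<mu> \<alpha>) *\<^sub>R real_exp \<alpha>) $ i = real_exp \<beta> $ i"
      by (simp only: \<phi>_sum \<phi>_mult \<phi>1) (simp add: real_exp_def mult.commute)
  qed
  then have "(\<Sum>\<alpha>\<in>T. (\<phi> (\<mu> \<alpha>) - \<mu> \<alpha>) *\<^sub>R real_exp \<alpha>) = 0"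
    using eq by (simp add: scaleR_diff_left sum_subtractf)
  moreover have "(\<Sum>\<alpha>\<in>T. \<phi> (\<mu> \<alpha>) - \<mu> \<alpha>) = 0"
    using \<mu>(1) \<phi>1 by (simp add: \<phi>_sum[symmetric] sum_subtractf)
  ultimately have "\<phi> (\<mu> \<alpha>) - \<mu> \<alpha> = 0"
    using affine_independent_imp_zero[OF T, of "\<lambda>\<alpha>. \<phi> (\<mu> \<alpha>) - \<mu> \<alpha>" \<alpha>] \<alpha> by blast
  then show ?thesis
    using \<phi>_rat[of "\<mu> \<alpha>"] by simp
qed

text \<open>The support of \<nu> contains an affinely independent set with positive weights balanced
  at \<beta>. Scaled to total 1 these weights are rational, and a common denominator makes them
  integers.\<close>

lemma ex_circuit_weight:
  fixes \<nu> :: "'n::finite exponent \<Rightarrow> real"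
  assumes A: "finite A" and \<nu>: "\<And>\<alpha>. \<alpha> \<in> A \<Longrightarrow> 0 \<le> \<nu> \<alpha>" "\<exists>\<alpha>\<in>A. \<nu> \<alpha> \<noteq> 0"
    "(\<Sum>\<alpha>\<in>A. \<nu> \<alpha> *\<^sub>R (real_exp \<alpha> - real_exp \<beta>)) = 0"
  shows "\<exists>m. circuit_weight A \<beta> m \<and> (\<forall>\<alpha>. 0 < m \<alpha> \<longrightarrow> \<nu> \<alpha> \<noteq> 0)"
proof -
  define T where "T = {\<alpha>\<in>A. \<nu> \<alpha> \<noteq> 0}"
  have "(\<Sum>\<alpha>\<in>T. \<nu> \<alpha> *\<^sub>R (real_exp \<alpha> - real_exp \<beta>)) = (\<Sum>\<alpha>\<in>A. \<nu> \<alpha> *\<^sub>R (real_exp \<alpha> - real_exp \<beta>))"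
    by (rule sum.mono_neutral_left) (use A in \<open>auto simp: T_def\<close>)
  then have "\<exists>S \<mu>. S \<subseteq> T \<and> S \<noteq> {} \<and> (\<forall>\<alpha>\<in>S. 0 < \<mu> \<alpha>) \<and> \<not> affine_dependent (real_exp ` S)
    \<and> (\<Sum>\<alpha>\<in>S. \<mu> \<alpha> *\<^sub>R (real_exp \<alpha> - real_exp \<beta>)) = 0"
    using A \<nu> by (intro ex_affine_independent_solution[of T \<nu>]) (auto simp: T_def less_le)
  then obtain S \<mu> where S: "S \<subseteq> T" "S \<noteq> {}" "\<And>\<alpha>. \<alpha> \<in> S \<Longrightarrow> 0 < \<mu> \<alpha>"
    "\<not> affine_dependent (real_exp ` S)" "(\<Sum>\<alpha>\<in>S. \<mu> \<alpha> *\<^sub>R (real_exp \<alpha> - real_exp \<beta>)) = 0"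
    by blast
  have fin: "finite S"
    using S(1) A by (auto simp: T_def intro: finite_subset)
  define \<kappa> where "\<kappa> \<alpha> = \<mu> \<alpha> / sum \<mu> S" for \<alpha>
  have "0 < sum \<mu> S"
    using fin S(2,3) by (rule sum_pos)
  then have \<kappa>_pos: "0 < \<kappa> \<alpha>" if "\<alpha> \<in> S" for \<alpha>
    using that S(3) by (simp add: \<kappa>_def)
  have \<kappa>1: "(\<Sum>\<alpha>\<in>S. \<kappa> \<alpha>) = 1"
    using \<open>0 < sum \<mu> S\<close> by (simp add: \<kappa>_def sum_divide_distrib[symmetric])
  have "(\<Sum>\<alpha>\<in>S. \<kappa> \<alpha> *\<^sub>R (real_exp \<alpha> - real_exp \<beta>))
      = inverse (sum \<mu> S) *\<^sub>R (\<Sum>\<alpha>\<in>S. \<mu> \<alpha> *\<^sub>R (real_exp \<alpha> - real_exp \<beta>))"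
    unfolding scaleR_sum_right scaleR_scaleR by (simp add: \<kappa>_def divide_inverse mult.commute)
  then have \<kappa>0: "(\<Sum>\<alpha>\<in>S. \<kappa> \<alpha> *\<^sub>R (real_exp \<alpha> - real_exp \<beta>)) = 0"
    by (simp add: S(5))
  have \<kappa>_rat: "\<kappa> \<alpha> \<in> \<rat> \<and> 0 \<le> \<kappa> \<alpha>" if "\<alpha> \<in> S" for \<alpha>
    using rational_barycentric[OF fin S(4) \<kappa>1 \<kappa>0 that] \<kappa>_pos[OF that] by simp
  have "\<exists>N>0. \<forall>\<alpha>\<in>S. real N * \<kappa> \<alpha> \<in> \<nat>"
    by (rule common_denominator[OF fin \<kappa>_rat])
  then obtain N where N: "0 < N" "\<forall>\<alpha>\<in>S. real N * \<kappa> \<alpha> \<in> \<nat>"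
    by blast
  \<comment> \<open>The floor only converts the type: \<open>real N * \<kappa> \<alpha>\<close> is
    already a natural number.\<close>
  define m where "m \<alpha> = (if \<alpha> \<in> S then nat \<lfloor>real N * \<kappa> \<alpha>\<rfloor> else 0)" for \<alpha>
  have m: "real (m \<alpha>) = real N * \<kappa> \<alpha>" if "\<alpha> \<in> S" for \<alpha>
    using N(2) that by (auto simp: m_def elim!: Nats_cases)
  have supp: "{\<alpha>. 0 < m \<alpha>} = S"
  proof (intro set_eqI iffI CollectI)
    fix \<alpha> assume "\<alpha> \<in> S"
    then have "0 < real (m \<alpha>)"
      using m \<kappa>_pos N(1) by simp
    then show "0 < m \<alpha>"
      by simp
  qed (auto simp: m_def split: if_splits)
  have "(\<Sum>\<alpha>\<in>A. real (m \<alpha>) *\<^sub>R (real_exp \<alpha> - real_exp \<beta>)) = (\<Sum>\<alpha>\<in>S. real (m \<alpha>) *\<^sub>R (real_exp \<alpha> - real_exp \<beta>))"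
    by (rule sum.mono_neutral_right) (use A S(1) in \<open>auto simp: m_def T_def\<close>)
  also have "\<dots> = (\<Sum>\<alpha>\<in>S. real N *\<^sub>R (\<kappa> \<alpha> *\<^sub>R (real_exp \<alpha> - real_exp \<beta>)))"
    by (intro sum.cong) (simp_all add: m)
  also have "\<dots> = 0"
    unfolding scaleR_sum_right[symmetric] by (simp add: \<kappa>0)
  finally have "circuit_weight A \<beta> m"
    unfolding circuit_weight_def supp using S(1,2,4) by (auto simp: T_def)
  then show ?thesis
    using supp S(1) by (intro exI[of _ m]) (auto simp: T_def)
qed

text \<open>There are infinitely many weights, but the last clause depends on their supports alone.
  One weight is chosen for each subset of \<open>A\<close> that occurs as a support.\<close>

lemma ex_finite_circuit_family:
  fixes A :: "'n::finite exponent set"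
  assumes A: "finite A"
  shows "\<exists>\<M>. finite \<M> \<and> (\<forall>m\<in>\<M>. circuit_weight A \<beta> m) \<and>
    (\<forall>\<nu>. (\<forall>\<alpha>\<in>A. 0 \<le> \<nu> \<alpha>) \<longrightarrow> (\<exists>\<alpha>\<in>A. \<nu> \<alpha> \<noteq> 0) \<longrightarrow>
        (\<Sum>\<alpha>\<in>A. \<nu> \<alpha> *\<^sub>R (real_exp \<alpha> - real_exp \<beta>)) = 0 \<longrightarrow>
        (\<exists>m\<in>\<M>. \<forall>\<alpha>. 0 < m \<alpha> \<longrightarrow> \<nu> \<alpha> \<noteq> 0))"
proof -
  define \<T> where "\<T> = {T. \<exists>m. circuit_weight A \<beta> m \<and> {\<alpha>. 0 < m \<alpha>} = T}"
  have "\<T> \<subseteq> Pow A"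
    by (auto simp: \<T>_def circuit_weight_def)
  then have fin: "finite \<T>"
    using A by (simp add: finite_subset)
  have "\<forall>T\<in>\<T>. \<exists>m. circuit_weight A \<beta> m \<and> {\<alpha>. 0 < m \<alpha>} = T"
    by (simp add: \<T>_def)
  then obtain M where M: "\<forall>T\<in>\<T>. circuit_weight A \<beta> (M T) \<and> {\<alpha>. 0 < M T \<alpha>} = T"
    by metis
  show ?thesis
  proof (intro exI[of _ "M ` \<T>"] conjI allI impI)
    fix \<nu> :: "'n exponent \<Rightarrow> real"
    assume "\<forall>\<alpha>\<in>A. 0 \<le> \<nu> \<alpha>" "\<exists>\<alpha>\<in>A. \<nu> \<alpha> \<noteq> 0"
      "(\<Sum>\<alpha>\<in>A. \<nu> \<alpha> *\<^sub>R (real_exp \<alpha> - real_exp \<beta>)) = 0"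
    then have "\<exists>m. circuit_weight A \<beta> m \<and> (\<forall>\<alpha>. 0 < m \<alpha> \<longrightarrow> \<nu> \<alpha> \<noteq> 0)"
      by (intro ex_circuit_weight[OF A]) simp_all
    then obtain m where m: "circuit_weight A \<beta> m" "\<forall>\<alpha>. 0 < m \<alpha> \<longrightarrow> \<nu> \<alpha> \<noteq> 0"
      by blast
    then have T: "{\<alpha>. 0 < m \<alpha>} \<in> \<T>"
      by (auto simp: \<T>_def)
    have "{\<alpha>. 0 < M {\<alpha>. 0 < m \<alpha>} \<alpha>} = {\<alpha>. 0 < m \<alpha>}"
      using bspec[OF M T] by (rule conjunct2)
    then have "0 < M {\<alpha>. 0 < m \<alpha>} \<alpha> \<longleftrightarrow> 0 < m \<alpha>" for \<alpha>
      by (simp add: set_eq_iff)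
    then show "\<exists>m\<in>M ` \<T>. \<forall>\<alpha>. 0 < m \<alpha> \<longrightarrow> \<nu> \<alpha> \<noteq> 0"
      using m(2) by (intro bexI[of _ "M {\<alpha>. 0 < m \<alpha>}"] imageI T) simp
  qed (use fin M in auto)
qed

section \<open>Splitting exponential sums along circuits\<close>

text \<open>As long as \<nu> is nonzero, the family offers an \<open>m\<close> supported inside the
  support of \<nu>. Subtracting the largest admissible multiple of it keeps the balance and removes
  an entry, so the support shrinks.\<close>

lemma circuit_conic_decomposition:
  fixes A :: "'n::finite exponent set" and \<M> :: "('n exponent \<Rightarrow> nat) set"
  assumes A: "finite A" and \<M>: "finite \<M>" "\<And>m. m \<in> \<M> \<Longrightarrow> circuit_weight A \<beta> m"
    and ex: "\<And>\<nu>. (\<And>\<alpha>. \<alpha> \<in> A \<Longrightarrow> 0 \<le> \<nu> \<alpha>) \<Longrightarrow> \<exists>\<alpha>\<in>A. \<nu> \<alpha> \<noteq> 0 \<Longrightarrow>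
      (\<Sum>\<alpha>\<in>A. \<nu> \<alpha> *\<^sub>R (real_exp \<alpha> - real_exp \<beta>)) = 0 \<Longrightarrow>
      \<exists>m\<in>\<M>. \<forall>\<alpha>. 0 < m \<alpha> \<longrightarrow> \<nu> \<alpha> \<noteq> 0"
    and \<nu>: "\<And>\<alpha>. \<alpha> \<in> A \<Longrightarrow> 0 \<le> \<nu> \<alpha>" "(\<Sum>\<alpha>\<in>A. \<nu> \<alpha> *\<^sub>R (real_exp \<alpha> - real_exp \<beta>)) = 0"
  shows "\<exists>s. (\<forall>m\<in>\<M>. 0 \<le> s m) \<and> (\<forall>\<alpha>\<in>A. \<nu> \<alpha> = (\<Sum>m\<in>\<M>. s m * real (m \<alpha>)))"
  using \<nu>
proof (induction "card {\<alpha>\<in>A. \<nu> \<alpha> \<noteq> 0}" arbitrary: \<nu> rule: less_induct)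
  case less
  show ?case
  proof (cases "\<exists>\<alpha>\<in>A. \<nu> \<alpha> \<noteq> 0")
    case False
    then show ?thesis
      by (intro exI[of _ "\<lambda>_. 0"]) simp
  next
    case True
    obtain m where m: "m \<in> \<M>" "\<forall>\<alpha>. 0 < m \<alpha> \<longrightarrow> \<nu> \<alpha> \<noteq> 0"
      using ex[OF less.prems(1) True less.prems(2)] by blast
    define T where "T = {\<alpha>. 0 < m \<alpha>}"
    have T: "T \<subseteq> A" "T \<noteq> {}" "finite T" and bal: "(\<Sum>\<alpha>\<in>A. real (m \<alpha>) *\<^sub>R (real_exp \<alpha> - real_exp \<beta>)) = 0"
      using \<M>(2)[OF m(1)] A unfolding circuit_weight_def T_def by (blast intro: finite_subset)+
    define t where "t = Min ((\<lambda>\<alpha>. \<nu> \<alpha> / real (m \<alpha>)) ` T)"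
    have t_le: "t \<le> \<nu> \<alpha> / real (m \<alpha>)" if "\<alpha> \<in> T" for \<alpha>
      using that T by (simp add: t_def)
    have "t \<in> (\<lambda>\<alpha>. \<nu> \<alpha> / real (m \<alpha>)) ` T"
      unfolding t_def using T by (intro Min_in) auto
    then obtain \<gamma> where \<gamma>: "\<gamma> \<in> T" "t = \<nu> \<gamma> / real (m \<gamma>)"
      by auto
    have t: "0 \<le> t"
      using \<gamma> T(1) less.prems(1)[of \<gamma>] by auto
    define \<mu> where "\<mu> \<alpha> = \<nu> \<alpha> - t * real (m \<alpha>)" for \<alpha>
    have nonneg: "0 \<le> \<mu> \<alpha>" if "\<alpha> \<in> A" for \<alpha>
    proof (cases "\<alpha> \<in> T")
      case True
      then show ?thesis
        using t_le[OF True] by (simp add: \<mu>_def T_def field_simps)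
    next
      case False
      then show ?thesis
        using less.prems(1)[OF that] by (simp add: \<mu>_def T_def)
    qed
    have "(\<Sum>\<alpha>\<in>A. (t * real (m \<alpha>)) *\<^sub>R (real_exp \<alpha> - real_exp \<beta>)) = 0"
      using bal by (simp only: scaleR_scaleR[symmetric] scaleR_sum_right[symmetric] scaleR_zero_right)
    then have bal': "(\<Sum>\<alpha>\<in>A. \<mu> \<alpha> *\<^sub>R (real_exp \<alpha> - real_exp \<beta>)) = 0"
      using less.prems(2) by (simp add: \<mu>_def scaleR_diff_left sum_subtractf)
    have "\<mu> \<gamma> = 0"
      using \<gamma> by (simp add: \<mu>_def T_def)
    moreover have "\<nu> \<gamma> \<noteq> 0" "\<gamma> \<in> A"
      using \<gamma>(1) m(2) T(1) by (auto simp: T_def)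
    moreover have "\<nu> \<alpha> \<noteq> 0" if "\<mu> \<alpha> \<noteq> 0" for \<alpha>
      using that m(2) by (cases "m \<alpha> = 0") (auto simp: \<mu>_def)
    ultimately have "{\<alpha>\<in>A. \<mu> \<alpha> \<noteq> 0} \<subset> {\<alpha>\<in>A. \<nu> \<alpha> \<noteq> 0}"
      by blast
    then have "card {\<alpha>\<in>A. \<mu> \<alpha> \<noteq> 0} < card {\<alpha>\<in>A. \<nu> \<alpha> \<noteq> 0}"
      using A by (intro psubset_card_mono) auto
    then have "\<exists>s. (\<forall>m\<in>\<M>. 0 \<le> s m) \<and> (\<forall>\<alpha>\<in>A. \<mu> \<alpha> = (\<Sum>m\<in>\<M>. s m * real (m \<alpha>)))"
      by (rule less.hyps[OF _ nonneg bal'])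
    then obtain s where s: "\<forall>m\<in>\<M>. 0 \<le> s m" "\<forall>\<alpha>\<in>A. \<mu> \<alpha> = (\<Sum>m\<in>\<M>. s m * real (m \<alpha>))"
      by blast
    have "\<nu> \<alpha> = (\<Sum>m'\<in>\<M>. (s(m := s m + t)) m' * real (m' \<alpha>))" if "\<alpha> \<in> A" for \<alpha>
    proof -
      have "(\<Sum>m'\<in>\<M>. (s(m := s m + t)) m' * real (m' \<alpha>))
          = (\<Sum>m'\<in>\<M>. s m' * real (m' \<alpha>) + (if m' = m then t * real (m \<alpha>) else 0))"
        by (rule sum.cong) (auto simp: algebra_simps)
      also have "\<dots> = \<mu> \<alpha> + t * real (m \<alpha>)"
        using s(2) that m(1) \<M>(1) by (simp add: sum.distrib)
      finally show ?thesis
        by (simp add: \<mu>_def)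
    qed
    then show ?thesis
      using s(1) t by (intro exI[of _ "s(m := s m + t)"]) auto
  qed
qed

text \<open>Let \<nu> be the certificate of the lower bound, with total q, and split it conically
  into circuits with factors s m. Each circuit receives the share of c \<alpha> that it has in \<nu>
  \<alpha>. The logarithmic condition says that the ratios \<nu> / c have weighted product 1 along
  the circuit, so the product of the powers of u is exactly (s m M)^M. The inner coefficient may
  thus be as large as s m M; these values sum to q, and scaling by d / q \<le> 1 makes them sum to
  d.\<close>

lemma age_circuit_decomposition:
  fixes A :: "'n::finite exponent set" and \<M> :: "('n exponent \<Rightarrow> nat) set"
  assumes A: "finite A" and \<M>: "finite \<M>" "\<And>m. m \<in> \<M> \<Longrightarrow> circuit_weight A \<beta> m"
    and ex: "\<And>\<nu>. (\<And>\<alpha>. \<alpha> \<in> A \<Longrightarrow> 0 \<le> \<nu> \<alpha>) \<Longrightarrow> \<exists>\<alpha>\<in>A. \<nu> \<alpha> \<noteq> 0 \<Longrightarrow>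
      (\<Sum>\<alpha>\<in>A. \<nu> \<alpha> *\<^sub>R (real_exp \<alpha> - real_exp \<beta>)) = 0 \<Longrightarrow>
      \<exists>m\<in>\<M>. \<forall>\<alpha>. 0 < m \<alpha> \<longrightarrow> \<nu> \<alpha> \<noteq> 0"
    and c: "\<And>\<alpha>. \<alpha> \<in> A \<Longrightarrow> 0 \<le> c \<alpha>" and d: "0 \<le> d"
    and dom: "\<And>x. d \<le> (\<Sum>\<alpha>\<in>A. c \<alpha> * exp ((real_exp \<alpha> - real_exp \<beta>) \<bullet> x))"
  shows "\<exists>u D. (\<forall>m\<in>\<M>. (\<forall>\<alpha>\<in>A. 0 \<le> u m \<alpha>) \<and> 0 \<le> D m \<and> D m ^ (\<Sum>\<alpha>\<in>A. m \<alpha>) \<le> (\<Prod>\<alpha>\<in>A. u m \<alpha> ^ m \<alpha>))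
    \<and> (\<forall>\<alpha>\<in>A. (\<Sum>m\<in>\<M>. u m \<alpha> * (real (m \<alpha>) / real (\<Sum>\<alpha>\<in>A. m \<alpha>))) \<le> c \<alpha>)
    \<and> (\<Sum>m\<in>\<M>. D m) = d"
proof -
  let ?a = "\<lambda>\<alpha>. real_exp \<alpha> - real_exp \<beta>"
  have "\<exists>\<nu>. (\<forall>\<alpha>\<in>A. 0 \<le> \<nu> \<alpha> \<and> (c \<alpha> = 0 \<longrightarrow> \<nu> \<alpha> = 0)) \<and> (\<Sum>\<alpha>\<in>A. \<nu> \<alpha> *\<^sub>R ?a \<alpha>) = 0
    \<and> d \<le> (\<Sum>\<alpha>\<in>A. \<nu> \<alpha>)
    \<and> (\<forall>m. (\<forall>\<alpha>\<in>A. \<nu> \<alpha> = 0 \<longrightarrow> m \<alpha> = 0) \<longrightarrow> (\<Sum>\<alpha>\<in>A. m \<alpha> *\<^sub>R ?a \<alpha>) = 0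
          \<longrightarrow> (\<Sum>\<alpha>\<in>A. m \<alpha> * ln (\<nu> \<alpha> / c \<alpha>)) = 0)"
    by (rule exp_sum_lower_bound_certificate[OF A c dom])
  then obtain \<nu> where \<nu>: "\<forall>\<alpha>\<in>A. 0 \<le> \<nu> \<alpha> \<and> (c \<alpha> = 0 \<longrightarrow> \<nu> \<alpha> = 0)" "(\<Sum>\<alpha>\<in>A. \<nu> \<alpha> *\<^sub>R ?a \<alpha>) = 0"
      "d \<le> (\<Sum>\<alpha>\<in>A. \<nu> \<alpha>)"
    and ln0: "\<And>m. \<forall>\<alpha>\<in>A. \<nu> \<alpha> = 0 \<longrightarrow> m \<alpha> = 0 \<Longrightarrow> (\<Sum>\<alpha>\<in>A. m \<alpha> *\<^sub>R ?a \<alpha>) = 0 \<Longrightarrow>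
      (\<Sum>\<alpha>\<in>A. m \<alpha> * ln (\<nu> \<alpha> / c \<alpha>)) = 0"
    by (elim exE conjE) (rule that, auto)
  have "\<exists>s. (\<forall>m\<in>\<M>. 0 \<le> s m) \<and> (\<forall>\<alpha>\<in>A. \<nu> \<alpha> = (\<Sum>m\<in>\<M>. s m * real (m \<alpha>)))"
    by (rule circuit_conic_decomposition[OF A \<M> ex]) (use \<nu> in auto)
  then obtain s where s: "\<forall>m\<in>\<M>. 0 \<le> s m" "\<forall>\<alpha>\<in>A. \<nu> \<alpha> = (\<Sum>m\<in>\<M>. s m * real (m \<alpha>))"
    by blast
  define M where "M m = (\<Sum>\<alpha>\<in>A. m \<alpha>)" for m :: "'n exponent \<Rightarrow> nat"
  have M_pos: "0 < M m" if m: "m \<in> \<M>" for m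
  proof -
    obtain \<alpha> where "\<alpha> \<in> A" "0 < m \<alpha>"
      using \<M>(2)[OF m] by (auto simp: circuit_weight_def)
    then show ?thesis
      using A unfolding M_def by (intro sum_pos2[of _ \<alpha>]) auto
  qed
  define q where "q = (\<Sum>\<alpha>\<in>A. \<nu> \<alpha>)"
  have q: "q = (\<Sum>m\<in>\<M>. s m * real (M m))"
  proof -
    have "q = (\<Sum>\<alpha>\<in>A. \<Sum>m\<in>\<M>. s m * real (m \<alpha>))"
      unfolding q_def using s(2) by (intro sum.cong) auto
    also have "\<dots> = (\<Sum>m\<in>\<M>. \<Sum>\<alpha>\<in>A. s m * real (m \<alpha>))"
      by (rule sum.swap)
    finally show ?thesis
      by (simp add: M_def sum_distrib_left)
  qed
  \<comment> \<open>If \<open>q = 0\<close> then also \<open>d = 0\<close>, so the identity holds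
    with the convention for division by zero.\<close>
  have dq: "0 \<le> d / q" "d / q \<le> 1" "d / q * q = d"
    using d \<nu>(3) by (auto simp: q_def divide_le_eq)
  \<comment> \<open>The share of the circuit in \<open>c \<alpha>\<close> is
    \<open>c \<alpha> / \<nu> \<alpha> * (s m * m \<alpha>)\<close>; dividing it by the normalising
    weight \<open>m \<alpha> / M m\<close> gives this expression.\<close>
  define u where "u m \<alpha> = c \<alpha> / \<nu> \<alpha> * (s m * real (M m))" for m \<alpha>
  define D where "D m = s m * real (M m) * (d / q)" for m
  have u_nonneg: "0 \<le> u m \<alpha>" if "m \<in> \<M>" "\<alpha> \<in> A" for m \<alpha>
    using that c s(1) \<nu>(1) by (simp add: u_def)
  have D_nonneg: "0 \<le> D m" if "m \<in> \<M>" for m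
    unfolding D_def using that s(1) dq(1) by (intro mult_nonneg_nonneg) auto
  have "D m ^ M m \<le> (\<Prod>\<alpha>\<in>A. u m \<alpha> ^ m \<alpha>)" if m: "m \<in> \<M>" for m
  proof (cases "s m = 0")
    case True
    then show ?thesis
      using u_nonneg[OF m] M_pos[OF m] by (simp add: D_def zero_power prod_nonneg)
  next
    case False
    \<comment> \<open>A sum of nonnegative terms vanishes only termwise, so a circuit that is
      actually used avoids the zeros of \<nu>.\<close>
    have supp: "m \<alpha> = 0" if "\<alpha> \<in> A" "\<nu> \<alpha> = 0" for \<alpha>
    proof -
      have "\<forall>m\<in>\<M>. s m * real (m \<alpha>) = 0"
        using s that \<M>(1) by (subst sum_nonneg_eq_0_iff[symmetric]) auto
      then show ?thesis
        using m False by auto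
    qed
    have pos: "0 < \<nu> \<alpha> / c \<alpha>" if "\<alpha> \<in> A" "m \<alpha> \<noteq> 0" for \<alpha>
    proof -
      have "\<nu> \<alpha> \<noteq> 0"
        using supp[of \<alpha>] that by auto
      moreover have "0 \<le> \<nu> \<alpha>" "c \<alpha> \<noteq> 0"
        using \<nu>(1) that(1) \<open>\<nu> \<alpha> \<noteq> 0\<close> by auto
      ultimately show ?thesis
        using c[OF that(1)] by simp
    qed
    have "(\<Prod>\<alpha>\<in>A. (\<nu> \<alpha> / c \<alpha>) ^ m \<alpha>) = (\<Prod>\<alpha>\<in>A. exp (real (m \<alpha>) * ln (\<nu> \<alpha> / c \<alpha>)))"
    proof (rule prod.cong)
      fix \<alpha> assume "\<alpha> \<in> A"
      then show "(\<nu> \<alpha> / c \<alpha>) ^ m \<alpha> = exp (real (m \<alpha>) * ln (\<nu> \<alpha> / c \<alpha>))"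
        using pos[of \<alpha>] by (cases "m \<alpha> = 0") (simp_all add: exp_of_nat_mult del: zero_less_divide_iff)
    qed simp
    also have "\<dots> = exp (\<Sum>\<alpha>\<in>A. real (m \<alpha>) * ln (\<nu> \<alpha> / c \<alpha>))"
      by (simp add: exp_sum A)
    also have "(\<Sum>\<alpha>\<in>A. real (m \<alpha>) * ln (\<nu> \<alpha> / c \<alpha>)) = 0"
      using supp \<M>(2)[OF m] by (intro ln0) (auto simp: circuit_weight_def)
    finally have one: "(\<Prod>\<alpha>\<in>A. (\<nu> \<alpha> / c \<alpha>) ^ m \<alpha>) = 1"
      by simp
    have "(\<Prod>\<alpha>\<in>A. (c \<alpha> / \<nu> \<alpha>) ^ m \<alpha>) = inverse (\<Prod>\<alpha>\<in>A. (\<nu> \<alpha> / c \<alpha>) ^ m \<alpha>)"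
      unfolding prod_inversef[symmetric] by (simp add: o_def power_inverse[symmetric])
    then have "(\<Prod>\<alpha>\<in>A. (c \<alpha> / \<nu> \<alpha>) ^ m \<alpha>) = 1"
      by (simp add: one)
    moreover have "(\<Prod>\<alpha>\<in>A. u m \<alpha> ^ m \<alpha>)
        = (\<Prod>\<alpha>\<in>A. (c \<alpha> / \<nu> \<alpha>) ^ m \<alpha>) * (\<Prod>\<alpha>\<in>A. (s m * real (M m)) ^ m \<alpha>)"
      unfolding u_def power_mult_distrib[of "c _ / \<nu> _"] by (rule prod.distrib)
    moreover have "(\<Prod>\<alpha>\<in>A. (s m * real (M m)) ^ m \<alpha>) = (s m * real (M m)) ^ M m"
      unfolding M_def[of m] by (rule power_sum[symmetric])
    ultimately have "(\<Prod>\<alpha>\<in>A. u m \<alpha> ^ m \<alpha>) = (s m * real (M m)) ^ M m"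
      by simp
    moreover have "D m ^ M m \<le> (s m * real (M m)) ^ M m"
    proof (rule power_mono)
      have "0 \<le> s m * real (M m)"
        using s(1) m by simp
      then show "D m \<le> s m * real (M m)"
        using mult_left_mono[OF dq(2), of "s m * real (M m)"] by (simp add: D_def)
    qed (rule D_nonneg[OF m])
    ultimately show ?thesis
      by simp
  qed
  moreover have "(\<Sum>m\<in>\<M>. u m \<alpha> * (real (m \<alpha>) / real (M m))) \<le> c \<alpha>" if "\<alpha> \<in> A" for \<alpha>
  proof -
    have "(\<Sum>m\<in>\<M>. u m \<alpha> * (real (m \<alpha>) / real (M m))) = (\<Sum>m\<in>\<M>. c \<alpha> / \<nu> \<alpha> * (s m * real (m \<alpha>)))"
    proof (rule sum.cong)
      fix m assume "m \<in> \<M>"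
      then show "u m \<alpha> * (real (m \<alpha>) / real (M m)) = c \<alpha> / \<nu> \<alpha> * (s m * real (m \<alpha>))"
        using M_pos[of m] by (simp add: u_def)
    qed simp
    also have "\<dots> = c \<alpha> / \<nu> \<alpha> * \<nu> \<alpha>"
      using s(2) that by (simp add: sum_distrib_left)
    \<comment> \<open>Equality fails only where \<nu> \<alpha> = 0 and c \<alpha> > 0: the left side
      is then 0.\<close>
    also have "\<dots> \<le> c \<alpha>"
      using c[OF that] by simp
    finally show ?thesis .
  qed
  moreover have "(\<Sum>m\<in>\<M>. D m) = d"
  proof -
    have "(\<Sum>m\<in>\<M>. D m) = q * (d / q)"
      by (simp only: D_def sum_distrib_right[symmetric] q[symmetric])
    then show ?thesis
      using dq(3) by (simp only: mult.commute)
  qed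
  ultimately show ?thesis
    using u_nonneg D_nonneg unfolding M_def by (intro exI[of _ u] exI[of _ D]) simp
qed

section \<open>From the product inequality back to circuit polynomials\<close>

text \<open>After division by the mean \<open>s\<close> the claim is that the product of the (y /
  s)^m is at most 1. This follows from t \<le> exp (t - 1), because the resulting exponents sum to
  0.\<close>

lemma weighted_amgm_power:
  fixes y :: "'a \<Rightarrow> real" and m :: "'a \<Rightarrow> nat"
  assumes A: "finite A" "\<And>\<alpha>. \<alpha> \<in> A \<Longrightarrow> 0 \<le> y \<alpha>" and M: "0 < (\<Sum>\<alpha>\<in>A. m \<alpha>)"
  shows "(\<Prod>\<alpha>\<in>A. y \<alpha> ^ m \<alpha>) \<le> ((\<Sum>\<alpha>\<in>A. real (m \<alpha>) * y \<alpha>) / real (\<Sum>\<alpha>\<in>A. m \<alpha>)) ^ (\<Sum>\<alpha>\<in>A. m \<alpha>)"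
proof -
  define M where "M = (\<Sum>\<alpha>\<in>A. m \<alpha>)"
  define s where "s = (\<Sum>\<alpha>\<in>A. real (m \<alpha>) * y \<alpha>) / real M"
  have M_pos: "0 < M"
    using M by (simp add: M_def)
  have nonneg: "0 \<le> (\<Sum>\<alpha>\<in>A. real (m \<alpha>) * y \<alpha>)"
    using A by (intro sum_nonneg) simp
  show ?thesis
  proof (cases "s = 0")
    case True
    then have "(\<Sum>\<alpha>\<in>A. real (m \<alpha>) * y \<alpha>) = 0"
      using M_pos by (simp add: s_def)
    then have zero: "\<forall>\<alpha>\<in>A. real (m \<alpha>) * y \<alpha> = 0"
      using A by (subst sum_nonneg_eq_0_iff[symmetric]) auto
    have "\<exists>\<alpha>\<in>A. 0 < m \<alpha>"
      using M_pos by (rule contrapos_pp) (simp add: M_def)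
    then obtain \<alpha> where \<alpha>: "\<alpha> \<in> A" "0 < m \<alpha>"
      by blast
    then have "y \<alpha> ^ m \<alpha> = 0"
      using zero by auto
    then have "(\<Prod>\<alpha>\<in>A. y \<alpha> ^ m \<alpha>) = 0"
      using A(1) \<alpha>(1) by (intro prod_zero) auto
    moreover have "0 \<le> (\<Sum>\<alpha>\<in>A. real (m \<alpha>) * y \<alpha>) / real (\<Sum>\<alpha>\<in>A. m \<alpha>)"
      using nonneg by (rule divide_nonneg_nonneg) (rule of_nat_0_le_iff)
    ultimately show ?thesis
      by (simp only: zero_le_power)
  next
    case False
    moreover have "0 \<le> s"
      unfolding s_def using nonneg by (rule divide_nonneg_nonneg) (rule of_nat_0_le_iff)
    ultimately have s: "0 < s"
      by linarith
    have "(\<Prod>\<alpha>\<in>A. y \<alpha> ^ m \<alpha>) = (\<Prod>\<alpha>\<in>A. (y \<alpha> / s) ^ m \<alpha> * s ^ m \<alpha>)"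
      using s by (simp add: power_divide)
    also have "\<dots> = (\<Prod>\<alpha>\<in>A. (y \<alpha> / s) ^ m \<alpha>) * s ^ M"
      by (simp add: prod.distrib M_def power_sum)
    also have "\<dots> \<le> (\<Prod>\<alpha>\<in>A. exp (y \<alpha> / s - 1) ^ m \<alpha>) * s ^ M"
    proof (intro mult_right_mono prod_mono conjI power_mono)
      fix \<alpha> assume "\<alpha> \<in> A"
      then show "0 \<le> y \<alpha> / s" "0 \<le> (y \<alpha> / s) ^ m \<alpha>"
        using A(2) s by simp_all
      show "y \<alpha> / s \<le> exp (y \<alpha> / s - 1)"
        using exp_ge_add_one_self[of "y \<alpha> / s - 1"] by simp
    qed (use s in simp)
    also have "(\<Prod>\<alpha>\<in>A. exp (y \<alpha> / s - 1) ^ m \<alpha>) = exp (\<Sum>\<alpha>\<in>A. real (m \<alpha>) * (y \<alpha> / s - 1))"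
      by (simp add: exp_sum[OF A(1)] exp_of_nat_mult)
    also have "(\<Sum>\<alpha>\<in>A. real (m \<alpha>) * (y \<alpha> / s - 1)) = (\<Sum>\<alpha>\<in>A. real (m \<alpha>) * y \<alpha>) / s - real M"
      by (simp add: right_diff_distrib sum_subtractf sum_divide_distrib M_def)
    also have "(\<Sum>\<alpha>\<in>A. real (m \<alpha>) * y \<alpha>) / s = real M"
      using False M_pos by (simp add: s_def)
    finally show ?thesis
      by (simp add: s_def M_def)
  qed
qed

lemma circuit_weight_sum_eq:
  assumes "circuit_weight A \<beta> m"
  shows "(\<Sum>\<alpha>\<in>A. m \<alpha> * \<alpha> $ i) = (\<Sum>\<alpha>\<in>A. m \<alpha>) * \<beta> $ i"
proof -
  have "(\<Sum>\<alpha>\<in>A. real (m \<alpha>) *\<^sub>R (real_exp \<alpha> - real_exp \<beta>)) $ i = 0"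
    using assms by (simp add: circuit_weight_def)
  then have "(\<Sum>\<alpha>\<in>A. real (m \<alpha>) * real (\<alpha> $ i)) = (\<Sum>\<alpha>\<in>A. real (m \<alpha>)) * real (\<beta> $ i)"
    by (simp add: real_exp_def right_diff_distrib sum_subtractf sum_distrib_right)
  then have "real (\<Sum>\<alpha>\<in>A. m \<alpha> * \<alpha> $ i) = real ((\<Sum>\<alpha>\<in>A. m \<alpha>) * \<beta> $ i)"
    by simp
  then show ?thesis
    by (simp only: of_nat_eq_iff)
qed

text \<open>The multiplicative form of the balance condition. The exponents of each variable agree
  as natural numbers, so zero and negative coordinates of \<open>x\<close> are covered.\<close>

lemma monomial_circuit_power:
  assumes "circuit_weight A \<beta> m"
  shows "(\<Prod>\<alpha>\<in>A. monomial x \<alpha> ^ m \<alpha>) = monomial x \<beta> ^ (\<Sum>\<alpha>\<in>A. m \<alpha>)"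
proof -
  have "(\<Prod>\<alpha>\<in>A. monomial x \<alpha> ^ m \<alpha>) = (\<Prod>\<alpha>\<in>A. \<Prod>i\<in>UNIV. x $ i ^ (m \<alpha> * \<alpha> $ i))"
    by (simp add: monomial_def prod_power_distrib power_mult[symmetric] mult.commute)
  also have "\<dots> = (\<Prod>i\<in>UNIV. \<Prod>\<alpha>\<in>A. x $ i ^ (m \<alpha> * \<alpha> $ i))"
    by (rule prod.swap)
  also have "\<dots> = (\<Prod>i\<in>UNIV. x $ i ^ ((\<Sum>\<alpha>\<in>A. m \<alpha>) * \<beta> $ i))"
    by (simp only: power_sum[symmetric] circuit_weight_sum_eq[OF assms])
  also have "\<dots> = monomial x \<beta> ^ (\<Sum>\<alpha>\<in>A. m \<alpha>)"
    by (simp add: monomial_def prod_power_distrib power_mult[symmetric] mult.commute)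
  finally show ?thesis .
qed

text \<open>Geometric mean cones range over the support of \<open>m\<close>, the estimates over all
  of \<open>A\<close>; these identities pass between the two.\<close>

lemma circuit_weight_total:
  assumes "finite A" "circuit_weight A \<beta> m"
  shows "(\<Sum>\<alpha> | 0 < m \<alpha>. m \<alpha>) = (\<Sum>\<alpha>\<in>A. m \<alpha>)" "0 < (\<Sum>\<alpha>\<in>A. m \<alpha>)"
    and "(\<Prod>\<alpha> | 0 < m \<alpha>. (v \<alpha> :: real) ^ m \<alpha>) = (\<Prod>\<alpha>\<in>A. v \<alpha> ^ m \<alpha>)"
proof -
  have T: "{\<alpha>. 0 < m \<alpha>} \<subseteq> A" "{\<alpha>. 0 < m \<alpha>} \<noteq> {}"
    using assms(2) by (simp_all add: circuit_weight_def)
  show "(\<Sum>\<alpha> | 0 < m \<alpha>. m \<alpha>) = (\<Sum>\<alpha>\<in>A. m \<alpha>)"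
    by (rule sum.mono_neutral_left) (use assms(1) T in auto)
  show "(\<Prod>\<alpha> | 0 < m \<alpha>. v \<alpha> ^ m \<alpha>) = (\<Prod>\<alpha>\<in>A. v \<alpha> ^ m \<alpha>)"
    by (rule prod.mono_neutral_left) (use assms(1) T in auto)
  obtain \<alpha> where "\<alpha> \<in> A" "0 < m \<alpha>"
    using T by blast
  then show "0 < (\<Sum>\<alpha>\<in>A. m \<alpha>)"
    using assms(1) by (intro sum_pos2[of _ \<alpha>]) auto
qed

text \<open>Divided by its total, \<open>m\<close> exhibits \<beta> as a convex combination of the
  vertices in which every coefficient is strictly positive.\<close>

lemma circuit_weight_rel_interior:
  assumes A: "finite A" and m: "circuit_weight A \<beta> m"
  shows "real_exp \<beta> \<in> rel_interior (newton {\<alpha>. 0 < m \<alpha>})"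
proof -
  let ?T = "{\<alpha>. 0 < m \<alpha>}"
  define M where "M = (\<Sum>\<alpha>\<in>A. m \<alpha>)"
  have T: "finite ?T" "?T \<subseteq> A"
    using A m by (auto simp: circuit_weight_def intro: finite_subset)
  have M: "0 < M" "(\<Sum>\<alpha>\<in>?T. m \<alpha>) = M"
    using circuit_weight_total[OF A m] by (simp_all add: M_def)
  have inj: "inj_on real_exp ?T"
    using inj_real_exp by (rule inj_on_subset) simp
  define w where "w v = real (m (inv real_exp v)) / real M" for v :: "real ^ 'a"
  have w: "w (real_exp \<alpha>) = real (m \<alpha>) / real M" for \<alpha>
    by (simp add: w_def inv_f_f[OF inj_real_exp])
  have "(\<Sum>\<alpha>\<in>?T. real (m \<alpha>) *\<^sub>R (real_exp \<alpha> - real_exp \<beta>)) = 0"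
    using m T A unfolding circuit_weight_def
    by (subst sum.mono_neutral_left[of A]) auto
  then have "(\<Sum>\<alpha>\<in>?T. real (m \<alpha>) *\<^sub>R real_exp \<alpha>) = real M *\<^sub>R real_exp \<beta>"
    by (simp add: scaleR_diff_right sum_subtractf scaleR_sum_left[symmetric] M(2)[symmetric])
  moreover have "(\<Sum>\<alpha>\<in>?T. w (real_exp \<alpha>) *\<^sub>R real_exp \<alpha>)
      = inverse (real M) *\<^sub>R (\<Sum>\<alpha>\<in>?T. real (m \<alpha>) *\<^sub>R real_exp \<alpha>)"
    unfolding scaleR_sum_right scaleR_scaleR w by (simp add: divide_inverse mult.commute)
  ultimately have "(\<Sum>\<alpha>\<in>?T. w (real_exp \<alpha>) *\<^sub>R real_exp \<alpha>) = real_exp \<beta>"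
    using M(1) by simp
  then have "(\<Sum>v\<in>real_exp ` ?T. w v *\<^sub>R v) = real_exp \<beta>"
    by (simp add: sum.reindex[OF inj])
  moreover have "(\<Sum>\<alpha>\<in>?T. w (real_exp \<alpha>)) = 1"
    unfolding w sum_divide_distrib[symmetric] of_nat_sum[symmetric] M(2) using M(1) by simp
  then have "sum w (real_exp ` ?T) = 1"
    by (simp add: sum.reindex[OF inj])
  moreover have "\<forall>v\<in>real_exp ` ?T. 0 < w v"
    using M(1) by (auto simp: w)
  ultimately have "real_exp \<beta> \<in> {y. \<exists>u. (\<forall>x\<in>real_exp ` ?T. 0 < u x) \<and> sum u (real_exp ` ?T) = 1
      \<and> (\<Sum>x\<in>real_exp ` ?T. u x *\<^sub>R x) = y}"
    by (intro CollectI exI[of _ w] conjI)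
  then show ?thesis
    unfolding newton_def by (rule subsetD[OF explicit_subset_rel_interior_convex_hull_minimal[OF finite_imageI[OF T(1)]]])
qed

text \<open>AM-GM applied to the values u \<alpha> x^\<alpha> bounds d |x^\<beta>| by the vertex
  part of the polynomial. As the absolute value is bounded, either sign \<sigma> of the inner term
  is allowed.\<close>

lemma circuit_term_SONC:
  fixes A :: "'n::finite exponent set"
  assumes A: "finite A" "A \<subseteq> even_exps" and m: "circuit_weight A \<beta> m"
    and u: "\<And>\<alpha>. 0 < m \<alpha> \<Longrightarrow> 0 \<le> u \<alpha>" and d: "0 \<le> d" "d ^ (\<Sum>\<alpha>\<in>A. m \<alpha>) \<le> (\<Prod>\<alpha>\<in>A. u \<alpha> ^ m \<alpha>)"
    and \<sigma>: "\<bar>\<sigma>\<bar> = 1"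
  shows "(\<Sum>\<alpha> | 0 < m \<alpha>. Poly_Mapping.single \<alpha> (u \<alpha> * (real (m \<alpha>) / real (\<Sum>\<alpha>\<in>A. m \<alpha>))))
    - Poly_Mapping.single \<beta> (\<sigma> * d) \<in> SONC"
proof -
  let ?T = "{\<alpha>. 0 < m \<alpha>}"
  define M where "M = (\<Sum>\<alpha>\<in>A. m \<alpha>)"
  have T: "finite ?T" "?T \<subseteq> A" "?T \<noteq> {}" "\<not> affine_dependent (real_exp ` ?T)"
    using A m by (auto simp: circuit_weight_def intro: finite_subset)
  have M: "0 < M"
    using circuit_weight_total[OF A(1) m] by (simp add: M_def)
  define c where "c \<alpha> = u \<alpha> * (real (m \<alpha>) / real M)" for \<alpha>
  define p where "p = (\<Sum>\<alpha>\<in>?T. Poly_Mapping.single \<alpha> (c \<alpha>)) - Poly_Mapping.single \<beta> (\<sigma> * d)"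
  have c_nonneg: "0 \<le> c \<alpha>" if "0 < m \<alpha>" for \<alpha>
    using u[OF that] by (simp add: c_def)
  have "p \<in> SONC"
  proof (cases "\<forall>\<alpha>\<in>?T. 0 < u \<alpha>")
    case True
    then have "\<forall>\<alpha>\<in>?T. 0 < c \<alpha>"
      using M by (simp add: c_def)
    then have "circuit_poly p"
      unfolding circuit_poly_def simplex_vertices_def
      using T A(2) circuit_weight_rel_interior[OF A(1) m]
      by (intro exI[of _ ?T] exI[of _ c] exI[of _ "\<sigma> * d"] exI[of _ \<beta>]) (auto simp: p_def)
    moreover have "nonneg_poly p"
      unfolding nonneg_poly_def
    proof
      fix x
      have mono: "0 \<le> monomial x \<alpha>" if "\<alpha> \<in> A" for \<alpha>
        using monomial_even_nonneg A(2) that by blast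
      \<comment> \<open>Outside the support of \<open>m\<close> nothing is known about the sign of
        \<open>u\<close>, so \<open>y\<close> is set to 0 there.\<close>
      define y where "y \<alpha> = (if 0 < m \<alpha> then u \<alpha> * monomial x \<alpha> else 0)" for \<alpha>
      have y: "0 \<le> y \<alpha>" if "\<alpha> \<in> A" for \<alpha>
        using that mono u by (simp add: y_def)
      define S where "S = (\<Sum>\<alpha>\<in>A. real (m \<alpha>) * y \<alpha>) / real M"
      have S: "S = (\<Sum>\<alpha>\<in>?T. c \<alpha> * monomial x \<alpha>)"
      proof -
        have "(\<Sum>\<alpha>\<in>A. real (m \<alpha>) * y \<alpha>) = (\<Sum>\<alpha>\<in>?T. real (m \<alpha>) * y \<alpha>)"
          by (rule sum.mono_neutral_right) (use A(1) T(2) in auto)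
        then show ?thesis
          unfolding S_def by (simp add: sum_divide_distrib c_def y_def mult.assoc mult.left_commute)
      qed
      have "(d * \<bar>monomial x \<beta>\<bar>) ^ M = d ^ M * \<bar>\<Prod>\<alpha>\<in>A. monomial x \<alpha> ^ m \<alpha>\<bar>"
        using monomial_circuit_power[OF m, of x]
        by (simp add: M_def power_mult_distrib power_abs)
      also have "\<bar>\<Prod>\<alpha>\<in>A. monomial x \<alpha> ^ m \<alpha>\<bar> = (\<Prod>\<alpha>\<in>A. monomial x \<alpha> ^ m \<alpha>)"
        using mono by (intro abs_of_nonneg prod_nonneg) auto
      also have "d ^ M * (\<Prod>\<alpha>\<in>A. monomial x \<alpha> ^ m \<alpha>)
          \<le> (\<Prod>\<alpha>\<in>A. u \<alpha> ^ m \<alpha>) * (\<Prod>\<alpha>\<in>A. monomial x \<alpha> ^ m \<alpha>)"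
        unfolding M_def using d(2) mono by (intro mult_right_mono prod_nonneg) auto
      also have "\<dots> = (\<Prod>\<alpha>\<in>A. y \<alpha> ^ m \<alpha>)"
        unfolding prod.distrib[symmetric] y_def by (intro prod.cong) (auto simp: power_mult_distrib)
      also have "\<dots> \<le> S ^ M"
        unfolding S_def M_def by (rule weighted_amgm_power) (use A y M in \<open>auto simp: M_def\<close>)
      finally have le: "(d * \<bar>monomial x \<beta>\<bar>) ^ M \<le> S ^ M" .
      have "0 \<le> S"
        unfolding S_def using y by (intro divide_nonneg_nonneg sum_nonneg) auto
      then have "d * \<bar>monomial x \<beta>\<bar> \<le> S"
        using le d(1) M by (simp add: power_mono_iff)
      moreover have "\<bar>\<sigma> * d * monomial x \<beta>\<bar> = d * \<bar>monomial x \<beta>\<bar>"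
        using \<sigma> d(1) by (simp add: abs_mult)
      ultimately have "\<sigma> * d * monomial x \<beta> \<le> S"
        by linarith
      then show "0 \<le> eval_poly p x"
        by (simp add: p_def eval_poly_minus eval_poly_sum eval_poly_single S)
    qed
    ultimately show ?thesis
      by (intro nonneg_circuit_SONC) (simp add: nonneg_circuit_def)
  next
    \<comment> \<open>A vertex coefficient vanishes, so \<open>circuit_poly\<close> cannot be
      established with these vertices. But then the product is 0, which forces d = 0, and only
      monomial squares remain.\<close>
    case False
    then obtain \<alpha> where "0 < m \<alpha>" "\<not> 0 < u \<alpha>"
      by auto
    then have "0 < m \<alpha>" "u \<alpha> = 0"
      using u[of \<alpha>] by auto
    then have "(\<Prod>\<alpha>\<in>A. u \<alpha> ^ m \<alpha>) = 0"
      using A(1) T(2) by (intro prod_zero bexI[of _ \<alpha>]) auto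
    then have "d ^ M \<le> 0"
      using d(2) by (simp add: M_def)
    then have "\<not> 0 < d"
      using zero_less_power by (metis not_le)
    then have "d = 0"
      using d(1) by simp
    then show ?thesis
      unfolding p_def using T(2) A(2) c_nonneg by (auto intro!: SONC_sum single_SONC)
  qed
  then show ?thesis
    by (simp add: p_def c_def M_def)
qed

text \<open>The polynomial is evaluated at the coordinatewise exponential of \<open>x\<close>. If
  the coefficient at \<beta> is positive, then \<beta> has an odd coordinate, and flipping the sign
  of that variable makes the \<beta> term negative while the even exponents in \<open>A\<close> are
  unaffected. Division by the absolute value of the \<beta> monomial gives the bound.\<close>

lemma nonneg_poly_dominated:
  fixes p :: "'n::finite rpoly"
  assumes p: "nonneg_poly p" and A: "finite A" "A \<subseteq> even_exps" "\<beta> \<notin> A"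
    and keys: "Poly_Mapping.keys p \<subseteq> insert \<beta> A" and e: "Poly_Mapping.lookup p \<beta> \<le> 0 \<or> \<beta> \<notin> even_exps"
  shows "\<bar>Poly_Mapping.lookup p \<beta>\<bar>
    \<le> (\<Sum>\<alpha>\<in>A. Poly_Mapping.lookup p \<alpha> * exp ((real_exp \<alpha> - real_exp \<beta>) \<bullet> x))"
proof -
  define e where "e = Poly_Mapping.lookup p \<beta>"
  define y :: "real ^ 'n" where "y = (\<chi> i. exp (x $ i))"
  have y: "monomial y \<alpha> = exp (real_exp \<alpha> \<bullet> x)" for \<alpha>
    by (simp add: monomial_def y_def inner_vec_def real_exp_def exp_sum exp_of_nat_mult)
  have eval: "eval_poly p z = (\<Sum>\<alpha>\<in>A. Poly_Mapping.lookup p \<alpha> * monomial z \<alpha>) + e * monomial z \<beta>" for z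
    using A eval_poly_superset[OF _ keys, of z] by (simp add: e_def)
  have "\<exists>z. (\<forall>\<alpha>\<in>A. monomial z \<alpha> = monomial y \<alpha>) \<and> e * monomial z \<beta> = - \<bar>e\<bar> * monomial y \<beta>"
  proof (cases "e \<le> 0")
    case True
    then show ?thesis
      by (intro exI[of _ y]) simp
  next
    case False
    then obtain i where i: "odd (\<beta> $ i)"
      using e by (auto simp: e_def even_exps_def)
    define z :: "real ^ 'n" where "z = (\<chi> j. (if j = i then - 1 else 1) * y $ j)"
    have "monomial z \<alpha> = (\<Prod>j\<in>UNIV. (if j = i then (- 1) ^ (\<alpha> $ i) else 1) * y $ j ^ (\<alpha> $ j))" for \<alpha>
      unfolding monomial_def z_def by (intro prod.cong) (auto simp: power_minus[of "y $ _"])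
    then have z: "monomial z \<alpha> = (- 1) ^ (\<alpha> $ i) * monomial y \<alpha>" for \<alpha>
      by (simp add: prod.distrib monomial_def)
    show ?thesis
      using i False A(2) by (intro exI[of _ z]) (auto simp: z even_exps_def)
  qed
  then obtain z where z: "\<forall>\<alpha>\<in>A. monomial z \<alpha> = monomial y \<alpha>" "e * monomial z \<beta> = - \<bar>e\<bar> * monomial y \<beta>"
    by blast
  have "0 \<le> eval_poly p z"
    using p by (simp add: nonneg_poly_def)
  then have "\<bar>e\<bar> * exp (real_exp \<beta> \<bullet> x) \<le> (\<Sum>\<alpha>\<in>A. Poly_Mapping.lookup p \<alpha> * exp (real_exp \<alpha> \<bullet> x))"
    using z by (simp add: eval y)
  then have "\<bar>e\<bar> \<le> (\<Sum>\<alpha>\<in>A. Poly_Mapping.lookup p \<alpha> * exp (real_exp \<alpha> \<bullet> x)) / exp (real_exp \<beta> \<bullet> x)"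
    by (simp add: pos_le_divide_eq)
  then show ?thesis
    by (simp add: e_def sum_divide_distrib inner_diff_left exp_diff)
qed

section \<open>The cone of SONC coefficients\<close>

lemma set_plus_subset_closed:
  assumes "\<And>x y. x \<in> C \<Longrightarrow> y \<in> C \<Longrightarrow> x + y \<in> C" "X \<subseteq> C" "Y \<subseteq> C"
  shows "X + Y \<subseteq> C"
  using assms by (auto elim!: set_plus_elim)

lemma set_sum_subset_closed:
  fixes C :: "'a::comm_monoid_add set"
  assumes "\<And>x y. x \<in> C \<Longrightarrow> y \<in> C \<Longrightarrow> x + y \<in> C" "0 \<in> C" "\<And>i. i \<in> I \<Longrightarrow> X i \<subseteq> C"
  shows "(\<Sum>i\<in>I. X i) \<subseteq> C"
  using assms(3)
proof (induction I rule: infinite_finite_induct)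
  case (insert i I)
  then show ?case
    using set_plus_subset_closed[OF assms(1)] by simp
qed (use assms(2) in simp_all)

lemma sum_mem_set_sum: "finite I \<Longrightarrow> (\<And>i. i \<in> I \<Longrightarrow> f i \<in> X i) \<Longrightarrow> (\<Sum>i\<in>I. f i) \<in> (\<Sum>i\<in>I. X i)"
  by (auto simp: set_sum_alt)

text \<open>Coefficient vectors of sums of nonnegative circuit polynomials with a common inner
  exponent. \<open>F\<close> is the direction of the inner coefficient, including its sign, and the
  factor in front of \<open>E \<alpha>\<close> converts the coordinates \<open>u\<close> of the
  geometric mean cone into polynomial coefficients.\<close>

definition age_generators :: "'a set \<Rightarrow> ('a \<Rightarrow> nat) set \<Rightarrow> ('a \<Rightarrow> 'v) \<Rightarrow> 'v \<Rightarrow> 'v::real_vector set" where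
  "age_generators A \<M> E F = (\<Sum>m\<in>\<M>. geometric_mean_cone {\<alpha>. 0 < m \<alpha>} m
     (\<lambda>\<alpha>. (real (m \<alpha>) / real (\<Sum>\<alpha>\<in>A. m \<alpha>)) *\<^sub>R E \<alpha>) F)"

lemma soc3_representable_age_generators:
  assumes A: "finite A" and \<M>: "\<And>m. m \<in> \<M> \<Longrightarrow> circuit_weight A \<beta> m"
    and V: "subspace V" "\<And>\<alpha>. \<alpha> \<in> A \<Longrightarrow> E \<alpha> \<in> V" "F \<in> V"
  shows "soc3_representable V (age_generators A \<M> E F)"
  unfolding age_generators_def
proof (rule soc3_representable_sum[OF V(1)])
  fix m assume "m \<in> \<M>"
  then have T: "{\<alpha>. 0 < m \<alpha>} \<subseteq> A" "{\<alpha>. 0 < m \<alpha>} \<noteq> {}"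
    using \<M> by (simp_all add: circuit_weight_def)
  show "soc3_representable V (geometric_mean_cone {\<alpha>. 0 < m \<alpha>} m
      (\<lambda>\<alpha>. (real (m \<alpha>) / real (\<Sum>\<alpha>\<in>A. m \<alpha>)) *\<^sub>R E \<alpha>) F)"
  proof (rule soc3_representable_geometric_mean_cone)
    show "finite {\<alpha>. 0 < m \<alpha>}"
      using T(1) A by (rule finite_subset)
    show "(real (m \<alpha>) / real (\<Sum>\<alpha>\<in>A. m \<alpha>)) *\<^sub>R E \<alpha> \<in> V" if "\<alpha> \<in> {\<alpha>. 0 < m \<alpha>}" for \<alpha>
      using that T(1) V by (blast intro: subspace_scale)
  qed (use T V in auto)
qed

text \<open>For an odd \<beta> the generators of both signs are added although a given point needs
  only one of them; the other contributes 0.\<close>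

lemma zero_mem_age_generators:
  assumes A: "finite A" and \<M>: "finite \<M>" "\<And>m. m \<in> \<M> \<Longrightarrow> circuit_weight A \<beta> m"
  shows "0 \<in> age_generators A \<M> E F"
proof -
  have "0 \<in> geometric_mean_cone {\<alpha>. 0 < m \<alpha>} m (\<lambda>\<alpha>. (real (m \<alpha>) / real (\<Sum>\<alpha>\<in>A. m \<alpha>)) *\<^sub>R E \<alpha>) F"
    if "m \<in> \<M>" for m
  proof -
    have "0 < (\<Sum>\<alpha> | 0 < m \<alpha>. m \<alpha>)"
      using circuit_weight_total(1,2)[OF A \<M>(2)[OF that]] by simp
    then have "(0::real) ^ (\<Sum>\<alpha> | 0 < m \<alpha>. m \<alpha>) \<le> (\<Prod>\<alpha> | 0 < m \<alpha>. 0 ^ m \<alpha>)"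
      by (simp only: zero_power) (intro prod_nonneg, simp)
    then show ?thesis
      unfolding geometric_mean_cone_def
      by (intro CollectI exI[of _ "\<lambda>_. 0"] exI[of _ "0::real"]) simp
  qed
  then have "(\<Sum>m\<in>\<M>. 0) \<in> age_generators A \<M> E F"
    unfolding age_generators_def by (intro sum_mem_set_sum \<M>(1))
  then show ?thesis
    by simp
qed

text \<open>The vector \<open>c'\<close> does not depend on \<open>F\<close>, so the sign of the
  inner term can be chosen afterwards. It is only bounded by \<open>c\<close>; the difference is
  left to the rays.\<close>

lemma age_generators_cover:
  fixes A :: "'n::finite exponent set" and E :: "'n exponent \<Rightarrow> 'v::real_vector"
  assumes A: "finite A" and \<M>: "finite \<M>" "\<And>m. m \<in> \<M> \<Longrightarrow> circuit_weight A \<beta> m"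
    and ex: "\<And>\<nu>. (\<And>\<alpha>. \<alpha> \<in> A \<Longrightarrow> 0 \<le> \<nu> \<alpha>) \<Longrightarrow> \<exists>\<alpha>\<in>A. \<nu> \<alpha> \<noteq> 0 \<Longrightarrow>
      (\<Sum>\<alpha>\<in>A. \<nu> \<alpha> *\<^sub>R (real_exp \<alpha> - real_exp \<beta>)) = 0 \<Longrightarrow>
      \<exists>m\<in>\<M>. \<forall>\<alpha>. 0 < m \<alpha> \<longrightarrow> \<nu> \<alpha> \<noteq> 0"
    and c: "\<And>\<alpha>. \<alpha> \<in> A \<Longrightarrow> 0 \<le> c \<alpha>" and d: "0 \<le> d"
    and dom: "\<And>x. d \<le> (\<Sum>\<alpha>\<in>A. c \<alpha> * exp ((real_exp \<alpha> - real_exp \<beta>) \<bullet> x))"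
  shows "\<exists>c'. (\<forall>\<alpha>\<in>A. c' \<alpha> \<le> c \<alpha>) \<and> (\<forall>F. (\<Sum>\<alpha>\<in>A. c' \<alpha> *\<^sub>R E \<alpha>) + d *\<^sub>R F \<in> age_generators A \<M> E F)"
proof -
  have "\<exists>u D. (\<forall>m\<in>\<M>. (\<forall>\<alpha>\<in>A. 0 \<le> u m \<alpha>) \<and> 0 \<le> D m \<and> D m ^ (\<Sum>\<alpha>\<in>A. m \<alpha>) \<le> (\<Prod>\<alpha>\<in>A. u m \<alpha> ^ m \<alpha>))
    \<and> (\<forall>\<alpha>\<in>A. (\<Sum>m\<in>\<M>. u m \<alpha> * (real (m \<alpha>) / real (\<Sum>\<alpha>\<in>A. m \<alpha>))) \<le> c \<alpha>)
    \<and> (\<Sum>m\<in>\<M>. D m) = d"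
    by (rule age_circuit_decomposition[OF A \<M> ex c d dom])
  then obtain u D where u: "\<And>m \<alpha>. m \<in> \<M> \<Longrightarrow> \<alpha> \<in> A \<Longrightarrow> 0 \<le> u m \<alpha>"
    and D: "\<And>m. m \<in> \<M> \<Longrightarrow> 0 \<le> D m"
      "\<And>m. m \<in> \<M> \<Longrightarrow> D m ^ (\<Sum>\<alpha>\<in>A. m \<alpha>) \<le> (\<Prod>\<alpha>\<in>A. u m \<alpha> ^ m \<alpha>)"
    and le: "\<forall>\<alpha>\<in>A. (\<Sum>m\<in>\<M>. u m \<alpha> * (real (m \<alpha>) / real (\<Sum>\<alpha>\<in>A. m \<alpha>))) \<le> c \<alpha>"
    and D_sum: "(\<Sum>m\<in>\<M>. D m) = d"
    by (elim exE conjE) (rule that, auto)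
  define w where "w m \<alpha> = real (m \<alpha>) / real (\<Sum>\<alpha>\<in>A. m \<alpha>)" for m :: "'n exponent \<Rightarrow> nat" and \<alpha>
  define c' where "c' \<alpha> = (\<Sum>m\<in>\<M>. u m \<alpha> * w m \<alpha>)" for \<alpha>
  have "(\<Sum>\<alpha>\<in>A. c' \<alpha> *\<^sub>R E \<alpha>) + d *\<^sub>R F \<in> age_generators A \<M> E F" for F
  proof -
    have mem: "(\<Sum>\<alpha>\<in>A. u m \<alpha> *\<^sub>R (w m \<alpha> *\<^sub>R E \<alpha>)) + D m *\<^sub>R F
        \<in> geometric_mean_cone {\<alpha>. 0 < m \<alpha>} m (\<lambda>\<alpha>. w m \<alpha> *\<^sub>R E \<alpha>) F" if m: "m \<in> \<M>" for m
    proof -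
      have T: "{\<alpha>. 0 < m \<alpha>} \<subseteq> A"
        using \<M>(2)[OF m] by (simp add: circuit_weight_def)
      have "(\<Sum>\<alpha>\<in>A. u m \<alpha> *\<^sub>R (w m \<alpha> *\<^sub>R E \<alpha>)) = (\<Sum>\<alpha> | 0 < m \<alpha>. u m \<alpha> *\<^sub>R (w m \<alpha> *\<^sub>R E \<alpha>))"
        by (rule sum.mono_neutral_right) (use A T in \<open>auto simp: w_def\<close>)
      moreover have "D m ^ (\<Sum>\<alpha> | 0 < m \<alpha>. m \<alpha>) \<le> (\<Prod>\<alpha> | 0 < m \<alpha>. u m \<alpha> ^ m \<alpha>)"
        unfolding circuit_weight_total[OF A \<M>(2)[OF m]] by (rule D(2)[OF m])
      ultimately show ?thesis
        unfolding geometric_mean_cone_def using T u[OF m] D(1)[OF m]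
        by (intro CollectI exI[of _ "u m"] exI[of _ "D m"]) auto
    qed
    have "(\<Sum>m\<in>\<M>. \<Sum>\<alpha>\<in>A. u m \<alpha> *\<^sub>R (w m \<alpha> *\<^sub>R E \<alpha>)) = (\<Sum>\<alpha>\<in>A. c' \<alpha> *\<^sub>R E \<alpha>)"
      by (subst sum.swap) (simp add: c'_def scaleR_sum_left)
    then have "(\<Sum>\<alpha>\<in>A. c' \<alpha> *\<^sub>R E \<alpha>) + d *\<^sub>R F
        = (\<Sum>m\<in>\<M>. (\<Sum>\<alpha>\<in>A. u m \<alpha> *\<^sub>R (w m \<alpha> *\<^sub>R E \<alpha>)) + D m *\<^sub>R F)"
      by (simp add: sum.distrib scaleR_sum_left[symmetric] D_sum)
    also have "\<dots> \<in> age_generators A \<M> E F"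
      unfolding age_generators_def w_def[symmetric] by (rule sum_mem_set_sum[OF \<M>(1) mem])
    finally show ?thesis .
  qed
  moreover have "\<forall>\<alpha>\<in>A. c' \<alpha> \<le> c \<alpha>"
    using le by (simp add: c'_def w_def)
  ultimately show ?thesis
    by (intro exI[of _ c']) blast
qed

section \<open>The coefficient cone as a finite Minkowski sum\<close>

lemma sum_single_lookup:
  assumes "finite I" "p \<in> coord_space I"
  shows "(\<Sum>i\<in>I. Poly_Mapping.single i (Poly_Mapping.lookup p i)) = p"
  by (rule poly_mapping_eqI)
    (use assms in \<open>auto simp: lookup_sum lookup_single when_def mem_coord_space_iff\<close>)

lemma mem_SONC_cone_iff:
  assumes "finite A" "finite B1" "finite B2"
  shows "(c, d1, d2) \<in> SONC_cone A B1 B2 \<longleftrightarrow>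
    c \<in> coord_space A \<and> d1 \<in> coord_space B1 \<and> d2 \<in> coord_space B2
    \<and> (\<forall>\<alpha>\<in>A. 0 \<le> Poly_Mapping.lookup c \<alpha>) \<and> (\<forall>\<beta>\<in>B1. 0 \<le> Poly_Mapping.lookup d1 \<beta>)
    \<and> c - (d1 + d2) \<in> SONC"
  using sum_single_lookup[OF assms(1), of c] sum_single_lookup[OF assms(2), of d1]
    sum_single_lookup[OF assms(3), of d2]
  unfolding SONC_cone_def SONC_ambient_def by auto

lemma SONC_cone_add:
  assumes fin: "finite A" "finite B1" "finite B2"
    and x: "x \<in> SONC_cone A B1 B2" and y: "y \<in> SONC_cone A B1 B2"
  shows "x + y \<in> SONC_cone A B1 B2"
proof -
  obtain c d1 d2 where x_eq: "x = (c, d1, d2)"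
    by (cases x)
  obtain c' d1' d2' where y_eq: "y = (c', d1', d2')"
    by (cases y)
  have "c + c' - (d1 + d1' + (d2 + d2')) = (c - (d1 + d2)) + (c' - (d1' + d2'))"
    by simp
  moreover have "(c - (d1 + d2)) + (c' - (d1' + d2')) \<in> SONC"
    using x y unfolding x_eq y_eq mem_SONC_cone_iff[OF fin] by (intro SONC_add) auto
  ultimately have "c + c' - (d1 + d1' + (d2 + d2')) \<in> SONC"
    by (simp only:)
  then show ?thesis
    using x y unfolding x_eq y_eq add_Pair mem_SONC_cone_iff[OF fin]
    by (auto simp: lookup_add intro: subspace_add[OF subspace_coord_space])
qed

lemma SONC_cone_scaleR:
  assumes fin: "finite A" "finite B1" "finite B2"
    and x: "x \<in> SONC_cone A B1 B2" and t: "0 \<le> t"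
  shows "t *\<^sub>R x \<in> SONC_cone A B1 B2"
proof -
  obtain c d1 d2 where x_eq: "x = (c, d1, d2)"
    by (cases x)
  have "t *\<^sub>R (c - (d1 + d2)) \<in> SONC"
    using x t unfolding x_eq mem_SONC_cone_iff[OF fin] by (intro SONC_scaleR) auto
  then have "t *\<^sub>R c - (t *\<^sub>R d1 + t *\<^sub>R d2) \<in> SONC"
    by (simp add: scaleR_diff_right scaleR_add_right)
  then show ?thesis
    using x t unfolding x_eq scaleR_Pair mem_SONC_cone_iff[OF fin]
    by (auto intro: subspace_scale[OF subspace_coord_space])
qed

lemma SONC_cone_zero:
  assumes "finite A" "finite B1" "finite B2"
  shows "0 \<in> SONC_cone A B1 B2"
  unfolding zero_prod_def mem_SONC_cone_iff[OF assms]
  by (auto simp: SONC_0 subspace_0[OF subspace_coord_space])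

text \<open>This is where \<open>B1\<close> and \<open>B2\<close> get their finiteness from: the
  hull of a finite set is bounded, so the coordinates of its lattice points lie in a finite
  range.\<close>

lemma finite_lattice_points_newton:
  fixes A :: "'n::finite exponent set"
  assumes "finite A"
  shows "finite {\<beta>. real_exp \<beta> \<in> newton A}"
proof -
  have "bounded (newton A)"
    unfolding newton_def using assms by (intro bounded_convex_hull finite_imp_bounded) simp
  then obtain K where K: "\<And>v. v \<in> newton A \<Longrightarrow> norm v \<le> K"
    unfolding bounded_iff by blast
  have "{\<beta>. real_exp \<beta> \<in> newton A} \<subseteq> vec_lambda ` (PiE UNIV (\<lambda>_. {..nat \<lceil>K\<rceil>}))"
  proof
    fix \<beta> :: "'n exponent" assume "\<beta> \<in> {\<beta>. real_exp \<beta> \<in> newton A}"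
    then have "norm (real_exp \<beta>) \<le> K"
      using K by simp
    then have "real (\<beta> $ i) \<le> K" for i
      using component_le_norm_cart[of "real_exp \<beta>" i] by (simp add: real_exp_def)
    then have "\<beta> $ i \<le> nat \<lceil>K\<rceil>" for i
      by (metis le_nat_iff of_nat_ceiling of_nat_le_iff order_trans nat_ceiling_le_eq real_nat_ceiling_ge)
    then have "vec_nth \<beta> \<in> PiE UNIV (\<lambda>_. {..nat \<lceil>K\<rceil>})"
      by auto
    then show "\<beta> \<in> vec_lambda ` (PiE UNIV (\<lambda>_. {..nat \<lceil>K\<rceil>}))"
      by (metis image_eqI vec_lambda_eta vec_nth_inverse)
  qed
  then show ?thesis
    by (rule finite_subset) (simp add: finite_PiE)
qed

text \<open>One inclusion is soundness: every generator gives a SONC polynomial, and the cone is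
  closed under addition. The other is completeness: the support decomposition yields one summand for
  each \<beta>, each summand is covered by the circuits at \<beta>, and the rest of \<open>c\<close>
  lies on the rays.\<close>

lemma SONC_cone_generators:
  fixes A B1 B2 :: "'n::finite exponent set"
  defines "E \<equiv> \<lambda>\<alpha> :: 'n exponent. (Poly_Mapping.single \<alpha> (1::real), 0 :: 'n rpoly, 0 :: 'n rpoly)"
    and "F1 \<equiv> \<lambda>\<beta> :: 'n exponent. (0 :: 'n rpoly, Poly_Mapping.single \<beta> (1::real), 0 :: 'n rpoly)"
    and "F2 \<equiv> \<lambda>\<beta> :: 'n exponent. (0 :: 'n rpoly, 0 :: 'n rpoly, Poly_Mapping.single \<beta> (1::real))"
  assumes fin: "finite A" "finite B1" "finite B2"
    and ev: "A \<subseteq> even_exps" "B1 \<subseteq> even_exps" "B2 \<inter> even_exps = {}" and disj: "A \<inter> B1 = {}"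
    and \<M>: "\<And>\<beta>. finite (\<M> \<beta>)" "\<And>\<beta> m. m \<in> \<M> \<beta> \<Longrightarrow> circuit_weight A \<beta> m"
    and ex: "\<And>\<beta> \<nu>. (\<And>\<alpha>. \<alpha> \<in> A \<Longrightarrow> 0 \<le> \<nu> \<alpha>) \<Longrightarrow> \<exists>\<alpha>\<in>A. \<nu> \<alpha> \<noteq> 0 \<Longrightarrow>
      (\<Sum>\<alpha>\<in>A. \<nu> \<alpha> *\<^sub>R (real_exp \<alpha> - real_exp \<beta>)) = 0 \<Longrightarrow>
      \<exists>m\<in>\<M> \<beta>. \<forall>\<alpha>. 0 < m \<alpha> \<longrightarrow> \<nu> \<alpha> \<noteq> 0"
  shows "SONC_cone A B1 B2 = (\<Sum>\<alpha>\<in>A. {t *\<^sub>R E \<alpha> | t. 0 \<le> t})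
    + (\<Sum>\<beta>\<in>B1. age_generators A (\<M> \<beta>) E (F1 \<beta>))
    + (\<Sum>\<beta>\<in>B2. age_generators A (\<M> \<beta>) E (F2 \<beta>) + age_generators A (\<M> \<beta>) E (- F2 \<beta>))"
    (is "?C = ?R + ?D1 + ?D2")
proof
  note closed = SONC_cone_add[OF fin] and zero = SONC_cone_zero[OF fin]
  have ray: "{t *\<^sub>R E \<alpha> | t. 0 \<le> t} \<subseteq> ?C" if \<alpha>: "\<alpha> \<in> A" for \<alpha>
  proof (rule subsetI)
    fix x assume "x \<in> {t *\<^sub>R E \<alpha> | t. 0 \<le> t}"
    then obtain t where x: "x = t *\<^sub>R E \<alpha>" and "0 \<le> t"
      by auto
    then have "t *\<^sub>R Poly_Mapping.single \<alpha> (1::real) \<in> SONC"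
      using ev(1) \<alpha> by (auto simp: single_scaleR[symmetric] intro!: single_SONC)
    moreover have "Poly_Mapping.single \<alpha> (1::real) \<in> coord_space A"
      using \<alpha> by (simp add: mem_coord_space_iff lookup_single when_def)
    ultimately show "x \<in> ?C"
      using \<open>0 \<le> t\<close> unfolding x E_def scaleR_Pair scaleR_zero_right mem_SONC_cone_iff[OF fin]
      by (auto simp: lookup_single when_def subspace_0[OF subspace_coord_space]
          intro: subspace_scale[OF subspace_coord_space])
  qed
  \<comment> \<open>\<open>F\<close> bundles the last two components, and \<sigma> is the sign of
    the subtracted inner coefficient: +1 for \<open>B1\<close>, where the cone demands nonnegative
    \<open>d1\<close>, and either sign for \<open>B2\<close>.\<close>
  have circuit: "age_generators A (\<M> \<beta>) E (0, F) \<subseteq> ?C"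
    if F: "F = (Poly_Mapping.single \<beta> 1, 0) \<and> \<beta> \<in> B1 \<and> \<sigma> = 1
      \<or> F = (0, Poly_Mapping.single \<beta> \<sigma>) \<and> \<beta> \<in> B2 \<and> \<bar>\<sigma>\<bar> = 1" for \<beta> F and \<sigma> :: real
    unfolding age_generators_def
  proof (rule set_sum_subset_closed[OF closed zero], assumption, assumption, rule subsetI)
    fix m x
    assume m: "m \<in> \<M> \<beta>"
    assume "x \<in> geometric_mean_cone {\<alpha>. 0 < m \<alpha>} m
        (\<lambda>\<alpha>. (real (m \<alpha>) / real (\<Sum>\<alpha>\<in>A. m \<alpha>)) *\<^sub>R E \<alpha>) (0, F)"
    then obtain u d where x: "x = (\<Sum>\<alpha> | 0 < m \<alpha>. u \<alpha> *\<^sub>R ((real (m \<alpha>) / real (\<Sum>\<alpha>\<in>A. m \<alpha>)) *\<^sub>R E \<alpha>)) + d *\<^sub>R (0, F)"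
      and u: "\<And>\<alpha>. 0 < m \<alpha> \<Longrightarrow> 0 \<le> u \<alpha>" and d: "0 \<le> d"
      and "d ^ (\<Sum>\<alpha> | 0 < m \<alpha>. m \<alpha>) \<le> (\<Prod>\<alpha> | 0 < m \<alpha>. u \<alpha> ^ m \<alpha>)"
      unfolding geometric_mean_cone_def by auto
    then have du: "d ^ (\<Sum>\<alpha>\<in>A. m \<alpha>) \<le> (\<Prod>\<alpha>\<in>A. u \<alpha> ^ m \<alpha>)"
      unfolding circuit_weight_total[OF fin(1) \<M>(2)[OF m]] by simp
    have T: "{\<alpha>. 0 < m \<alpha>} \<subseteq> A" "finite {\<alpha>. 0 < m \<alpha>}"
      using \<M>(2)[OF m] fin(1) by (auto simp: circuit_weight_def intro: finite_subset)
    define c where "c = (\<Sum>\<alpha> | 0 < m \<alpha>. Poly_Mapping.single \<alpha> (u \<alpha> * (real (m \<alpha>) / real (\<Sum>\<alpha>\<in>A. m \<alpha>))))"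
    have x': "x = (c, d *\<^sub>R F)"
      unfolding x c_def
      by (rule prod_eqI)
        (simp_all add: E_def fst_sum snd_sum single_scaleR[symmetric] zero_prod_def[symmetric] del: of_nat_sum)
    have c_lookup: "Poly_Mapping.lookup c \<alpha> = (if 0 < m \<alpha> then u \<alpha> * (real (m \<alpha>) / real (\<Sum>\<alpha>\<in>A. m \<alpha>)) else 0)" for \<alpha>
      unfolding c_def using T(2) by (simp add: lookup_sum lookup_single when_def del: of_nat_sum)
    have c: "c \<in> coord_space A" "\<forall>\<alpha>\<in>A. 0 \<le> Poly_Mapping.lookup c \<alpha>"
      unfolding mem_coord_space_iff c_lookup using T(1)
      by (auto intro!: mult_nonneg_nonneg divide_nonneg_nonneg sum_nonneg u)
    have "\<bar>\<sigma>\<bar> = 1"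
      using F by auto
    have sonc: "c - Poly_Mapping.single \<beta> (\<sigma> * d) \<in> SONC"
      unfolding c_def by (rule circuit_term_SONC[OF fin(1) ev(1) \<M>(2)[OF m] _ d du \<open>\<bar>\<sigma>\<bar> = 1\<close>]) (rule u)
    have \<beta>: "d *\<^sub>R Poly_Mapping.single \<beta> \<tau> = Poly_Mapping.single \<beta> (\<tau> * d)" for \<tau> :: real
      by (simp add: single_scaleR[symmetric] mult.commute)
    from F show "x \<in> ?C"
    proof (elim disjE conjE)
      assume "F = (Poly_Mapping.single \<beta> 1, 0)" "\<beta> \<in> B1" "\<sigma> = 1"
      then show ?thesis
        unfolding x' using c sonc d
        by (auto simp: mem_SONC_cone_iff[OF fin] \<beta> mem_coord_space_iff lookup_single when_def)
    next
      assume "F = (0, Poly_Mapping.single \<beta> \<sigma>)" "\<beta> \<in> B2"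
      then show ?thesis
        unfolding x' using c sonc d
        by (auto simp: mem_SONC_cone_iff[OF fin] \<beta> mem_coord_space_iff lookup_single when_def)
    qed
  qed
  have "?R \<subseteq> ?C"
    by (rule set_sum_subset_closed[OF closed zero ray])
  moreover have "?D1 \<subseteq> ?C"
    unfolding F1_def by (rule set_sum_subset_closed[OF closed zero]) (auto intro!: circuit[THEN subsetD])
  moreover have "?D2 \<subseteq> ?C"
  proof (rule set_sum_subset_closed[OF closed zero])
    fix \<beta> assume "\<beta> \<in> B2"
    then have "age_generators A (\<M> \<beta>) E (0, 0, Poly_Mapping.single \<beta> 1) \<subseteq> ?C"
      "age_generators A (\<M> \<beta>) E (0, 0, Poly_Mapping.single \<beta> (- 1)) \<subseteq> ?C"
      by (auto intro!: circuit)
    moreover have "- F2 \<beta> = (0, 0, Poly_Mapping.single \<beta> (- 1))"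
      by (simp add: F2_def single_uminus)
    ultimately show "age_generators A (\<M> \<beta>) E (F2 \<beta>) + age_generators A (\<M> \<beta>) E (- F2 \<beta>) \<subseteq> ?C"
      by (intro set_plus_subset_closed[OF closed]) (simp_all add: F2_def)
  qed
  ultimately show "?R + ?D1 + ?D2 \<subseteq> ?C"
    by (intro set_plus_subset_closed[OF closed])
next
  show "?C \<subseteq> ?R + ?D1 + ?D2"
  proof
    fix x assume x: "x \<in> ?C"
    obtain c d1 d2 where x_eq: "x = (c, d1, d2)"
      by (cases x)
    have c: "c \<in> coord_space A" "\<forall>\<alpha>\<in>A. 0 \<le> Poly_Mapping.lookup c \<alpha>"
      and d1: "d1 \<in> coord_space B1" "\<forall>\<beta>\<in>B1. 0 \<le> Poly_Mapping.lookup d1 \<beta>"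
      and d2: "d2 \<in> coord_space B2" and sonc: "c - (d1 + d2) \<in> SONC"
      using x unfolding x_eq mem_SONC_cone_iff[OF fin] by auto
    define p where "p = c - (d1 + d2)"
    have p: "Poly_Mapping.lookup p \<alpha>
        = Poly_Mapping.lookup c \<alpha> - (Poly_Mapping.lookup d1 \<alpha> + Poly_Mapping.lookup d2 \<alpha>)" for \<alpha>
      by (simp add: p_def lookup_minus lookup_add)
    \<comment> \<open>With pairwise disjoint index sets every coefficient of \<open>p\<close> comes
      from exactly one of \<open>c\<close>, \<open>d1\<close> and \<open>d2\<close>, so
      \<open>B1 \<union> B2\<close> can serve as the set of possibly negative or odd
      exponents.\<close>
    have disj': "A \<inter> B2 = {}" "B1 \<inter> B2 = {}"
      using ev by auto
    have p_A: "Poly_Mapping.lookup p \<alpha> = Poly_Mapping.lookup c \<alpha>" if "\<alpha> \<notin> B1 \<union> B2" for \<alpha>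
      using that d1 d2 by (auto simp: p mem_coord_space_iff)
    have p_B1: "Poly_Mapping.lookup p \<beta> = - Poly_Mapping.lookup d1 \<beta>" if "\<beta> \<in> B1" for \<beta>
    proof -
      have "\<beta> \<notin> A" "\<beta> \<notin> B2"
        using that disj disj' by auto
      then show ?thesis
        using c(1) d2 by (simp add: p mem_coord_space_iff)
    qed
    have p_B2: "Poly_Mapping.lookup p \<beta> = - Poly_Mapping.lookup d2 \<beta>" if "\<beta> \<in> B2" for \<beta>
    proof -
      have "\<beta> \<notin> A" "\<beta> \<notin> B1"
        using that disj disj' by auto
      then show ?thesis
        using c(1) d1(1) by (simp add: p mem_coord_space_iff)
    qed
    have keys_p: "Poly_Mapping.keys p - (B1 \<union> B2) \<subseteq> A"
    proof
      fix \<alpha> assume "\<alpha> \<in> Poly_Mapping.keys p - (B1 \<union> B2)"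
      then have "Poly_Mapping.lookup c \<alpha> \<noteq> 0"
        using p_A[of \<alpha>] by (simp add: in_keys_iff)
      then show "\<alpha> \<in> A"
        using c(1) by (auto simp: mem_coord_space_iff)
    qed
    have pos: "0 \<le> Poly_Mapping.lookup p \<alpha>" if "\<alpha> \<notin> B1 \<union> B2" for \<alpha>
      using p_A[OF that] c by (cases "\<alpha> \<in> A") (auto simp: mem_coord_space_iff)
    have neg: "Poly_Mapping.lookup p \<beta> \<le> 0 \<or> \<beta> \<notin> even_exps" if "\<beta> \<in> B1 \<union> B2" for \<beta>
      using that p_B1 d1 ev by auto
    have "\<exists>h. (\<forall>\<beta>\<in>B1 \<union> B2. age \<beta> (h \<beta>) \<and> Poly_Mapping.lookup (h \<beta>) \<beta> = Poly_Mapping.lookup p \<beta>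
          \<and> Poly_Mapping.keys (h \<beta>) - {\<beta>} \<subseteq> Poly_Mapping.keys p - (B1 \<union> B2))
      \<and> (\<forall>\<alpha>. \<alpha> \<notin> B1 \<union> B2 \<longrightarrow> (\<Sum>\<beta>\<in>B1 \<union> B2. Poly_Mapping.lookup (h \<beta>) \<alpha>) \<le> Poly_Mapping.lookup p \<alpha>)"
      by (rule SONC_support_decomposition) (use sonc fin neg pos in \<open>simp_all add: p_def\<close>)
    then obtain h where h_all: "\<forall>\<beta>\<in>B1 \<union> B2. age \<beta> (h \<beta>) \<and> Poly_Mapping.lookup (h \<beta>) \<beta> = Poly_Mapping.lookup p \<beta>
          \<and> Poly_Mapping.keys (h \<beta>) - {\<beta>} \<subseteq> Poly_Mapping.keys p - (B1 \<union> B2)"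
      and h_le: "\<forall>\<alpha>. \<alpha> \<notin> B1 \<union> B2 \<longrightarrow> (\<Sum>\<beta>\<in>B1 \<union> B2. Poly_Mapping.lookup (h \<beta>) \<alpha>) \<le> Poly_Mapping.lookup p \<alpha>"
      by (elim exE conjE) (rule that)
    have h: "age \<beta> (h \<beta>)" "Poly_Mapping.lookup (h \<beta>) \<beta> = Poly_Mapping.lookup p \<beta>"
      "Poly_Mapping.keys (h \<beta>) - {\<beta>} \<subseteq> Poly_Mapping.keys p - (B1 \<union> B2)" if "\<beta> \<in> B1 \<union> B2" for \<beta>
      using bspec[OF h_all that] by auto
    have "\<forall>\<beta>\<in>B1 \<union> B2. \<exists>c'. (\<forall>\<alpha>\<in>A. c' \<alpha> \<le> Poly_Mapping.lookup (h \<beta>) \<alpha>) \<and>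
      (\<forall>F. (\<Sum>\<alpha>\<in>A. c' \<alpha> *\<^sub>R E \<alpha>) + \<bar>Poly_Mapping.lookup p \<beta>\<bar> *\<^sub>R F \<in> age_generators A (\<M> \<beta>) E F)"
    proof
      fix \<beta> assume \<beta>: "\<beta> \<in> B1 \<union> B2"
      then have \<beta>A: "\<beta> \<notin> A"
        using disj disj' by auto
      show "\<exists>c'. (\<forall>\<alpha>\<in>A. c' \<alpha> \<le> Poly_Mapping.lookup (h \<beta>) \<alpha>) \<and>
        (\<forall>F. (\<Sum>\<alpha>\<in>A. c' \<alpha> *\<^sub>R E \<alpha>) + \<bar>Poly_Mapping.lookup p \<beta>\<bar> *\<^sub>R F \<in> age_generators A (\<M> \<beta>) E F)"
      proof (rule age_generators_cover[OF fin(1) \<M>(1,2) ex])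
        show "0 \<le> Poly_Mapping.lookup (h \<beta>) \<alpha>" if "\<alpha> \<in> A" for \<alpha>
          using h(1)[OF \<beta>] that \<beta>A by (auto simp: age_def)
        have "Poly_Mapping.keys (h \<beta>) \<subseteq> insert \<beta> A"
          using h(3)[OF \<beta>] keys_p by blast
        then have "\<bar>Poly_Mapping.lookup (h \<beta>) \<beta>\<bar>
            \<le> (\<Sum>\<alpha>\<in>A. Poly_Mapping.lookup (h \<beta>) \<alpha> * exp ((real_exp \<alpha> - real_exp \<beta>) \<bullet> x))" for x
          using h(1)[OF \<beta>] fin(1) ev(1) \<beta>A neg[OF \<beta>] h(2)[OF \<beta>]
          by (intro nonneg_poly_dominated) (auto simp: age_def)
        then show "\<bar>Poly_Mapping.lookup p \<beta>\<bar>
            \<le> (\<Sum>\<alpha>\<in>A. Poly_Mapping.lookup (h \<beta>) \<alpha> * exp ((real_exp \<alpha> - real_exp \<beta>) \<bullet> x))" for x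
          unfolding h(2)[OF \<beta>] .
      qed auto
    qed
    from bchoice[OF this] obtain c' where c'_all: "\<forall>\<beta>\<in>B1 \<union> B2. (\<forall>\<alpha>\<in>A. c' \<beta> \<alpha> \<le> Poly_Mapping.lookup (h \<beta>) \<alpha>) \<and>
      (\<forall>F. (\<Sum>\<alpha>\<in>A. c' \<beta> \<alpha> *\<^sub>R E \<alpha>) + \<bar>Poly_Mapping.lookup p \<beta>\<bar> *\<^sub>R F \<in> age_generators A (\<M> \<beta>) E F)"
      by (elim exE) (rule that)
    have c'_le: "c' \<beta> \<alpha> \<le> Poly_Mapping.lookup (h \<beta>) \<alpha>" if "\<beta> \<in> B1 \<union> B2" "\<alpha> \<in> A" for \<beta> \<alpha>
      using bspec[OF c'_all that(1)] that(2) by simp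
    have c'_mem: "(\<Sum>\<alpha>\<in>A. c' \<beta> \<alpha> *\<^sub>R E \<alpha>) + \<bar>Poly_Mapping.lookup p \<beta>\<bar> *\<^sub>R F
        \<in> age_generators A (\<M> \<beta>) E F" if "\<beta> \<in> B1 \<union> B2" for \<beta> F
      using bspec[OF c'_all that, THEN conjunct2] by (rule spec)
    \<comment> \<open>What the circuits leave of \<open>c\<close>. It is nonnegative because
      \<open>c'\<close> is at most the coefficient of \<open>h\<close>, and these coefficients add
      up to at most that of \<open>c\<close>.\<close>
    define r where "r \<alpha> = Poly_Mapping.lookup c \<alpha> - (\<Sum>\<beta>\<in>B1 \<union> B2. c' \<beta> \<alpha>)" for \<alpha>
    define S where "S \<beta> = (\<Sum>\<alpha>\<in>A. c' \<beta> \<alpha> *\<^sub>R E \<alpha>)" for \<beta>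
    have "0 \<le> r \<alpha>" if \<alpha>: "\<alpha> \<in> A" for \<alpha>
    proof -
      have "\<alpha> \<notin> B1 \<union> B2"
        using \<alpha> disj disj' by auto
      moreover have "(\<Sum>\<beta>\<in>B1 \<union> B2. c' \<beta> \<alpha>) \<le> (\<Sum>\<beta>\<in>B1 \<union> B2. Poly_Mapping.lookup (h \<beta>) \<alpha>)"
        using c'_le \<alpha> by (intro sum_mono) auto
      ultimately show ?thesis
        using h_le[rule_format, of \<alpha>] p_A[of \<alpha>] by (simp add: r_def)
    qed
    then have R: "(\<Sum>\<alpha>\<in>A. r \<alpha> *\<^sub>R E \<alpha>) \<in> ?R"
      by (intro sum_mem_set_sum fin(1)) auto
    have D1: "(\<Sum>\<beta>\<in>B1. S \<beta> + Poly_Mapping.lookup d1 \<beta> *\<^sub>R F1 \<beta>) \<in> ?D1"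
    proof (rule sum_mem_set_sum[OF fin(2)])
      fix \<beta> assume \<beta>: "\<beta> \<in> B1"
      then show "S \<beta> + Poly_Mapping.lookup d1 \<beta> *\<^sub>R F1 \<beta> \<in> age_generators A (\<M> \<beta>) E (F1 \<beta>)"
        using c'_mem[of \<beta> "F1 \<beta>"] p_B1[OF \<beta>] d1(2) by (simp add: S_def)
    qed
    have D2: "(\<Sum>\<beta>\<in>B2. S \<beta> + Poly_Mapping.lookup d2 \<beta> *\<^sub>R F2 \<beta>) \<in> ?D2"
    proof (rule sum_mem_set_sum[OF fin(3)])
      fix \<beta> assume \<beta>: "\<beta> \<in> B2"
      have zero_mem: "0 \<in> age_generators A (\<M> \<beta>) E F" for F
        by (rule zero_mem_age_generators[OF fin(1) \<M>])
      show "S \<beta> + Poly_Mapping.lookup d2 \<beta> *\<^sub>R F2 \<beta>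
          \<in> age_generators A (\<M> \<beta>) E (F2 \<beta>) + age_generators A (\<M> \<beta>) E (- F2 \<beta>)"
      \<comment> \<open>The covering lemma only sees the absolute value of the coefficient; its sign
        selects the direction \<open>F2 \<beta>\<close> or \<open>- F2 \<beta>\<close>.\<close>
      proof (cases "0 \<le> Poly_Mapping.lookup d2 \<beta>")
        case True
        then have "S \<beta> + Poly_Mapping.lookup d2 \<beta> *\<^sub>R F2 \<beta> \<in> age_generators A (\<M> \<beta>) E (F2 \<beta>)"
          using c'_mem[of \<beta> "F2 \<beta>"] p_B2[OF \<beta>] \<beta> by (simp add: S_def)
        from set_plus_intro[OF this zero_mem] show ?thesis
          by simp
      next
        case False
        then have "S \<beta> + Poly_Mapping.lookup d2 \<beta> *\<^sub>R F2 \<beta> \<in> age_generators A (\<M> \<beta>) E (- F2 \<beta>)"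
          using c'_mem[of \<beta> "- F2 \<beta>"] p_B2[OF \<beta>] \<beta> by (simp add: S_def)
        from set_plus_intro[OF zero_mem this] show ?thesis
          by simp
      qed
    qed
    have coord: "(\<Sum>i\<in>I. Poly_Mapping.lookup q i *\<^sub>R Poly_Mapping.single i (1::real)) = q"
      if "finite I" "q \<in> coord_space I" for I and q :: "'n rpoly"
      using sum_single_lookup[OF that] by (simp add: single_scaleR[symmetric])
    have "(\<Sum>\<alpha>\<in>A. r \<alpha> *\<^sub>R E \<alpha>) = (\<Sum>\<alpha>\<in>A. Poly_Mapping.lookup c \<alpha> *\<^sub>R E \<alpha>) - (\<Sum>\<beta>\<in>B1 \<union> B2. S \<beta>)"
      unfolding r_def S_def scaleR_diff_left sum_subtractf scaleR_sum_left
      by (subst (2) sum.swap) simp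
    moreover have "(\<Sum>\<beta>\<in>B1 \<union> B2. S \<beta>) = (\<Sum>\<beta>\<in>B1. S \<beta>) + (\<Sum>\<beta>\<in>B2. S \<beta>)"
      using fin disj' by (intro sum.union_disjoint) auto
    moreover have "(\<Sum>\<alpha>\<in>A. Poly_Mapping.lookup c \<alpha> *\<^sub>R E \<alpha>) = (c, 0, 0)"
      "(\<Sum>\<beta>\<in>B1. Poly_Mapping.lookup d1 \<beta> *\<^sub>R F1 \<beta>) = (0, d1, 0)"
      "(\<Sum>\<beta>\<in>B2. Poly_Mapping.lookup d2 \<beta> *\<^sub>R F2 \<beta>) = (0, 0, d2)"
      using coord[OF fin(1) c(1)] coord[OF fin(2) d1(1)] coord[OF fin(3) d2]
      by (auto intro!: prod_eqI simp: E_def F1_def F2_def fst_sum snd_sum)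
    ultimately have "x = (\<Sum>\<alpha>\<in>A. r \<alpha> *\<^sub>R E \<alpha>)
        + (\<Sum>\<beta>\<in>B1. S \<beta> + Poly_Mapping.lookup d1 \<beta> *\<^sub>R F1 \<beta>)
        + (\<Sum>\<beta>\<in>B2. S \<beta> + Poly_Mapping.lookup d2 \<beta> *\<^sub>R F2 \<beta>)"
      by (simp add: x_eq sum.distrib)
    also have "\<dots> \<in> ?R + ?D1 + ?D2"
      by (intro set_plus_intro R D1 D2)
    finally show "x \<in> ?R + ?D1 + ?D2" .
  qed
qed

theorem theorem1p1:
  fixes A B1 B2 :: "(nat ^ 'n::finite) set"
  assumes "finite A"
    and "A \<subseteq> even_exps"
    and "B1 \<subseteq> {\<beta>. real_exp \<beta> \<in> newton A} \<inter> even_exps"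
    and "B2 \<subseteq> {\<beta>. real_exp \<beta> \<in> newton A} \<inter> (UNIV - even_exps)"
    and "A \<inter> B1 = {}"
  shows "admits_soc_representation (SONC_ambient A B1 B2) (SONC_cone A B1 B2)"
proof -
  have fin: "finite A" "finite B1" "finite B2"
    using assms(1,3,4) finite_subset[OF _ finite_lattice_points_newton[OF assms(1)]] by auto
  \<comment> \<open>The family may depend on \<beta> but not on the point of the cone; this
    uniformity makes the Minkowski sum finite.\<close>
  have "\<forall>\<beta>. \<exists>\<M>. finite \<M> \<and> (\<forall>m\<in>\<M>. circuit_weight A \<beta> m) \<and>
    (\<forall>\<nu>. (\<forall>\<alpha>\<in>A. 0 \<le> \<nu> \<alpha>) \<longrightarrow> (\<exists>\<alpha>\<in>A. \<nu> \<alpha> \<noteq> 0) \<longrightarrow>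
        (\<Sum>\<alpha>\<in>A. \<nu> \<alpha> *\<^sub>R (real_exp \<alpha> - real_exp \<beta>)) = 0 \<longrightarrow>
        (\<exists>m\<in>\<M>. \<forall>\<alpha>. 0 < m \<alpha> \<longrightarrow> \<nu> \<alpha> \<noteq> 0))"
    by (rule allI, rule ex_finite_circuit_family[OF fin(1)])
  from choice[OF this] obtain \<M> where \<M>_all: "\<forall>\<beta>. finite (\<M> \<beta>) \<and> (\<forall>m\<in>\<M> \<beta>. circuit_weight A \<beta> m) \<and>
    (\<forall>\<nu>. (\<forall>\<alpha>\<in>A. 0 \<le> \<nu> \<alpha>) \<longrightarrow> (\<exists>\<alpha>\<in>A. \<nu> \<alpha> \<noteq> 0) \<longrightarrow>
        (\<Sum>\<alpha>\<in>A. \<nu> \<alpha> *\<^sub>R (real_exp \<alpha> - real_exp \<beta>)) = 0 \<longrightarrow>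
        (\<exists>m\<in>\<M> \<beta>. \<forall>\<alpha>. 0 < m \<alpha> \<longrightarrow> \<nu> \<alpha> \<noteq> 0))"
    by (elim exE) (rule that)
  then have \<M>: "finite (\<M> \<beta>)" "m \<in> \<M> \<beta> \<Longrightarrow> circuit_weight A \<beta> m" for \<beta> m
    by simp_all
  have ex: "\<exists>m\<in>\<M> \<beta>. \<forall>\<alpha>. 0 < m \<alpha> \<longrightarrow> \<nu> \<alpha> \<noteq> 0"
    if "\<And>\<alpha>. \<alpha> \<in> A \<Longrightarrow> 0 \<le> \<nu> \<alpha>" "\<exists>\<alpha>\<in>A. \<nu> \<alpha> \<noteq> 0"
      "(\<Sum>\<alpha>\<in>A. \<nu> \<alpha> *\<^sub>R (real_exp \<alpha> - real_exp \<beta>)) = 0" for \<beta> \<nu>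
    by (rule \<M>_all[THEN spec, THEN conjunct2, THEN conjunct2, rule_format]) (fact that)+
  let ?V = "SONC_ambient A B1 B2"
  have V: "subspace ?V"
    unfolding SONC_ambient_def by (intro subspace_Times subspace_coord_space)
  have single: "Poly_Mapping.single \<alpha> (1::real) \<in> coord_space I" if "\<alpha> \<in> I" for \<alpha> :: "nat ^ 'n" and I
    using that by (auto simp: mem_coord_space_iff lookup_single when_def)
  have "soc3_representable ?V (SONC_cone A B1 B2)"
  proof (subst SONC_cone_generators[OF fin _ _ _ assms(5) \<M> ex])
    show "A \<subseteq> even_exps" "B1 \<subseteq> even_exps" "B2 \<inter> even_exps = {}"
      using assms(2-4) by auto
    show "soc3_representable ?V ((\<Sum>\<alpha>\<in>A. {t *\<^sub>R (Poly_Mapping.single \<alpha> 1, 0, 0) |t. 0 \<le> t})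
        + (\<Sum>\<beta>\<in>B1. age_generators A (\<M> \<beta>) (\<lambda>\<alpha>. (Poly_Mapping.single \<alpha> 1, 0, 0)) (0, Poly_Mapping.single \<beta> 1, 0))
        + (\<Sum>\<beta>\<in>B2. age_generators A (\<M> \<beta>) (\<lambda>\<alpha>. (Poly_Mapping.single \<alpha> 1, 0, 0)) (0, 0, Poly_Mapping.single \<beta> 1)
          + age_generators A (\<M> \<beta>) (\<lambda>\<alpha>. (Poly_Mapping.single \<alpha> 1, 0, 0)) (- (0, 0, Poly_Mapping.single \<beta> 1))))"
      by (intro soc3_representable_plus[OF V] soc3_representable_sum[OF V] soc3_representable_ray[OF V]
          soc3_representable_age_generators[OF fin(1) \<M>(2) V] subspace_neg[OF V])
        (auto simp: SONC_ambient_def single subspace_0[OF subspace_coord_space])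
  qed
  moreover have "convex_cone (SONC_cone A B1 B2)"
    unfolding convex_cone_iff
    using SONC_cone_zero[OF fin] SONC_cone_add[OF fin] SONC_cone_scaleR[OF fin] by blast
  moreover have "SONC_cone A B1 B2 \<subseteq> ?V"
    by (auto simp: SONC_cone_def)
  ultimately show ?thesis
    unfolding admits_soc_representation_def soc3_representable_def by (metis numeral_le_iff semiring_norm(68,69,71,72))
qed

end
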